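(* Let $d \geq 1$ be an integer, let $k$ be a field of characteristic $0$, and let $V$ be an $\mathrm{FI}_d$-module over $k$. For $1\le i\le d$ and $n\ge 0$ let $\phi^i_n : V_n \to V_{n+1}$ be the map induced by the pair consisting of the standard inclusion $[n]\hookrightarrow[n+1]$ and the coloring of $n+1$ by the color $i$. Then $V$ is finitely generated if and only if $V_n$ is finite dimensional for all $n\geq 0$ and the following three conditions hold: (1) for all $n \gg 0$, $\bigcap_{i=1}^d \ker \phi^i_n = \{0\}$; (2) for all $n\gg 0$, $\sum_{i=1}^d \phi^i_n(V_n)$ spans $V_{n+1}$ as an $\mathfrak{S}_{n+1}$-representation (i.e. the smallest $\mathfrak{S}_{n+1}$-subrepresentation containing it is $V_{n+1}$); (3) for any partition $\lambda$ and any integers $n_1 \geq \cdots \geq n_d \geq |\lambda|+\lambda_1$, writing $c_{\lambda,m_1,\ldots,m_d}$ for the multiplicity of $S(\lambda)_{m_1,\ldots,m_d}$ in $V_{(\sum_i m_i)-(d-1)|\lambda|}$, the quantity $c_{\lambda,n_1+l,\ldots,n_d+l}$ is independent of $l$ for $l\gg 0$.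
   Context: $\mathrm{FI}_d$ is the category whose objects are the sets $[n]=\{1,\ldots,n\}$, $n\ge 0$, and whose morphisms $[n]\to[m]$ are pairs $(f,g)$ with $f:[n]\to[m]$ an injection and $g:[m]\setminus \mathrm{im} f\to\{1,\ldots,d\}$ a map (a $d$-coloring of the complement of the image). Composition is $(f,g)\circ(f',g')=(f\circ f',h)$ with $h(x)=g(x)$ if $x\notin\mathrm{im} f$ and $h(x)=g'(f^{-1}(x))$ otherwise. An $\mathrm{FI}_d$-module over $k$ is a functor $V:\mathrm{FI}_d\to \mathrm{Mod}_k$; $V_n:=V([n])$, which is a $k[\mathfrak{S}_n]$-module since $\mathrm{End}_{\mathrm{FI}_d}([n])=\mathfrak{S}_n$. $V$ is finitely generated if there is a finite subset of $\bigsqcup_n V_n$ that is contained in no proper submodule of $V$; equivalently, $V$ is a quotient of a finite direct sum of modules $M(m)$, where $M(m)_n=k[\mathrm{Hom}_{\mathrm{FI}_d}([m],[n])]$. For a partition $\mu$ of $n$, $S^\mu$ is the irreducible $\mathfrak{S}_n$-representation over $k$ attached to $\mu$, with $S^{(n)}$ trivial. For a partition $\lambda=(\lambda_1,\ldots,\lambda_h)$ (the empty partition is allowed, with $|\lambda|=\lambda_1=0$), $|\lambda|=\sum_i\lambda_i$. For integers $n_1\ge\cdots\ge n_d\ge|\lambda|+\lambda_1$, $\lambda[n_1,\ldots,n_d]:=(n_1-|\lambda|,\ldots,n_d-|\lambda|,\lambda_1,\ldots,\lambda_h)$ (dropping zero entries), a partition of $(\sum_i n_i)-(d-1)|\lambda|$,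 and $S(\lambda)_{n_1,\ldots,n_d}:=S^{\lambda[n_1,\ldots,n_d]}$. *)

theory Defs
  imports
    Complex_Main
    "HOL-Library.FuncSet"
    "HOL-Library.Function_Algebras"
    "HOL-Combinatorics.Permutations"
begin

section \<open>The category \<open>FI_d\<close>\<close>

text \<open>
  The object \<open>[n]\<close> is \<open>{1..n}\<close>, represented by \<open>n\<close>; colours are \<open>{1..d}\<close>. Both components of a
  morphism are extensional functions, so that equality in HOL is equality of morphisms.
\<close>

type_synonym fi_mor = "(nat \<Rightarrow> nat) \<times> (nat \<Rightarrow> nat)"

definition FI_hom :: "nat \<Rightarrow> nat \<Rightarrow> nat \<Rightarrow> fi_mor set" where
  "FI_hom d m n =
    {(f, g). f \<in> {1..m} \<rightarrow>\<^sub>E {1..n} \<and> inj_on f {1..m} \<and> g \<in> ({1..n} - f ` {1..m}) \<rightarrow>\<^sub>E {1..d}}"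

definition FI_id :: "nat \<Rightarrow> fi_mor" where
  "FI_id n = (restrict id {1..n}, \<lambda>_. undefined)"

text \<open>
  \<open>FI_comp l m n \<alpha> \<beta>\<close> is \<open>\<alpha> \<circ> \<beta>\<close> for \<open>\<beta> : [l] \<rightarrow> [m]\<close> and \<open>\<alpha> : [m] \<rightarrow> [n]\<close>.
\<close>

definition FI_comp :: "nat \<Rightarrow> nat \<Rightarrow> nat \<Rightarrow> fi_mor \<Rightarrow> fi_mor \<Rightarrow> fi_mor" where
  "FI_comp l m n = (\<lambda>(f, g) (f', g').
     (compose {1..l} f f',
      \<lambda>x\<in>{1..n} - (f \<circ> f') ` {1..l}.
        if x \<notin> f ` {1..m} then g x else g' (inv_into {1..m} f x)))"

lemma FI_id_in_hom: "FI_id n \<in> FI_hom d n n"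
  by (auto simp: FI_id_def FI_hom_def inj_on_def)

lemma FI_comp_in_hom:
  assumes "\<alpha> \<in> FI_hom d m n" "\<beta> \<in> FI_hom d l m"
  shows "FI_comp l m n \<alpha> \<beta> \<in> FI_hom d l n"
proof -
  obtain f g f' g' where ab: "\<alpha> = (f, g)" "\<beta> = (f', g')"
    by (cases \<alpha>, cases \<beta>)
  have f: "f \<in> {1..m} \<rightarrow>\<^sub>E {1..n}" "inj_on f {1..m}" "g \<in> ({1..n} - f ` {1..m}) \<rightarrow>\<^sub>E {1..d}"
    and f': "f' \<in> {1..l} \<rightarrow>\<^sub>E {1..m}" "inj_on f' {1..l}" "g' \<in> ({1..m} - f' ` {1..l}) \<rightarrow>\<^sub>E {1..d}"
    using assms unfolding ab FI_hom_def by blast+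
  have sub: "f' ` {1..l} \<subseteq> {1..m}"
    using f' by auto
  have img: "compose {1..l} f f' ` {1..l} = (f \<circ> f') ` {1..l}"
    by (simp add: compose_def cong: image_cong_simp)
  have "inj_on (f \<circ> f') {1..l}"
    by (rule comp_inj_on[OF f'(2) inj_on_subset[OF f(2) sub]])
  then have inj: "inj_on (compose {1..l} f f') {1..l}"
    unfolding compose_def inj_on_restrict_eq comp_def .
  have into: "compose {1..l} f f' \<in> {1..l} \<rightarrow>\<^sub>E {1..n}"
    unfolding compose_def restrict_PiE_iff by (intro ballI PiE_mem[OF f(1)] PiE_mem[OF f'(1)])
  have col: "(if x \<notin> f ` {1..m} then g x else g' (inv_into {1..m} f x)) \<in> {1..d}"
    if x: "x \<in> {1..n} - (f \<circ> f') ` {1..l}" for x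
  proof (cases "x \<in> f ` {1..m}")
    case True
    have "inv_into {1..m} f x \<notin> f' ` {1..l}"
    proof
      assume "inv_into {1..m} f x \<in> f' ` {1..l}"
      then have "f (inv_into {1..m} f x) \<in> f ` f' ` {1..l}"
        by (rule imageI)
      then show False
        using x unfolding f_inv_into_f[OF True] image_comp by blast
    qed
    then have "g' (inv_into {1..m} f x) \<in> {1..d}"
      by (intro PiE_mem[OF f'(3)] DiffI inv_into_into[OF True])
    then show ?thesis
      by (simp only: True not_True_eq_False if_False)
  next
    case False
    then have "g x \<in> {1..d}"
      using x by (intro PiE_mem[OF f(3)]) blast
    then show ?thesis
      by (simp only: False not_False_eq_True if_True)
  qed
  show ?thesis
    unfolding FI_hom_def FI_comp_def ab prod.case mem_Collect_eq img
    unfolding restrict_PiE_iff by (intro conjI inj into ballI col)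
qed

definition FI_perm :: "nat \<Rightarrow> (nat \<Rightarrow> nat) \<Rightarrow> fi_mor" where
  "FI_perm n \<sigma> = (restrict \<sigma> {1..n}, \<lambda>_. undefined)"

definition FI_incl :: "nat \<Rightarrow> nat \<Rightarrow> fi_mor" where
  "FI_incl i n = (restrict id {1..n}, \<lambda>x\<in>{n + 1}. i)"

lemma FI_perm_in_hom: "\<sigma> permutes {1..n} \<Longrightarrow> FI_perm n \<sigma> \<in> FI_hom d n n"
  using permutes_image[of \<sigma> "{1..n}"] permutes_inj_on[of \<sigma> "{1..n}" "{1..n}"]
  by (auto simp: FI_perm_def FI_hom_def)

lemma FI_incl_in_hom: "i \<in> {1..d} \<Longrightarrow> FI_incl i n \<in> FI_hom d n (n + 1)"
  by (auto simp: FI_incl_def FI_hom_def inj_on_def PiE_iff extensional_def)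


section \<open>Modules over \<open>FI_d\<close>\<close>

definition linear_on ::
    "('k \<Rightarrow> 'v::ab_group_add \<Rightarrow> 'v) \<Rightarrow> ('k \<Rightarrow> 'w::ab_group_add \<Rightarrow> 'w) \<Rightarrow> 'v set \<Rightarrow> ('v \<Rightarrow> 'w) \<Rightarrow> bool"
  where
  "linear_on s s' U f \<longleftrightarrow>
    (\<forall>x\<in>U. \<forall>y\<in>U. f (x + y) = f x + f y) \<and> (\<forall>c. \<forall>x\<in>U. f (s c x) = s' c (f x))"

text \<open>
  The spaces \<open>V n\<close> are subspaces of one ambient space, for which one can always take their
  direct sum; they may overlap, and \<open>act m n \<alpha>\<close> is meaningful on \<open>V m\<close> only.
\<close>

locale FI_module = vector_space scale
  for scale :: "'k::field \<Rightarrow> 'v::ab_group_add \<Rightarrow> 'v" +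
  fixes d :: nat
    and V :: "nat \<Rightarrow> 'v set"
    and act :: "nat \<Rightarrow> nat \<Rightarrow> fi_mor \<Rightarrow> 'v \<Rightarrow> 'v"
  assumes subspace_V: "subspace (V n)"
    and act_in: "\<alpha> \<in> FI_hom d m n \<Longrightarrow> x \<in> V m \<Longrightarrow> act m n \<alpha> x \<in> V n"
    and act_linear: "\<alpha> \<in> FI_hom d m n \<Longrightarrow> linear_on scale scale (V m) (act m n \<alpha>)"
    and act_id: "x \<in> V n \<Longrightarrow> act n n (FI_id n) x = x"
    and act_comp: "\<alpha> \<in> FI_hom d m n \<Longrightarrow> \<beta> \<in> FI_hom d l m \<Longrightarrow> x \<in> V l \<Longrightarrow>
      act l n (FI_comp l m n \<alpha> \<beta>) x = act m n \<alpha> (act l m \<beta> x)"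
begin

definition submodule :: "(nat \<Rightarrow> 'v set) \<Rightarrow> bool" where
  "submodule W \<longleftrightarrow>
    (\<forall>n. subspace (W n) \<and> W n \<subseteq> V n) \<and>
    (\<forall>m n. \<forall>\<alpha>\<in>FI_hom d m n. act m n \<alpha> ` W m \<subseteq> W n)"

text \<open>\<open>Sigma UNIV V\<close> is the disjoint union of the sets \<open>V n\<close>.\<close>

definition finitely_generated :: bool where
  "finitely_generated \<longleftrightarrow>
    (\<exists>S. finite S \<and> S \<subseteq> Sigma UNIV V \<and>
      (\<forall>W. submodule W \<and> S \<subseteq> Sigma UNIV W \<longrightarrow> W = V))"

end

definition finite_dimensional :: "('k::field \<Rightarrow> 'v::ab_group_add \<Rightarrow> 'v) \<Rightarrow> 'v set \<Rightarrow> bool" where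
  "finite_dimensional scale U \<longleftrightarrow> (\<exists>B. finite B \<and> B \<subseteq> U \<and> module.span scale B = U)"

definition perm_act ::
    "(nat \<Rightarrow> nat \<Rightarrow> fi_mor \<Rightarrow> 'v \<Rightarrow> 'v) \<Rightarrow> nat \<Rightarrow> (nat \<Rightarrow> nat) \<Rightarrow> 'v \<Rightarrow> 'v" where
  "perm_act act n \<sigma> = act n n (FI_perm n \<sigma>)"

definition phi :: "(nat \<Rightarrow> nat \<Rightarrow> fi_mor \<Rightarrow> 'v \<Rightarrow> 'v) \<Rightarrow> nat \<Rightarrow> nat \<Rightarrow> 'v \<Rightarrow> 'v" where
  "phi act i n = act n (n + 1) (FI_incl i n)"


section \<open>Representations of symmetric groups\<close>

text \<open>
  A representation of the symmetric group on \<open>{1..n}\<close> is given by a subspace \<open>U\<close> of an ambient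
  space with scalar multiplication \<open>s\<close>, and an action \<open>\<rho> \<sigma>\<close> on \<open>U\<close> for each \<open>\<sigma> permutes {1..n}\<close>.
\<close>

definition subrep ::
    "('k::field \<Rightarrow> 'v::ab_group_add \<Rightarrow> 'v) \<Rightarrow> nat \<Rightarrow> ((nat \<Rightarrow> nat) \<Rightarrow> 'v \<Rightarrow> 'v) \<Rightarrow> 'v set \<Rightarrow> 'v set \<Rightarrow> bool"
  where
  "subrep s n \<rho> U W \<longleftrightarrow>
    W \<subseteq> U \<and> module.subspace s W \<and> (\<forall>\<sigma>. \<sigma> permutes {1..n} \<longrightarrow> \<rho> \<sigma> ` W \<subseteq> W)"

definition subrep_generated ::
    "('k::field \<Rightarrow> 'v::ab_group_add \<Rightarrow> 'v) \<Rightarrow> nat \<Rightarrow> ((nat \<Rightarrow> nat) \<Rightarrow> 'v \<Rightarrow> 'v) \<Rightarrow> 'v set \<Rightarrow> 'v set \<Rightarrow> 'v set"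
  where
  "subrep_generated s n \<rho> U X = \<Inter>{W. subrep s n \<rho> U W \<and> X \<subseteq> W}"

definition irreducible_rep ::
    "('k::field \<Rightarrow> 'v::ab_group_add \<Rightarrow> 'v) \<Rightarrow> nat \<Rightarrow> ((nat \<Rightarrow> nat) \<Rightarrow> 'v \<Rightarrow> 'v) \<Rightarrow> 'v set \<Rightarrow> bool"
  where
  "irreducible_rep s n \<rho> U \<longleftrightarrow>
    U \<noteq> {0} \<and> (\<forall>W. subrep s n \<rho> U W \<longrightarrow> W = {0} \<or> W = U)"

definition rep_iso ::
    "nat \<Rightarrow> ('k::field \<Rightarrow> 'v::ab_group_add \<Rightarrow> 'v) \<Rightarrow> ((nat \<Rightarrow> nat) \<Rightarrow> 'v \<Rightarrow> 'v) \<Rightarrow> 'v set \<Rightarrow>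
     ('k \<Rightarrow> 'w::ab_group_add \<Rightarrow> 'w) \<Rightarrow> ((nat \<Rightarrow> nat) \<Rightarrow> 'w \<Rightarrow> 'w) \<Rightarrow> 'w set \<Rightarrow> bool"
  where
  "rep_iso n s \<rho> U s' \<rho>' U' \<longleftrightarrow>
    (\<exists>f. bij_betw f U U' \<and> linear_on s s' U f \<and>
      (\<forall>\<sigma>. \<sigma> permutes {1..n} \<longrightarrow> (\<forall>x\<in>U. f (\<rho> \<sigma> x) = \<rho>' \<sigma> (f x))))"

definition irreducible_decomposition ::
    "('k::field \<Rightarrow> 'v::ab_group_add \<Rightarrow> 'v) \<Rightarrow> nat \<Rightarrow> ((nat \<Rightarrow> nat) \<Rightarrow> 'v \<Rightarrow> 'v) \<Rightarrow> 'v set \<Rightarrow>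
     nat \<Rightarrow> (nat \<Rightarrow> 'v set) \<Rightarrow> bool"
  where
  "irreducible_decomposition s n \<rho> U r W \<longleftrightarrow>
    (\<forall>i<r. subrep s n \<rho> U (W i) \<and> irreducible_rep s n \<rho> (W i)) \<and>
    (\<forall>u\<in>U. \<exists>!w. w \<in> (\<Pi>\<^sub>E i\<in>{..<r}. W i) \<and> u = (\<Sum>i<r. w i))"

text \<open>
  The number of summands isomorphic to \<open>(s', \<rho>', S)\<close> in a decomposition of \<open>U\<close> into irreducibles.
  It is only meant for \<open>U\<close> finite-dimensional in characteristic \<open>0\<close>, where such decompositions
  exist and this number is the same for all of them.
\<close>

definition rep_multiplicity ::
    "nat \<Rightarrow> ('k::field \<Rightarrow> 'w::ab_group_add \<Rightarrow> 'w) \<Rightarrow> ((nat \<Rightarrow> nat) \<Rightarrow> 'w \<Rightarrow> 'w) \<Rightarrow> 'w set \<Rightarrow>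
     ('k \<Rightarrow> 'v::ab_group_add \<Rightarrow> 'v) \<Rightarrow> ((nat \<Rightarrow> nat) \<Rightarrow> 'v \<Rightarrow> 'v) \<Rightarrow> 'v set \<Rightarrow> nat"
  where
  "rep_multiplicity n s' \<rho>' S s \<rho> U =
    (THE c. \<exists>r W. irreducible_decomposition s n \<rho> U r W \<and>
      c = card {i \<in> {..<r}. rep_iso n s' \<rho>' S s \<rho> (W i)})"


section \<open>Partitions and Specht modules\<close>

definition is_partition :: "nat list \<Rightarrow> bool" where
  "is_partition \<mu> \<longleftrightarrow> sorted_wrt (\<ge>) \<mu> \<and> 0 \<notin> set \<mu>"

definition young_diagram :: "nat list \<Rightarrow> (nat \<times> nat) set" where
  "young_diagram \<mu> = {(i, j). i < length \<mu> \<and> j < \<mu> ! i}"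

text \<open>Only the values of a tableau on the cells of the diagram matter.\<close>

definition tableau :: "nat list \<Rightarrow> (nat \<times> nat \<Rightarrow> nat) \<Rightarrow> bool" where
  "tableau \<mu> t \<longleftrightarrow> bij_betw t (young_diagram \<mu>) {1..sum_list \<mu>}"

text \<open>The tabloid of a tableau, as the sequence of the sets of entries of its rows.\<close>

definition tabloid :: "nat list \<Rightarrow> (nat \<times> nat \<Rightarrow> nat) \<Rightarrow> nat \<Rightarrow> nat set" where
  "tabloid \<mu> t i = t ` {c \<in> young_diagram \<mu>. fst c = i}"

definition column_stabilizer :: "nat list \<Rightarrow> (nat \<times> nat \<Rightarrow> nat) \<Rightarrow> (nat \<Rightarrow> nat) set" where
  "column_stabilizer \<mu> t = {\<pi>. \<pi> permutes {1..sum_list \<mu>} \<and>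
    (\<forall>j. \<pi> ` t ` {c \<in> young_diagram \<mu>. snd c = j} = t ` {c \<in> young_diagram \<mu>. snd c = j})}"

text \<open>
  Linear combinations of tabloids are represented by their coefficient functions. The polytabloid
  of \<open>t\<close> is the sum of \<open>sign \<pi>\<close> times the tabloid of \<open>\<pi> \<circ> t\<close> over the column stabilizer of \<open>t\<close>.
\<close>

definition polytabloid :: "nat list \<Rightarrow> (nat \<times> nat \<Rightarrow> nat) \<Rightarrow> (nat \<Rightarrow> nat set) \<Rightarrow> 'k::field" where
  "polytabloid \<mu> t T =
    (\<Sum>\<pi>\<in>column_stabilizer \<mu> t. if tabloid \<mu> (\<pi> \<circ> t) = T then of_int (sign \<pi>) else 0)"

definition fun_scale :: "'k::field \<Rightarrow> ('a \<Rightarrow> 'k) \<Rightarrow> 'a \<Rightarrow> 'k" where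
  "fun_scale c v = (\<lambda>x. c * v x)"

definition specht :: "nat list \<Rightarrow> ((nat \<Rightarrow> nat set) \<Rightarrow> 'k::field) set" where
  "specht \<mu> = module.span fun_scale {polytabloid \<mu> t |t. tableau \<mu> t}"

text \<open>The linear extension of \<open>T \<mapsto> \<sigma> T\<close>, applying \<open>\<sigma>\<close> to all entries of a tabloid \<open>T\<close>.\<close>

definition tabloid_act ::
    "(nat \<Rightarrow> nat) \<Rightarrow> ((nat \<Rightarrow> nat set) \<Rightarrow> 'k::field) \<Rightarrow> (nat \<Rightarrow> nat set) \<Rightarrow> 'k" where
  "tabloid_act \<sigma> v = (\<lambda>T. v (\<lambda>i. inv \<sigma> ` T i))"

definition specht_multiplicity ::
    "nat list \<Rightarrow> ('k::field \<Rightarrow> 'v::ab_group_add \<Rightarrow> 'v) \<Rightarrow> ((nat \<Rightarrow> nat) \<Rightarrow> 'v \<Rightarrow> 'v) \<Rightarrow> 'v set \<Rightarrow> nat"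
  where
  "specht_multiplicity \<mu> s \<rho> U =
    rep_multiplicity (sum_list \<mu>) fun_scale tabloid_act (specht \<mu>) s \<rho> U"

definition first_part :: "nat list \<Rightarrow> nat" where
  "first_part \<mu> = (case \<mu> of [] \<Rightarrow> 0 | a # _ \<Rightarrow> a)"

text \<open>\<open>padded_partition \<lambda> [n\<^sub>1, \<dots>, n\<^sub>d]\<close> is the partition \<open>\<lambda>[n\<^sub>1, \<dots>, n\<^sub>d]\<close>.\<close>

definition padded_partition :: "nat list \<Rightarrow> nat list \<Rightarrow> nat list" where
  "padded_partition \<mu> ns = filter (\<lambda>a. a \<noteq> 0) (map (\<lambda>m. m - sum_list \<mu>) ns @ \<mu>)"

definition padded_multiplicity ::
    "('k::field \<Rightarrow> 'v::ab_group_add \<Rightarrow> 'v) \<Rightarrow> nat \<Rightarrow> (nat \<Rightarrow> 'v set) \<Rightarrow>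
     (nat \<Rightarrow> nat \<Rightarrow> fi_mor \<Rightarrow> 'v \<Rightarrow> 'v) \<Rightarrow> nat list \<Rightarrow> nat list \<Rightarrow> nat"
  where
  "padded_multiplicity scale d V act \<mu> ms =
    (let N = sum_list ms - (d - 1) * sum_list \<mu>
     in specht_multiplicity (padded_partition \<mu> ms) scale (perm_act act N) (V N))"

lemma sum_list_padded_partition:
  assumes "ns \<noteq> []" "\<forall>m\<in>set ns. sum_list \<mu> \<le> m"
  shows "sum_list (padded_partition \<mu> ns) = sum_list ns - (length ns - 1) * sum_list \<mu>"
proof -
  have *: "sum_list (filter (\<lambda>a. a \<noteq> 0) xs) = sum_list xs" for xs :: "nat list"
    by (induction xs) auto
  have **: "sum_list (map (\<lambda>m. m - sum_list \<mu>) ns) + length ns * sum_list \<mu> = sum_list ns"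
    using assms(2) by (induction ns) auto
  show ?thesis
    using ** assms(1) unfolding padded_partition_def *
    by (cases ns) auto
qed

end

theory Submission
  imports
    Defs
    "HOL-Library.Sublist"
    "HOL-Library.List_Lexorder"
    "HOL-Library.Infinite_Set"
begin

text \<open>
  Finite dimensionality together with (2) is equivalent to finite generation by an elementary
  argument, so it remains to deduce (1) and (3) from finite generation.

  The images of finitely many generators under all morphisms span \<open>V\<close>, and they are indexed by
  words in which a morphism inserts letters. Since words are well-quasi-ordered under insertion, a
  Groebner basis argument shows that torsion is confined to finitely many degrees, which is (1).

  For (3), the multiplicity of \<open>S\<^sup>\<mu>\<close> in \<open>V n\<close> is the dimension of the space of equivariant maps
  \<open>V n \<rightarrow> S\<^sup>\<mu>\<close>. Raising \<open>l\<close> by one inserts a column of height \<open>d\<close> into the diagram. Inserting \<open>d\<close>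
  new points, one of each colour, antisymmetrizing over them and deleting the new column from the
  tabloids turns equivariant maps for \<open>l + 1\<close> into equivariant maps for \<open>l\<close>. This is injective once
  \<open>l\<close> exceeds the degrees of the generators: a column of height \<open>d\<close> disjoint from the image of a
  morphism must contain each colour exactly once in order to survive antisymmetrization. So the
  multiplicities eventually decrease, hence are eventually constant.
\<close>

section \<open>Higman's lemma\<close>

text \<open>The field need not be algebraically closed, so multiplicities count equivariant maps
  only because a Specht module has no endomorphisms other than scalars. This and irreducibility rest
  on one fact: the column antisymmetrizer of a tableau maps the Specht module into the line of its
  polytabloid. The same fact controls the values of equivariant maps on antisymmetrized vectors in
  (3). The new column is inserted at index \<lambda>_1, the first part of \<lambda>. From there on
  every column has height at most \<open>d\<close>, and after the insertion at least l + 1 of them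
  have height exactly \<open>d\<close>. The image of a morphism from [m] with m \<le> l cannot meet
  them all; this is where the bound on \<open>l\<close> comes from. For (1), the images of the
  generators are in general linearly dependent, so the leading term of a vector cannot be read off
  from an expansion. It is the least bound such that the vector lies in the span of the terms up to
  it. A torsion element then yields, in a higher degree, a leading term that lies in the span of
  smaller ones.\<close>

definition bad_seq :: "'a set \<Rightarrow> (nat \<Rightarrow> 'a list) \<Rightarrow> bool" where
  "bad_seq A f \<longleftrightarrow> (\<forall>i. set (f i) \<subseteq> A) \<and> (\<forall>i j. i < j \<longrightarrow> \<not> subseq (f i) (f j))"

text \<open>Nash-Williams: each stage \<open>F n\<close> is a bad sequence; stage n + 1 keeps the
  first \<open>n\<close> words of stage \<open>n\<close> and makes word \<open>n\<close> as short as
  possible among the bad continuations. The diagonal \<open>g\<close> agrees with \<open>F m\<close>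
  below \<open>m\<close>, so it is bad and minimal at every place.\<close>

lemma minimal_bad_seq:
  assumes "bad_seq A f"
  shows "\<exists>g. bad_seq A g \<and>
    (\<forall>h n. bad_seq A h \<longrightarrow> (\<forall>i<n. h i = g i) \<longrightarrow> length (g n) \<le> length (h n))"
proof -
  let ?Q = "\<lambda>n F F'. (\<forall>i<n. F' i = F i) \<and>
    (\<forall>h. bad_seq A h \<longrightarrow> (\<forall>i<n. h i = F i) \<longrightarrow> length (F' n) \<le> length (h n))"
  have "\<exists>F. \<forall>n. bad_seq A (F n) \<and> ?Q n (F n) (F (Suc n))"
  proof (rule dependent_nat_choice)
    show "\<exists>F. bad_seq A F"
      using assms by blast
    fix F n assume F: "bad_seq A F"
    let ?P = "\<lambda>h. bad_seq A h \<and> (\<forall>i<n. h i = F i)"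
    have "?P (arg_min (\<lambda>h. length (h n)) ?P) \<and>
      (\<forall>h. ?P h \<longrightarrow> length (arg_min (\<lambda>h. length (h n)) ?P n) \<le> length (h n))"
      by (rule arg_min_nat_lemma[of ?P F]) (use F in simp)
    then show "\<exists>F'. bad_seq A F' \<and> ?Q n F F'"
      by blast
  qed
  then obtain F where F: "\<And>n. bad_seq A (F n)" and Q: "\<And>n. ?Q n (F n) (F (Suc n))"
    by blast
  define g where "g n = F (Suc n) n" for n
  have stable: "F (Suc (n + k)) n = g n" for n k
    by (induction k) (use Q in \<open>auto simp: g_def\<close>)
  have stable': "F m i = g i" if "i < m" for m i
    using stable[of i "m - Suc i"] that by simp
  have "bad_seq A g"
      unfolding bad_seq_def
  proof (intro conjI allI impI)
    show "set (g i) \<subseteq> A" for i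
      using F[of "Suc i"] by (simp add: g_def bad_seq_def)
    fix i j :: nat assume "i < j"
    then show "\<not> subseq (g i) (g j)"
      using F[of "Suc j"] stable'[of i "Suc j"] stable'[of j "Suc j"]
      unfolding bad_seq_def by (metis less_SucI lessI)
  qed
  moreover have "length (g n) \<le> length (h n)" if "bad_seq A h" "\<forall>i<n. h i = g i" for h n
  proof -
    have "\<forall>i<n. h i = F n i"
      using that(2) stable' by metis
    then show ?thesis
      using Q[of n] that(1) unfolding g_def by blast
  qed
  ultimately show ?thesis
    by blast
qed

text \<open>Infinitely many words of a minimal bad sequence start with the same letter
  \<open>a\<close>. Keeping the words before the first of these and continuing with the tails of
  these words gives a sequence that is still bad, but has a shorter word at place
  \<open>m\<close>.\<close>

theorem higman:
  assumes "finite A" "\<And>i. set (f i) \<subseteq> A"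
  obtains i j :: nat where "i < j" "subseq (f i) (f j)"
proof (rule ccontr)
  assume "\<not> thesis"
  then have "bad_seq A f"
    using assms that by (auto simp: bad_seq_def)
  then obtain g where g: "bad_seq A g" and
    minimal: "\<And>h n. bad_seq A h \<Longrightarrow> \<forall>i<n. h i = g i \<Longrightarrow> length (g n) \<le> length (h n)"
    using minimal_bad_seq by blast
  have ne: "g i \<noteq> []" for i
    using g by (metis bad_seq_def lessI list_emb_Nil)
  have gA: "set (g i) \<subseteq> A" for i
    using g unfolding bad_seq_def by blast
  have hd: "hd (g i) \<in> A" for i
    using gA hd_in_set[OF ne[of i]] by blast
  obtain a where "infinite {i. hd (g i) = a}"
    using pigeonhole_infinite[of UNIV "\<lambda>i. hd (g i)"] hd finite_subset[OF _ assms(1), of "range (\<lambda>i. hd (g i))"]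
    by auto
  then obtain r :: "nat \<Rightarrow> nat" where r: "strict_mono r" "\<And>k. hd (g (r k)) = a"
    using infinite_enumerate[of "{i. hd (g i) = a}"] by auto
  define m where "m = r 0"
  define h where "h n = (if n < m then g n else tl (g (r (n - m))))" for n
  have tl_sub: "subseq (g i) (g (r k))" if "subseq (g i) (tl (g (r k)))" for i k
    using that ne[of "r k"] by (cases "g (r k)") auto
  have "bad_seq A h"
    unfolding bad_seq_def
  proof (intro conjI allI impI)
    show "set (h i) \<subseteq> A" for i
      using gA[of i] gA[of "r (i - m)"] list.set_sel(2)[OF ne[of "r (i - m)"]] by (auto simp: h_def)
    fix i j :: nat assume ij: "i < j"
    show "\<not> subseq (h i) (h j)"
    proof
      assume s: "subseq (h i) (h j)"
      consider "j < m" | "i < m" "m \<le> j" | "m \<le> i"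
        by linarith
      then show False
      proof cases
        case 1
        then show False using s ij g by (simp add: h_def bad_seq_def)
      next
        \<comment> \<open>A kept word that embeds in a tail embeds in the whole word, and that word
          stands later in \<open>g\<close> because all values of \<open>r\<close> are at least
          \<open>m\<close>.\<close>
        case 2
        then have "subseq (g i) (g (r (j - m)))"
          using s tl_sub by (simp add: h_def)
        moreover have "i < r (j - m)"
          using 2 strict_mono_less_eq[OF r(1), of 0 "j - m"] by (simp add: m_def)
        ultimately show False
          using g unfolding bad_seq_def by blast
      next
        case 3
        then have "subseq (tl (g (r (i - m)))) (tl (g (r (j - m))))"
          using s ij by (simp add: h_def)
        then have "subseq (a # tl (g (r (i - m)))) (a # tl (g (r (j - m))))"
          by simp
        then have "subseq (g (r (i - m))) (g (r (j - m)))"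
          using ne r(2) by (metis list.collapse)
        moreover have "r (i - m) < r (j - m)"
          using 3 ij strict_monoD[OF r(1), of "i - m" "j - m"] by simp
        ultimately show False
          using g unfolding bad_seq_def by blast
      qed
    qed
  qed
  then have "length (g m) \<le> length (h m)"
    by (rule minimal) (simp add: h_def)
  then show False
    using ne[of m] by (cases "g m") (auto simp: h_def m_def)
qed

lemma subseq_embedding:
  assumes "subseq xs ys"
  shows "\<exists>h. strict_mono_on {..<length xs} h \<and> (\<forall>i<length xs. h i < length ys \<and> ys ! h i = xs ! i)"
  using assms
proof (induction rule: list_emb.induct)
  case (list_emb_Nil ys)
  show ?case by (auto simp: strict_mono_on_def)
next
  case (list_emb_Cons xs ys y)
  then obtain h where "strict_mono_on {..<length xs} h"
    "\<forall>i<length xs. h i < length ys \<and> ys ! h i = xs ! i" by blast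
  then show ?case
    by (intro exI[of _ "\<lambda>i. Suc (h i)"]) (auto simp: strict_mono_on_def)
next
  case (list_emb_Cons2 x y xs ys)
  then obtain h where "strict_mono_on {..<length xs} h"
    "\<forall>i<length xs. h i < length ys \<and> ys ! h i = xs ! i" by blast
  then show ?case using list_emb_Cons2(1)
    by (intro exI[of _ "\<lambda>i. case i of 0 \<Rightarrow> 0 | Suc i \<Rightarrow> Suc (h i)"])
      (auto simp: strict_mono_on_def split: nat.split)
qed

section \<open>Morphisms of \<open>FI_d\<close>\<close>

lemma FI_hom_iff:
  "(f, g) \<in> FI_hom d m n \<longleftrightarrow>
    f \<in> {1..m} \<rightarrow>\<^sub>E {1..n} \<and> inj_on f {1..m} \<and> g \<in> ({1..n} - f ` {1..m}) \<rightarrow>\<^sub>E {1..d}"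
  by (simp add: FI_hom_def)

lemma finite_FI_hom: "finite (FI_hom d m n)"
proof (rule finite_subset)
  show "FI_hom d m n \<subseteq> ({1..m} \<rightarrow>\<^sub>E {1..n}) \<times> (\<Union>A\<in>Pow {1..n}. A \<rightarrow>\<^sub>E {1..d})"
    by (auto simp: FI_hom_def)
qed (intro finite_cartesian_product finite_UN_I finite_PiE; auto intro: finite_subset)

lemma fst_FI_comp: "x \<in> {1..l} \<Longrightarrow> fst (FI_comp l m n \<alpha> \<beta>) x = fst \<alpha> (fst \<beta> x)"
  by (simp add: FI_comp_def compose_def split: prod.split)

lemma snd_FI_comp:
  assumes "\<alpha> \<in> FI_hom d m n" "y \<in> {1..n}" "y \<notin> fst \<alpha> ` fst \<beta> ` {1..l}"
  shows "snd (FI_comp l m n \<alpha> \<beta>) y =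
    (if y \<notin> fst \<alpha> ` {1..m} then snd \<alpha> y else snd \<beta> (inv_into {1..m} (fst \<alpha>) y))"
  using assms(2,3) by (simp add: FI_comp_def image_comp case_prod_unfold comp_def)

lemma fst_FI_hom_image: "\<alpha> \<in> FI_hom d m n \<Longrightarrow> fst \<alpha> ` {1..m} \<subseteq> {1..n}"
  by (cases \<alpha>) (auto simp: FI_hom_iff)

lemma inj_fst_FI_hom: "\<alpha> \<in> FI_hom d m n \<Longrightarrow> inj_on (fst \<alpha>) {1..m}"
  by (cases \<alpha>) (auto simp: FI_hom_iff)

lemma snd_FI_hom:
  "\<alpha> \<in> FI_hom d m n \<Longrightarrow> y \<in> {1..n} \<Longrightarrow> y \<notin> fst \<alpha> ` {1..m} \<Longrightarrow> snd \<alpha> y \<in> {1..d}"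
  by (cases \<alpha>) (auto simp: FI_hom_iff)

lemma FI_hom_eqI:
  assumes "\<alpha> \<in> FI_hom d m n" "\<beta> \<in> FI_hom d m n"
    and f: "\<And>x. x \<in> {1..m} \<Longrightarrow> fst \<alpha> x = fst \<beta> x"
    and g: "\<And>y. y \<in> {1..n} \<Longrightarrow> y \<notin> fst \<alpha> ` {1..m} \<Longrightarrow> snd \<alpha> y = snd \<beta> y"
  shows "\<alpha> = \<beta>"
proof -
  obtain u v u' v' where ab: "\<alpha> = (u, v)" "\<beta> = (u', v')"
    by (cases \<alpha>, cases \<beta>)
  have *: "u = u'"
    using assms(1,2) f unfolding ab
    by (intro PiE_ext[of u "{1..m}" "\<lambda>_. {1..n}" u']) (auto simp: FI_hom_iff)
  moreover have "v = v'"
    using assms(1,2) g unfolding ab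
    by (intro PiE_ext[of v "{1..n} - u ` {1..m}" "\<lambda>_. {1..d}" v']) (auto simp: FI_hom_iff *)
  ultimately show ?thesis
    by (simp add: ab)
qed

text \<open>The factor is \<alpha> pulled back along \<iota>: points through the inverse of \<iota>,
  colours by composition with \<open>fst \<iota>\<close>. With \<open>FI_incl\<close> or
  \<open>FI_block\<close> for \<iota>, this recognizes a morphism, after a permutation of its
  target, as one that ends by inserting points of prescribed colours.\<close>

lemma FI_factor_right:
  assumes \<alpha>: "\<alpha> \<in> FI_hom d m n'" and \<iota>: "\<iota> \<in> FI_hom d n n'"
    and sub: "fst \<alpha> ` {1..m} \<subseteq> fst \<iota> ` {1..n}"
    and agree: "\<And>y. y \<in> {1..n'} \<Longrightarrow> y \<notin> fst \<iota> ` {1..n} \<Longrightarrow> snd \<alpha> y = snd \<iota> y"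
  shows "\<exists>\<beta>\<in>FI_hom d m n. \<alpha> = FI_comp m n n' \<iota> \<beta>"
proof -
  define h where "h = fst \<iota>"
  define f where "f = (\<lambda>x\<in>{1..m}. inv_into {1..n} h (fst \<alpha> x))"
  define g where "g = (\<lambda>y\<in>{1..n} - f ` {1..m}. snd \<alpha> (h y))"
  have hf: "h (f x) = fst \<alpha> x" and fin: "f x \<in> {1..n}" if "x \<in> {1..m}" for x
  proof -
    have "fst \<alpha> x \<in> h ` {1..n}"
      using sub that by (auto simp: h_def)
    then show "h (f x) = fst \<alpha> x" "f x \<in> {1..n}"
      using that inv_into_into[of "fst \<alpha> x" h "{1..n}"] by (simp_all add: f_def f_inv_into_f)
  qed
  have injh: "inj_on h {1..n}" and hn: "h ` {1..n} \<subseteq> {1..n'}"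
    using inj_fst_FI_hom[OF \<iota>] fst_FI_hom_image[OF \<iota>] by (auto simp: h_def)
  have notin: "h y \<notin> fst \<alpha> ` {1..m}" if "y \<in> {1..n}" "y \<notin> f ` {1..m}" for y
  proof
    assume "h y \<in> fst \<alpha> ` {1..m}"
    then obtain x where x: "x \<in> {1..m}" "h y = h (f x)"
      using hf by auto
    then show False
      using inj_onD[OF injh _ that(1) fin[OF x(1)]] that by auto
  qed
  have \<beta>: "(f, g) \<in> FI_hom d m n"
    unfolding FI_hom_iff
  proof (intro conjI)
    show "f \<in> {1..m} \<rightarrow>\<^sub>E {1..n}"
      using fin by (auto simp: f_def)
    show "inj_on f {1..m}"
      by (rule inj_onI, rule inj_onD[OF inj_fst_FI_hom[OF \<alpha>]]) (use hf in metis)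
    show "g \<in> {1..n} - f ` {1..m} \<rightarrow>\<^sub>E {1..d}"
      unfolding g_def restrict_PiE_iff using notin hn snd_FI_hom[OF \<alpha>] by blast
  qed
  have "\<alpha> = FI_comp m n n' \<iota> (f, g)"
  proof (rule FI_hom_eqI[OF \<alpha> FI_comp_in_hom[OF \<iota> \<beta>]])
    show "fst \<alpha> x = fst (FI_comp m n n' \<iota> (f, g)) x" if "x \<in> {1..m}" for x
      using hf that by (simp add: fst_FI_comp h_def)
    fix y assume y: "y \<in> {1..n'}" "y \<notin> fst \<alpha> ` {1..m}"
    have *: "y \<notin> fst \<iota> ` fst (f, g) ` {1..m}"
      using hf y(2) by (force simp: h_def)
    show "snd \<alpha> y = snd (FI_comp m n n' \<iota> (f, g)) y"
    proof (cases "y \<in> fst \<iota> ` {1..n}")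
      case True
      then obtain x where x: "x \<in> {1..n}" "y = h x"
        by (auto simp: h_def)
      then have "x \<notin> f ` {1..m}"
        using * by (auto simp: h_def)
      then show ?thesis
        using x True inv_into_f_f[OF injh x(1)]
        by (subst snd_FI_comp[OF \<iota> y(1) *]) (simp add: g_def h_def)
    next
      case False
      then show ?thesis
        by (subst snd_FI_comp[OF \<iota> y(1) *]) (simp add: agree[OF y(1)])
    qed
  qed
  then show ?thesis
    using \<beta> by blast
qed

text \<open>Some point \<open>y\<close> is missed by \<alpha>. With \<open>i\<close> the colour of
  \<open>y\<close>, the point n + 1 is inserted with colour \<open>i\<close> and then sent to
  \<open>y\<close>.\<close>

lemma FI_factor_incl:
  assumes \<alpha>: "\<alpha> \<in> FI_hom d n n'" and "n < n'"
  shows "\<exists>i\<in>{1..d}. \<exists>\<beta>\<in>FI_hom d (n + 1) n'. \<alpha> = FI_comp n (n + 1) n' \<beta> (FI_incl i n)"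
proof -
  have "card (fst \<alpha> ` {1..n}) < card {1..n'}"
    using assms(2) inj_fst_FI_hom[OF \<alpha>] by (simp add: card_image)
  then obtain y where y: "y \<in> {1..n'}" "y \<notin> fst \<alpha> ` {1..n}"
    by (metis card_mono finite_atLeastAtMost finite_imageI not_less subsetI)
  define i where "i = snd \<alpha> y"
  have i: "i \<in> {1..d}"
    unfolding i_def by (rule snd_FI_hom[OF \<alpha> y])
  define f where "f = (fst \<alpha>)(n + 1 := y)"
  define g where "g = restrict (snd \<alpha>) ({1..n'} - f ` {1..n+1})"
  have seteq: "{1..n+1} = insert (n+1) {1..n}"
    by auto
  have fa: "f x = fst \<alpha> x" if "x \<in> {1..n}" for x
    using that by (auto simp: f_def)
  have img: "f ` {1..n+1} = insert y (fst \<alpha> ` {1..n})"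
    unfolding seteq using fa by (auto simp: f_def image_iff)
  have injf: "inj_on f {1..n}"
    using inj_fst_FI_hom[OF \<alpha>] fa by (metis inj_on_cong)
  have "f ` {1..n} = fst \<alpha> ` {1..n}"
    using fa by (auto simp: image_iff)
  then have inj: "inj_on f {1..n+1}"
    unfolding seteq using injf y(2) by (auto simp: inj_on_insert f_def)
  have \<beta>: "(f, g) \<in> FI_hom d (n + 1) n'"
    unfolding FI_hom_iff
  proof (intro conjI inj)
    obtain f0 g0 where [simp]: "\<alpha> = (f0, g0)"
      by fastforce
    have "f ` {1..n+1} \<subseteq> {1..n'}"
      unfolding img using fst_FI_hom_image[OF \<alpha>] y(1) by blast
    then show "f \<in> {1..n + 1} \<rightarrow>\<^sub>E {1..n'}"
      using \<alpha> by (auto simp: f_def FI_hom_iff PiE_iff extensional_def)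
    show "g \<in> {1..n'} - f ` {1..n + 1} \<rightarrow>\<^sub>E {1..d}"
      unfolding g_def restrict_PiE_iff img using snd_FI_hom[OF \<alpha>] by auto
  qed
  have \<iota>: "FI_incl i n \<in> FI_hom d n (n + 1)"
    using FI_incl_in_hom[OF i] .
  have incl: "fst (FI_incl i n) x = x" if "x \<in> {1..n}" for x
    using that by (simp add: FI_incl_def)
  have "\<alpha> = FI_comp n (n + 1) n' (f, g) (FI_incl i n)"
  proof (rule FI_hom_eqI[OF \<alpha> FI_comp_in_hom[OF \<beta> \<iota>]])
    show "fst \<alpha> x = fst (FI_comp n (n + 1) n' (f, g) (FI_incl i n)) x" if "x \<in> {1..n}" for x
      using that by (simp add: fst_FI_comp incl fa)
    fix z assume z: "z \<in> {1..n'}" "z \<notin> fst \<alpha> ` {1..n}"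
    have *: "z \<notin> fst (f, g) ` fst (FI_incl i n) ` {1..n}"
      using z fa incl by (auto simp: image_iff)
    have inv: "inv_into {1..n+1} f y = n + 1"
      using inv_into_f_f[OF inj, of "n + 1"] by (simp add: f_def)
    show "snd \<alpha> z = snd (FI_comp n (n + 1) n' (f, g) (FI_incl i n)) z"
    proof (cases "z = y")
      case True
      then show ?thesis
        using inv img by (subst snd_FI_comp[OF \<beta> z(1) *]) (simp add: FI_incl_def i_def)
    next
      case False
      then have "z \<notin> f ` {1..n+1}"
        using z(2) img by blast
      then show ?thesis
        using z(1) by (subst snd_FI_comp[OF \<beta> z(1) *]) (simp add: g_def)
    qed
  qed
  then show ?thesis
    using i \<beta> by blast
qed

lemma FI_perm_id: "FI_perm n id = FI_id n"
  by (simp add: FI_perm_def FI_id_def)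

lemma FI_comp_perm_perm:
  assumes "\<sigma> permutes {1..n}" "\<tau> permutes {1..n}"
  shows "FI_comp n n n (FI_perm n \<sigma>) (FI_perm n \<tau>) = FI_perm n (\<sigma> \<circ> \<tau>)"
proof (rule FI_hom_eqI)
  show "FI_comp n n n (FI_perm n \<sigma>) (FI_perm n \<tau>) \<in> FI_hom 0 n n"
    using assms by (intro FI_comp_in_hom FI_perm_in_hom)
  show *: "FI_perm n (\<sigma> \<circ> \<tau>) \<in> FI_hom 0 n n"
    using assms by (intro FI_perm_in_hom permutes_compose)
  show **: "fst (FI_comp n n n (FI_perm n \<sigma>) (FI_perm n \<tau>)) x = fst (FI_perm n (\<sigma> \<circ> \<tau>)) x"
    if "x \<in> {1..n}" for x
    using that permutes_in_image[OF assms(2), of x] unfolding fst_FI_comp[OF that]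
    by (simp add: FI_perm_def)
  fix y assume "y \<in> {1..n}" "y \<notin> fst (FI_comp n n n (FI_perm n \<sigma>) (FI_perm n \<tau>)) ` {1..n}"
  moreover have "fst (FI_comp n n n (FI_perm n \<sigma>) (FI_perm n \<tau>)) ` {1..n} = (\<sigma> \<circ> \<tau>) ` {1..n}"
    using ** by (auto simp: FI_perm_def image_iff)
  ultimately show "snd (FI_comp n n n (FI_perm n \<sigma>) (FI_perm n \<tau>)) y = snd (FI_perm n (\<sigma> \<circ> \<tau>)) y"
    using permutes_image[OF permutes_compose[OF assms(2,1)]] by simp
qed

lemma fst_FI_comp_perm:
  assumes "\<alpha> \<in> FI_hom d m n" "x \<in> {1..m}"
  shows "fst (FI_comp m n n (FI_perm n \<sigma>) \<alpha>) x = \<sigma> (fst \<alpha> x)"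
  unfolding fst_FI_comp[OF assms(2)] using imageI[OF assms(2), of "fst \<alpha>"] fst_FI_hom_image[OF assms(1)]
  by (metis FI_perm_def fst_conv restrict_apply' subsetD)

lemma snd_FI_comp_perm:
  assumes \<sigma>: "\<sigma> permutes {1..n}" and \<alpha>: "\<alpha> \<in> FI_hom d m n"
    and y: "y \<in> {1..n}" "y \<notin> fst \<alpha> ` {1..m}"
  shows "snd (FI_comp m n n (FI_perm n \<sigma>) \<alpha>) (\<sigma> y) = snd \<alpha> y"
proof -
  have \<sigma>y: "\<sigma> y \<in> {1..n}"
    using permutes_in_image[OF \<sigma>] y(1) by blast
  have inj: "inj_on (fst (FI_perm n \<sigma>)) {1..n}"
    using inj_fst_FI_hom[OF FI_perm_in_hom[OF \<sigma>]] .
  have fst: "fst (FI_perm n \<sigma>) y = \<sigma> y"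
    using y(1) by (simp add: FI_perm_def)
  have "\<sigma> y \<notin> fst (FI_perm n \<sigma>) ` fst \<alpha> ` {1..m}"
  proof
    assume "\<sigma> y \<in> fst (FI_perm n \<sigma>) ` fst \<alpha> ` {1..m}"
    then obtain z where "z \<in> fst \<alpha> ` {1..m}" "\<sigma> y = fst (FI_perm n \<sigma>) z"
      by auto
    moreover from this have "z \<in> {1..n}"
      using fst_FI_hom_image[OF \<alpha>] by auto
    ultimately show False
      using y inj_onD[OF inj, of y z] unfolding fst by metis
  qed
  then have "snd (FI_comp m n n (FI_perm n \<sigma>) \<alpha>) (\<sigma> y) =
      (if \<sigma> y \<notin> fst (FI_perm n \<sigma>) ` {1..n} then snd (FI_perm n \<sigma>) (\<sigma> y)
       else snd \<alpha> (inv_into {1..n} (fst (FI_perm n \<sigma>)) (\<sigma> y)))"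
    by (rule snd_FI_comp[OF FI_perm_in_hom[OF \<sigma>, of d] \<sigma>y])
  also have "\<dots> = snd \<alpha> y"
    using imageI[OF y(1), of "fst (FI_perm n \<sigma>)"] inv_into_f_f[OF inj y(1)] unfolding fst by simp
  finally show ?thesis .
qed

text \<open>Inserts one point of each colour, \<open>n + j\<close> with colour \<open>j\<close>.
  This is the morphism behind the comparison of multiplicities; its new points become the entries of
  the new column.\<close>

definition FI_block :: "nat \<Rightarrow> nat \<Rightarrow> fi_mor" where
  "FI_block d n = (restrict id {1..n}, \<lambda>y\<in>{n+1..n+d}. y - n)"

lemma FI_block_in_hom: "FI_block d n \<in> FI_hom d n (n + d)"
  by (auto simp: FI_block_def FI_hom_iff inj_on_def PiE_iff extensional_def)

text \<open>\<sigma> fixes the new points and hence keeps their colours; on the right it is regarded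
  as a permutation of the larger set.\<close>

lemma FI_block_perm:
  assumes \<sigma>: "\<sigma> permutes {1..n}"
  shows "FI_comp n n (n + d) (FI_block d n) (FI_perm n \<sigma>) =
    FI_comp n (n + d) (n + d) (FI_perm (n + d) \<sigma>) (FI_block d n)"
proof (rule FI_hom_eqI)
  have \<sigma>': "\<sigma> permutes {1..n+d}"
    using permutes_subset[OF \<sigma>] by auto
  have hom: "FI_block d n \<in> FI_hom d n (n + d)" "FI_perm n \<sigma> \<in> FI_hom d n n"
    "FI_perm (n + d) \<sigma> \<in> FI_hom d (n + d) (n + d)"
    using FI_block_in_hom FI_perm_in_hom \<sigma> \<sigma>' by blast+
  show "FI_comp n n (n + d) (FI_block d n) (FI_perm n \<sigma>) \<in> FI_hom d n (n + d)"
    "FI_comp n (n + d) (n + d) (FI_perm (n + d) \<sigma>) (FI_block d n) \<in> FI_hom d n (n + d)"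
    using FI_comp_in_hom hom by blast+
  have \<sigma>in: "\<sigma> x \<in> {1..n}" if "x \<in> {1..n}" for x
    using permutes_in_image[OF \<sigma>] that by blast
  have fst: "fst (FI_comp n n (n + d) (FI_block d n) (FI_perm n \<sigma>)) x = \<sigma> x" if "x \<in> {1..n}" for x
    using that \<sigma>in[OF that] unfolding fst_FI_comp[OF that] by (simp add: FI_block_def FI_perm_def)
  show "fst (FI_comp n n (n + d) (FI_block d n) (FI_perm n \<sigma>)) x =
    fst (FI_comp n (n + d) (n + d) (FI_perm (n + d) \<sigma>) (FI_block d n)) x" if "x \<in> {1..n}" for x
    using that unfolding fst[OF that] fst_FI_comp_perm[OF hom(1) that] by (simp add: FI_block_def)
  fix y assume y: "y \<in> {1..n+d}" "y \<notin> fst (FI_comp n n (n + d) (FI_block d n) (FI_perm n \<sigma>)) ` {1..n}"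
  have "fst (FI_comp n n (n + d) (FI_block d n) (FI_perm n \<sigma>)) ` {1..n} = \<sigma> ` {1..n}"
    using fst by (auto simp: image_iff)
  then have "y \<notin> {1..n}"
    using y(2) permutes_image[OF \<sigma>] by simp
  then have 1: "y \<notin> fst (FI_block d n) ` {1..n}" and 2: "\<sigma> y = y"
    and 3: "y \<notin> fst (FI_block d n) ` fst (FI_perm n \<sigma>) ` {1..n}"
    using permutes_not_in[OF \<sigma>] \<sigma>in by (auto simp: FI_block_def FI_perm_def)
  show "snd (FI_comp n n (n + d) (FI_block d n) (FI_perm n \<sigma>)) y =
    snd (FI_comp n (n + d) (n + d) (FI_perm (n + d) \<sigma>) (FI_block d n)) y"
    using snd_FI_comp[OF hom(1) y(1) 3] snd_FI_comp_perm[OF \<sigma>' hom(1) y(1) 1] 1 2 by simp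
qed

section \<open>Representations of symmetric groups\<close>

lemma sum_compose_left:
  assumes "\<And>\<pi>. \<pi> \<in> C \<Longrightarrow> \<tau> \<circ> \<pi> \<in> C" "\<And>\<pi>. \<pi> \<in> C \<Longrightarrow> inv \<tau> \<circ> \<pi> \<in> C" "bij \<tau>"
  shows "(\<Sum>\<pi>\<in>C. f \<pi>) = (\<Sum>\<pi>\<in>C. f (\<tau> \<circ> \<pi>))"
proof -
  have "\<tau> \<circ> inv \<tau> = id" "inv \<tau> \<circ> \<tau> = id"
    using assms(3) by (simp_all add: bij_def surj_iff inj_iff)
  then have "\<tau> \<circ> (inv \<tau> \<circ> \<pi>) = \<pi>" "inv \<tau> \<circ> (\<tau> \<circ> \<pi>) = \<pi>" if "\<pi> \<in> C" for \<pi>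
    by (simp_all add: o_assoc)
  then show ?thesis
    using assms(1,2)
    by (intro sum.reindex_bij_witness[of _ "\<lambda>\<pi>. \<tau> \<circ> \<pi>" "\<lambda>\<pi>. inv \<tau> \<circ> \<pi>"]) simp_all
qed

lemma linear_on_zero:
  assumes "linear_on s s' U f" "module.subspace s U" "vector_space s" "vector_space s'"
  shows "f 0 = 0"
proof -
  interpret vector_space s by fact
  interpret s': vector_space s' by fact
  have "f (s 0 0) = s' 0 (f 0)"
    using assms(1) subspace_0[OF assms(2)] unfolding linear_on_def by blast
  then show ?thesis
    by simp
qed

lemma linear_on_diff:
  assumes "linear_on s s' U f" "module.subspace s U" "vector_space s" "x \<in> U" "y \<in> U"
  shows "f (x - y) = f x - f y"
proof -
  interpret vector_space s by fact
  have "f (x - y + y) = f (x - y) + f y"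
    using assms subspace_diff[OF assms(2,4,5)] unfolding linear_on_def by blast
  then show ?thesis
    by simp
qed

lemma linear_on_sum:
  assumes "linear_on s s' U f" "module.subspace s U" "vector_space s" "vector_space s'"
    and "\<And>i. i \<in> I \<Longrightarrow> x i \<in> U"
  shows "f (\<Sum>i\<in>I. x i) = (\<Sum>i\<in>I. f (x i))"
proof -
  interpret vector_space s by fact
  show ?thesis
    using assms(5)
  proof (induction I rule: infinite_finite_induct)
    case (insert i I)
    then show ?case
      using assms(1) subspace_sum[OF assms(2), of I x] unfolding linear_on_def by simp
  qed (simp_all add: linear_on_zero[OF assms(1-4)])
qed

lemma linear_on_subset: "linear_on s s' U f \<Longrightarrow> W \<subseteq> U \<Longrightarrow> linear_on s s' W f"
  unfolding linear_on_def by blast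

lemma linear_on_cong: "linear_on s s' U f \<Longrightarrow> module.subspace s U \<Longrightarrow> vector_space s \<Longrightarrow>
    (\<And>x. x \<in> U \<Longrightarrow> g x = f x) \<Longrightarrow> linear_on s s' U g"
  unfolding linear_on_def
  by (metis module.subspace_add module.subspace_scale module_iff_vector_space)

text \<open>Maps are set to 0 outside \<open>U\<close>, so that two of them are equal exactly if
  they agree on \<open>U\<close>. They then form a subspace of a function space and have a
  dimension.\<close>

definition hom_space ::
    "nat \<Rightarrow> ('k::field \<Rightarrow> 'v::ab_group_add \<Rightarrow> 'v) \<Rightarrow> ((nat \<Rightarrow> nat) \<Rightarrow> 'v \<Rightarrow> 'v) \<Rightarrow> 'v set \<Rightarrow>
     ('k \<Rightarrow> 'w::ab_group_add \<Rightarrow> 'w) \<Rightarrow> ((nat \<Rightarrow> nat) \<Rightarrow> 'w \<Rightarrow> 'w) \<Rightarrow> 'w set \<Rightarrow> ('v \<Rightarrow> 'w) set" where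
  "hom_space n s \<rho> U s' \<rho>' U' = {f. (\<forall>x\<in>U. f x \<in> U') \<and> (\<forall>x. x \<notin> U \<longrightarrow> f x = 0) \<and>
    linear_on s s' U f \<and> (\<forall>\<sigma>. \<sigma> permutes {1..n} \<longrightarrow> (\<forall>x\<in>U. f (\<rho> \<sigma> x) = \<rho>' \<sigma> (f x)))}"

lemma hom_spaceD:
  assumes "f \<in> hom_space n s \<rho> U s' \<rho>' U'"
  shows "\<And>x. x \<in> U \<Longrightarrow> f x \<in> U'" "\<And>x. x \<notin> U \<Longrightarrow> f x = 0" "linear_on s s' U f"
    "\<And>\<sigma> x. \<sigma> permutes {1..n} \<Longrightarrow> x \<in> U \<Longrightarrow> f (\<rho> \<sigma> x) = \<rho>' \<sigma> (f x)"
  using assms by (auto simp: hom_space_def)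

definition hom_scale :: "('k \<Rightarrow> 'w \<Rightarrow> 'w) \<Rightarrow> 'k \<Rightarrow> ('v \<Rightarrow> 'w) \<Rightarrow> 'v \<Rightarrow> 'w" where
  "hom_scale s' c f = (\<lambda>x. s' c (f x))"

lemma vector_space_hom_scale: "vector_space s' \<Longrightarrow> vector_space (hom_scale s')"
  unfolding vector_space_def hom_scale_def by (auto simp: fun_eq_iff)

section \<open>Representations in characteristic 0: Maschke's theorem and Schur's lemma\<close>

locale sym_rep = vector_space s
  for s :: "'k::field_char_0 \<Rightarrow> 'v::ab_group_add \<Rightarrow> 'v" +
  fixes n :: nat and \<rho> :: "(nat \<Rightarrow> nat) \<Rightarrow> 'v \<Rightarrow> 'v" and U :: "'v set"
  assumes subspace_U: "subspace U"
    and rho_in: "\<sigma> permutes {1..n} \<Longrightarrow> x \<in> U \<Longrightarrow> \<rho> \<sigma> x \<in> U"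
    and rho_linear: "\<sigma> permutes {1..n} \<Longrightarrow> linear_on s s U (\<rho> \<sigma>)"
    and rho_id: "x \<in> U \<Longrightarrow> \<rho> id x = x"
    and rho_comp: "\<sigma> permutes {1..n} \<Longrightarrow> \<tau> permutes {1..n} \<Longrightarrow> x \<in> U \<Longrightarrow>
      \<rho> (\<sigma> \<circ> \<tau>) x = \<rho> \<sigma> (\<rho> \<tau> x)"
begin

lemma rho_add: "\<sigma> permutes {1..n} \<Longrightarrow> x \<in> U \<Longrightarrow> y \<in> U \<Longrightarrow> \<rho> \<sigma> (x + y) = \<rho> \<sigma> x + \<rho> \<sigma> y"
  and rho_scale: "\<sigma> permutes {1..n} \<Longrightarrow> x \<in> U \<Longrightarrow> \<rho> \<sigma> (s c x) = s c (\<rho> \<sigma> x)"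
  using rho_linear[of \<sigma>] by (auto simp: linear_on_def)

lemma rho_sum:
  assumes "\<sigma> permutes {1..n}" "\<And>i. i \<in> I \<Longrightarrow> x i \<in> U"
  shows "\<rho> \<sigma> (\<Sum>i\<in>I. x i) = (\<Sum>i\<in>I. \<rho> \<sigma> (x i))"
  by (rule linear_on_sum[OF rho_linear[OF assms(1)] subspace_U vector_space_axioms
      vector_space_axioms assms(2)])

lemma rho_inv: "\<sigma> permutes {1..n} \<Longrightarrow> x \<in> U \<Longrightarrow> \<rho> \<sigma> (\<rho> (inv \<sigma>) x) = x"
  and rho_inv': "\<sigma> permutes {1..n} \<Longrightarrow> x \<in> U \<Longrightarrow> \<rho> (inv \<sigma>) (\<rho> \<sigma> x) = x"
  using rho_comp[of \<sigma> "inv \<sigma>" x] rho_comp[of "inv \<sigma>" \<sigma> x] permutes_inv[of \<sigma>]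
    permutes_inv_o[of \<sigma>] rho_id by auto

lemma subrep_refl: "subrep s n \<rho> U U"
  using subspace_U rho_in by (auto simp: subrep_def)

lemma sym_rep_subrep:
  assumes "subrep s n \<rho> U W"
  shows "sym_rep s n \<rho> W"
proof
  have W: "W \<subseteq> U" "subspace W" "\<And>\<sigma> x. \<sigma> permutes {1..n} \<Longrightarrow> x \<in> W \<Longrightarrow> \<rho> \<sigma> x \<in> W"
    using assms by (auto simp: subrep_def)
  show "subspace W"
    by fact
  fix \<sigma> \<tau> x
  show "\<rho> \<sigma> x \<in> W" if "\<sigma> permutes {1..n}" "x \<in> W"
    using W that by blast
  show "linear_on s s W (\<rho> \<sigma>)" if "\<sigma> permutes {1..n}"
    using rho_linear[OF that] W(1) by (rule linear_on_subset)
  show "\<rho> id x = x" if "x \<in> W"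
    using W(1) rho_id that by blast
  show "\<rho> (\<sigma> \<circ> \<tau>) x = \<rho> \<sigma> (\<rho> \<tau> x)"
    if "\<sigma> permutes {1..n}" "\<tau> permutes {1..n}" "x \<in> W"
    using W(1) rho_comp that by blast
qed

lemma subrep_trans: "subrep s n \<rho> U W \<Longrightarrow> subrep s n \<rho> W X \<Longrightarrow> subrep s n \<rho> U X"
  by (auto simp: subrep_def)

lemma restrict_in_hom_space:
  assumes "\<And>x. x \<in> U \<Longrightarrow> f x \<in> U'" "linear_on s s' U f"
    "\<And>\<sigma> x. \<sigma> permutes {1..n} \<Longrightarrow> x \<in> U \<Longrightarrow> f (\<rho> \<sigma> x) = \<rho>' \<sigma> (f x)"
  shows "(\<lambda>x. if x \<in> U then f x else 0) \<in> hom_space n s \<rho> U s' \<rho>' U'"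
  using assms rho_in linear_on_cong[OF assms(2) subspace_U vector_space_axioms,
      of "\<lambda>x. if x \<in> U then f x else 0"]
  by (auto simp: hom_space_def)

text \<open>Averaging the conjugates of a linear projection \<open>p\<close> onto \<open>W\<close>
  over the group gives an equivariant projection; characteristic 0 allows division by the order of
  the group.\<close>

lemma maschke:
  assumes "subrep s n \<rho> U W"
  obtains P where "P \<in> hom_space n s \<rho> U s \<rho> W" "\<And>x. x \<in> W \<Longrightarrow> P x = x"
proof -
  interpret vector_space_pair s s ..
  interpret W: sym_rep s n \<rho> W
    by (rule sym_rep_subrep[OF assms])
  have W: "W \<subseteq> U"
    using assms by (auto simp: subrep_def)
  obtain p where p: "Vector_Spaces.linear s s p" "range p \<subseteq> W" "\<And>x. x \<in> W \<Longrightarrow> p x = x"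
    using linear_exists_left_inverse_on[OF linear_id W.subspace_U] by auto
  have pW: "p x \<in> W" for x
    using p(2) by blast
  have p_add: "p (x + y) = p x + p y" and p_scale: "p (s c x) = s c (p x)" for x y c
    using p(1) by (auto simp: Vector_Spaces.linear_iff)
  let ?Per = "{\<sigma>. \<sigma> permutes {1..n}}"
  define Q where "Q x = (\<Sum>\<sigma>\<in>?Per. \<rho> \<sigma> (p (\<rho> (inv \<sigma>) x)))" for x
  define P where "P x = s (1 / of_nat (card ?Per)) (Q x)" for x
  have fin: "finite ?Per"
    by (rule finite_permutations) simp
  have card: "of_nat (card ?Per) \<noteq> (0::'k)"
    using fin permutes_id[of "{1..n}"] by (auto simp del: permutes_id)
  have QW: "Q x \<in> W" if "x \<in> U" for x
    unfolding Q_def using pW W.rho_in by (intro subspace_sum[OF W.subspace_U]) auto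
  have "linear_on s s U P"
    unfolding linear_on_def
  proof (intro conjI ballI allI)
    fix x y assume xy: "x \<in> U" "y \<in> U"
    have "\<rho> \<sigma> (p (\<rho> (inv \<sigma>) (x + y))) = \<rho> \<sigma> (p (\<rho> (inv \<sigma>) x)) + \<rho> \<sigma> (p (\<rho> (inv \<sigma>) y))"
      if "\<sigma> permutes {1..n}" for \<sigma>
      using rho_add[OF permutes_inv[OF that] xy] p_add W.rho_add[OF that pW pW] by simp
    then show "P (x + y) = P x + P y"
      by (simp add: P_def Q_def sum.distrib scale_right_distrib)
  next
    fix x c assume x: "x \<in> U"
    have "\<rho> \<sigma> (p (\<rho> (inv \<sigma>) (s c x))) = s c (\<rho> \<sigma> (p (\<rho> (inv \<sigma>) x)))"
      if "\<sigma> permutes {1..n}" for \<sigma>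
      using rho_scale[OF permutes_inv[OF that] x] p_scale W.rho_scale[OF that pW] by simp
    then show "P (s c x) = s c (P x)"
      by (simp add: P_def Q_def scale_sum_right mult.commute)
  qed
  moreover have "P (\<rho> \<tau> x) = \<rho> \<tau> (P x)" if \<tau>: "\<tau> permutes {1..n}" and x: "x \<in> U" for \<tau> x
  proof -
    \<comment> \<open>The substitution of \<tau> \<circ> \<sigma> for \<sigma> lets the two
      occurrences of \<tau> inside cancel and leaves one on the outside.\<close>
    have "Q (\<rho> \<tau> x) = (\<Sum>\<sigma>\<in>?Per. \<rho> (\<tau> \<circ> \<sigma>) (p (\<rho> (inv (\<tau> \<circ> \<sigma>)) (\<rho> \<tau> x))))"
      unfolding Q_def by (rule sum_compose_left[of _ \<tau>]) (use \<tau> in \<open>auto intro: permutes_compose permutes_inv permutes_bij\<close>)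
    also have "\<dots> = (\<Sum>\<sigma>\<in>?Per. \<rho> \<tau> (\<rho> \<sigma> (p (\<rho> (inv \<sigma>) x))))"
    proof (rule sum.cong)
      fix \<sigma> assume "\<sigma> \<in> ?Per"
      then have \<sigma>: "\<sigma> permutes {1..n}"
        by simp
      have "inv (\<tau> \<circ> \<sigma>) = inv \<sigma> \<circ> inv \<tau>"
        using o_inv_distrib[OF permutes_bij[OF \<tau>] permutes_bij[OF \<sigma>]] .
      then have "\<rho> (inv (\<tau> \<circ> \<sigma>)) (\<rho> \<tau> x) = \<rho> (inv \<sigma>) x"
        using rho_comp[OF permutes_inv[OF \<sigma>] permutes_inv[OF \<tau>] rho_in[OF \<tau> x]] rho_inv'[OF \<tau> x]
        by simp
      then show "\<rho> (\<tau> \<circ> \<sigma>) (p (\<rho> (inv (\<tau> \<circ> \<sigma>)) (\<rho> \<tau> x))) = \<rho> \<tau> (\<rho> \<sigma> (p (\<rho> (inv \<sigma>) x)))"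
        using W.rho_comp[OF \<tau> \<sigma> pW] by simp
    qed simp
    also have "\<dots> = \<rho> \<tau> (Q x)"
      unfolding Q_def using pW W.rho_in by (intro W.rho_sum[OF \<tau>, symmetric]) auto
    finally show ?thesis
      using W.rho_scale[OF \<tau> QW[OF x]] by (simp add: P_def)
  qed
  moreover have "P x = x" if "x \<in> W" for x
  proof -
    have "Q x = (\<Sum>\<sigma>\<in>?Per. x)"
      unfolding Q_def using that W.rho_in[OF permutes_inv] p(3) W.rho_inv by (intro sum.cong) auto
    then show ?thesis
      using card by (simp add: P_def sum_constant_scale)
  qed
  moreover have "P x \<in> W" if "x \<in> U" for x
    unfolding P_def by (intro subspace_scale[OF W.subspace_U] QW that)
  ultimately show ?thesis
    using that[of "\<lambda>x. if x \<in> U then P x else 0"] W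
    by (intro that[of "\<lambda>x. if x \<in> U then P x else 0"] restrict_in_hom_space) auto
qed

lemma subrep_kernel:
  assumes "sym_rep s' n \<rho>' U'" "f \<in> hom_space n s \<rho> U s' \<rho>' U'"
  shows "subrep s n \<rho> U {x \<in> U. f x = 0}"
proof -
  interpret U': sym_rep s' n \<rho>' U' by fact
  note f = hom_spaceD[OF assms(2)]
  have f0: "f 0 = 0"
    by (rule linear_on_zero[OF f(3) subspace_U vector_space_axioms U'.vector_space_axioms])
  have "subspace {x \<in> U. f x = 0}"
    using f(3) subspace_U f0 by (auto simp: subspace_def linear_on_def)
  moreover have "\<rho>' \<sigma> 0 = 0" if "\<sigma> permutes {1..n}" for \<sigma>
    by (rule linear_on_zero[OF U'.rho_linear[OF that] U'.subspace_U U'.vector_space_axioms U'.vector_space_axioms])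
  ultimately show ?thesis
    using f(4) rho_in by (auto simp: subrep_def)
qed

lemma subrep_image:
  assumes "sym_rep s' n \<rho>' U'" "f \<in> hom_space n s \<rho> U s' \<rho>' U'"
  shows "subrep s' n \<rho>' U' (f ` U)"
proof -
  interpret U': sym_rep s' n \<rho>' U' by fact
  note f = hom_spaceD[OF assms(2)]
  have "U'.subspace (f ` U)"
    unfolding U'.subspace_def
  proof (intro conjI ballI allI)
    show "0 \<in> f ` U"
      using linear_on_zero[OF f(3) subspace_U vector_space_axioms U'.vector_space_axioms]
        subspace_0[OF subspace_U] by force
    show "x + y \<in> f ` U" if "x \<in> f ` U" "y \<in> f ` U" for x y
      using that f(3) subspace_add[OF subspace_U] unfolding linear_on_def by (smt (verit) image_iff)
    show "s' c x \<in> f ` U" if "x \<in> f ` U" for c x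
      using that f(3) subspace_scale[OF subspace_U] unfolding linear_on_def by (smt (verit) image_iff)
  qed
  moreover have "\<rho>' \<sigma> (f x) \<in> f ` U" if "\<sigma> permutes {1..n}" "x \<in> U" for \<sigma> x
    using f(4)[OF that] rho_in[OF that] by (auto intro!: rev_image_eqI)
  ultimately show ?thesis
    using f(1) by (auto simp: subrep_def)
qed

lemma schur:
  assumes U': "sym_rep s' n \<rho>' U'" and f: "f \<in> hom_space n s \<rho> U s' \<rho>' U'"
    and irr: "irreducible_rep s n \<rho> U" "irreducible_rep s' n \<rho>' U'"
    and ne: "\<exists>x\<in>U. f x \<noteq> 0"
  shows "bij_betw f U U'"
proof -
  interpret U': sym_rep s' n \<rho>' U' by fact
  have "{x \<in> U. f x = 0} = {0} \<or> {x \<in> U. f x = 0} = U"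
    using irr(1) subrep_kernel[OF U' f] by (auto simp: irreducible_rep_def)
  then have ker: "{x \<in> U. f x = 0} = {0}"
    using ne by auto
  have "f ` U = {0} \<or> f ` U = U'"
    using irr(2) subrep_image[OF U' f] by (auto simp: irreducible_rep_def)
  then have im: "f ` U = U'"
    using ne by auto
  have "x = y" if "x \<in> U" "y \<in> U" "f x = f y" for x y
  proof -
    have "f (x - y) = 0"
      using linear_on_diff[OF hom_spaceD(3)[OF f] subspace_U vector_space_axioms that(1,2)] that(3) by simp
    then show ?thesis
      using ker subspace_diff[OF subspace_U that(1,2)] by force
  qed
  then show ?thesis
    using im by (auto simp: bij_betw_def inj_on_def)
qed

end

section \<open>Decompositions into irreducible representations\<close>

lemma (in vector_space) dim_proper_subspace:
  assumes X: "finite_dimensional scale X" and W: "subspace W" "W \<subset> X"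
  shows "finite_dimensional scale W" "dim W < dim X"
proof -
  obtain B0 where B0: "finite B0" "B0 \<subseteq> X" "span B0 = X"
    using X by (auto simp: finite_dimensional_def)
  obtain B where B: "B \<subseteq> X" "independent B" "X \<subseteq> span B" "card B = dim X"
    using basis_exists by blast
  have finB: "finite B"
    using independent_span_bound[OF B0(1) B(2)] B(1) B0(3) by simp
  obtain A where A: "A \<subseteq> W" "independent A" "W \<subseteq> span A" "card A = dim W"
    using basis_exists by blast
  have finA: "finite A"
    using independent_span_bound[OF B0(1) A(2)] A(1) W(2) B0(3) by auto
  have "span A = W"
    using A span_minimal[OF A(1) W(1)] by auto
  then show "finite_dimensional scale W"
    using A finA by (auto simp: finite_dimensional_def)
  obtain x where x: "x \<in> X" "x \<notin> W"
    using W by blast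
  have "independent (insert x A)"
    using x A \<open>span A = W\<close> by (simp add: independent_insertI)
  moreover have "insert x A \<subseteq> span B"
    using x A(1) W(2) B(3) by auto
  ultimately have "card (insert x A) \<le> card B"
    using independent_span_bound[OF finB] by blast
  moreover have "x \<notin> A"
    using x A(1) by auto
  ultimately show "dim W < dim X"
    using finA A(4) B(4) by simp
qed

text \<open>As the summands are subspaces, uniqueness of components only has to be checked for the
  zero vector. The rule also passes from arbitrary families \<open>w\<close> to the extensional ones
  of the definition.\<close>

lemma irreducible_decompositionI:
  fixes s :: "'k::field \<Rightarrow> 'v::ab_group_add \<Rightarrow> 'v"
  assumes s: "vector_space s"
    and W: "\<And>i. i < r \<Longrightarrow> subrep s n \<rho> U (W i)" "\<And>i. i < r \<Longrightarrow> irreducible_rep s n \<rho> (W i)"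
    and ex: "\<And>u. u \<in> U \<Longrightarrow> \<exists>w. (\<forall>i<r. w i \<in> W i) \<and> u = (\<Sum>i<r. w i)"
    and zero: "\<And>w. (\<And>i. i < r \<Longrightarrow> w i \<in> W i) \<Longrightarrow> (\<Sum>i<r. w i) = 0 \<Longrightarrow> \<forall>i<r. w i = 0"
  shows "irreducible_decomposition s n \<rho> U r W"
  unfolding irreducible_decomposition_def
proof (intro conjI allI impI ballI)
  show "subrep s n \<rho> U (W i)" "irreducible_rep s n \<rho> (W i)" if "i < r" for i
    using W that by auto
  interpret vector_space s by fact
  fix u assume "u \<in> U"
  then obtain w where w: "\<forall>i<r. w i \<in> W i" "u = (\<Sum>i<r. w i)"
    using ex by blast
  show "\<exists>!w. w \<in> (\<Pi>\<^sub>E i\<in>{..<r}. W i) \<and> u = (\<Sum>i<r. w i)"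
  proof (intro ex1I conjI)
    show "restrict w {..<r} \<in> (\<Pi>\<^sub>E i\<in>{..<r}. W i)" "u = (\<Sum>i<r. restrict w {..<r} i)"
      using w by auto
    fix v assume v: "v \<in> (\<Pi>\<^sub>E i\<in>{..<r}. W i) \<and> u = (\<Sum>i<r. v i)"
    have "v i - w i \<in> W i" if "i < r" for i
      using w(1) v that W(1)[OF that] subspace_diff by (auto simp: subrep_def PiE_iff)
    moreover have "(\<Sum>i<r. v i - w i) = 0"
      using w(2) v by (simp add: sum_subtractf)
    ultimately have "\<forall>i<r. v i - w i = 0"
      by (rule zero)
    then show "v = restrict w {..<r}"
      using v by (auto simp: fun_eq_iff PiE_iff extensional_def)
  qed
qed

lemma irreducible_decompositionE:
  fixes s :: "'k::field \<Rightarrow> 'v::ab_group_add \<Rightarrow> 'v"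
  assumes s: "vector_space s"
    and dec: "irreducible_decomposition s n \<rho> U r W"
  shows "\<And>i. i < r \<Longrightarrow> subrep s n \<rho> U (W i)" "\<And>i. i < r \<Longrightarrow> irreducible_rep s n \<rho> (W i)"
    "\<And>u. u \<in> U \<Longrightarrow> \<exists>w. (\<forall>i<r. w i \<in> W i) \<and> u = (\<Sum>i<r. w i)"
    "\<And>v w. (\<And>i. i < r \<Longrightarrow> v i \<in> W i) \<Longrightarrow> (\<And>i. i < r \<Longrightarrow> w i \<in> W i) \<Longrightarrow> (\<Sum>i<r. v i) \<in> U \<Longrightarrow>
      (\<Sum>i<r. v i) = (\<Sum>i<r. w i) \<Longrightarrow> \<forall>i<r. v i = w i"
proof -
  show 1: "\<And>i. i < r \<Longrightarrow> subrep s n \<rho> U (W i)" "\<And>i. i < r \<Longrightarrow> irreducible_rep s n \<rho> (W i)"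
    using dec by (auto simp: irreducible_decomposition_def)
  have ex: "\<exists>!w. w \<in> (\<Pi>\<^sub>E i\<in>{..<r}. W i) \<and> u = (\<Sum>i<r. w i)" if "u \<in> U" for u
    using dec that by (auto simp: irreducible_decomposition_def)
  show "\<exists>w. (\<forall>i<r. w i \<in> W i) \<and> u = (\<Sum>i<r. w i)" if "u \<in> U" for u
    using ex1_implies_ex[OF ex[OF that]] by (auto simp: PiE_iff)
  fix v w
  assume vw: "\<And>i. i < r \<Longrightarrow> v i \<in> W i" "\<And>i. i < r \<Longrightarrow> w i \<in> W i" "(\<Sum>i<r. v i) \<in> U"
    "(\<Sum>i<r. v i) = (\<Sum>i<r. w i)"
  let ?P = "\<lambda>x. x \<in> (\<Pi>\<^sub>E i\<in>{..<r}. W i) \<and> (\<Sum>i<r. v i) = (\<Sum>i<r. x i)"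
  have "?P (restrict v {..<r})" "?P (restrict w {..<r})"
    using vw by auto
  then have "restrict v {..<r} = restrict w {..<r}"
    using ex[OF vw(3)] by blast
  then show "\<forall>i<r. v i = w i"
    by (metis lessThan_iff restrict_apply')
qed

context sym_rep
begin

text \<open>A nonzero subrepresentation of least dimension is irreducible.\<close>

lemma exists_irreducible_subrep:
  assumes "finite_dimensional s U" "U \<noteq> {0}"
  obtains X where "subrep s n \<rho> U X" "irreducible_rep s n \<rho> X"
proof -
  let ?P = "\<lambda>X. subrep s n \<rho> U X \<and> X \<noteq> {0}"
  define X where "X = arg_min dim ?P"
  have X: "?P X" and min: "\<And>Y. ?P Y \<Longrightarrow> dim X \<le> dim Y"
    using arg_min_nat_lemma[of ?P U dim] subrep_refl assms(2) by (auto simp: X_def)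
  have "finite_dimensional s X"
    using dim_proper_subspace(1)[OF assms(1), of X] X assms(1) by (auto simp: subrep_def)
  have "irreducible_rep s n \<rho> X"
    unfolding irreducible_rep_def
  proof (intro conjI allI impI)
    show "X \<noteq> {0}"
      using X by simp
    fix W assume W: "subrep s n \<rho> X W"
    show "W = {0} \<or> W = X"
    proof (rule ccontr)
      assume "\<not> (W = {0} \<or> W = X)"
      then have "W \<noteq> {0}" "W \<subset> X"
        using W by (auto simp: subrep_def)
      moreover have "subrep s n \<rho> U W"
        using X W subrep_trans by blast
      ultimately have "dim X \<le> dim W" "dim W < dim X"
        using min W dim_proper_subspace(2)[OF \<open>finite_dimensional s X\<close>] by (auto simp: subrep_def)
      then show False
        by simp
    qed
  qed
  then show ?thesis
    using that X by blast
qed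

end

text \<open>Induction on the dimension: an irreducible \<open>X\<close> is split off, and the kernel
  \<open>Y\<close> of an equivariant projection onto \<open>X\<close> is a complement of smaller
  dimension.\<close>

lemma exists_irreducible_decomposition:
  fixes s :: "'k::field_char_0 \<Rightarrow> 'v::ab_group_add \<Rightarrow> 'v"
  assumes "sym_rep s n \<rho> U" "finite_dimensional s U"
  shows "\<exists>r W. irreducible_decomposition s n \<rho> U r W"
  using assms
proof (induction "vector_space.dim s U" arbitrary: U rule: less_induct)
  case less
  interpret sym_rep s n \<rho> U
    by (rule less.prems(1))
  show ?case
  proof (cases "U = {0}")
    case True
    then have "irreducible_decomposition s n \<rho> U 0 (\<lambda>_. {})"
      by (intro irreducible_decompositionI vector_space_axioms) auto
    then show ?thesis by blast
  next
    case False
    then obtain X where X: "subrep s n \<rho> U X" "irreducible_rep s n \<rho> X"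
      using exists_irreducible_subrep less.prems(2) by blast
    interpret X: sym_rep s n \<rho> X
      by (rule sym_rep_subrep[OF X(1)])
    obtain P where P: "P \<in> hom_space n s \<rho> U s \<rho> X" "\<And>x. x \<in> X \<Longrightarrow> P x = x"
      using maschke[OF X(1)] by blast
    define Y where "Y = {x \<in> U. P x = 0}"
    have Y: "subrep s n \<rho> U Y"
      unfolding Y_def by (rule subrep_kernel[OF X.sym_rep_axioms P(1)])
    have XU: "X \<subseteq> U" and YU: "Y \<subseteq> U"
      using X(1) Y by (auto simp: subrep_def)
    interpret Y: sym_rep s n \<rho> Y
      by (rule sym_rep_subrep[OF Y])
    obtain x where "x \<in> X" "x \<noteq> 0"
      using X(2) subspace_0[OF X.subspace_U] by (auto simp: irreducible_rep_def)
    then have "x \<in> U" "x \<notin> Y"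
      using P(2) XU by (auto simp: Y_def)
    then have "Y \<subset> U"
      using YU by blast
    then obtain r W where W: "irreducible_decomposition s n \<rho> Y r W"
      using less.hyps[OF _ Y.sym_rep_axioms] dim_proper_subspace[OF less.prems(2) Y.subspace_U] by blast
    note dec = irreducible_decompositionE[OF vector_space_axioms W]
    have sub: "W i \<subseteq> Y" if "i < r" for i
      using dec(1)[OF that] by (auto simp: subrep_def)
    have "irreducible_decomposition s n \<rho> U (Suc r) (W(r := X))"
    proof (intro irreducible_decompositionI vector_space_axioms)
      show "subrep s n \<rho> U ((W(r := X)) i)" "irreducible_rep s n \<rho> ((W(r := X)) i)" if "i < Suc r" for i
        using that X dec(1,2) subrep_trans[OF Y] by (auto simp: less_Suc_eq)
      show "\<exists>w. (\<forall>i<Suc r. w i \<in> (W(r := X)) i) \<and> u = (\<Sum>i<Suc r. w i)" if u: "u \<in> U" for u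
      proof -
        have PX: "P u \<in> X"
          by (rule hom_spaceD(1)[OF P(1) u])
        have "P (u - P u) = 0"
          using linear_on_diff[OF hom_spaceD(3)[OF P(1)] subspace_U vector_space_axioms u] PX XU P(2)
          by auto
        then have "u - P u \<in> Y"
          using subspace_diff[OF subspace_U u] PX XU by (auto simp: Y_def)
        then obtain w where w: "\<forall>i<r. w i \<in> W i" "u - P u = (\<Sum>i<r. w i)"
          using dec(3) by blast
        have "(\<Sum>i<r. (w(r := P u)) i) = (\<Sum>i<r. w i)"
          by (rule sum.cong) auto
        then have "u = (\<Sum>i<Suc r. (w(r := P u)) i)"
          using w(2) by (simp add: algebra_simps)
        then show ?thesis
          using w(1) PX by (intro exI[of _ "w(r := P u)"]) (auto simp: less_Suc_eq)
      qed
      show "\<forall>i<Suc r. w i = 0"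
        if w: "\<And>i. i < Suc r \<Longrightarrow> w i \<in> (W(r := X)) i" and sum: "(\<Sum>i<Suc r. w i) = 0" for w
      proof -
        have wW: "w i \<in> W i" if "i < r" for i
          using w[of i] that by simp
        have wX: "w r \<in> X"
          using w[of r] by simp
        have sY: "(\<Sum>i<r. w i) \<in> Y"
          using wW sub by (intro subspace_sum[OF Y.subspace_U]) auto
        have "(\<Sum>i<r. w i) + w r = 0"
          using sum by simp
        moreover have "P ((\<Sum>i<r. w i) + w r) = P (\<Sum>i<r. w i) + P (w r)"
          using hom_spaceD(3)[OF P(1)] sY wX YU XU unfolding linear_on_def by blast
        moreover have "P 0 = 0"
          using P(2) subspace_0[OF X.subspace_U] by blast
        ultimately have "w r = 0"
          using sY P(2)[OF wX] by (simp add: Y_def)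
        then have "(\<Sum>i<r. w i) = (\<Sum>i<r. 0)"
          using sum by simp
        then have "\<forall>i<r. w i = 0"
          using dec(4)[of w "\<lambda>_. 0"] wW sY dec(1) subspace_0 by (auto simp: subrep_def)
        then show ?thesis
          using \<open>w r = 0\<close> by (auto simp: less_Suc_eq)
      qed
    qed
    then show ?thesis by blast
  qed
qed

context sym_rep
begin

text \<open>Components are unique and the summands are invariant, so the components of
  \<open>\<rho> \<sigma> x\<close> are the images of the components of \<open>x\<close>. Taking a
  component is therefore an equivariant map.\<close>

lemma decomposition_projections:
  assumes dec: "irreducible_decomposition s n \<rho> U r W"
  obtains q where "\<And>i. i < r \<Longrightarrow> q i \<in> hom_space n s \<rho> U s \<rho> (W i)"
    "\<And>i x. i < r \<Longrightarrow> x \<in> W i \<Longrightarrow> q i x = x"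
    "\<And>i j x. i < r \<Longrightarrow> j < r \<Longrightarrow> i \<noteq> j \<Longrightarrow> x \<in> W j \<Longrightarrow> q i x = 0"
    "\<And>u. u \<in> U \<Longrightarrow> u = (\<Sum>i<r. q i u)"
proof -
  note D = irreducible_decompositionE[OF vector_space_axioms dec]
  have "\<forall>u\<in>U. \<exists>w. (\<forall>i<r. w i \<in> W i) \<and> u = (\<Sum>i<r. w i)"
    using D(3) by blast
  then obtain w where w: "\<And>u i. u \<in> U \<Longrightarrow> i < r \<Longrightarrow> w u i \<in> W i" "\<And>u. u \<in> U \<Longrightarrow> u = (\<Sum>i<r. w u i)"
    by metis
  have sub: "W i \<subseteq> U" "subspace (W i)" if "i < r" for i
    using D(1)[OF that] by (auto simp: subrep_def)
  have uniq: "w u i = v i" if "u \<in> U" "\<And>i. i < r \<Longrightarrow> v i \<in> W i" "u = (\<Sum>i<r. v i)" "i < r" for u v i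
    using D(4)[of "w u" v] w that by metis
  define q where "q i = (\<lambda>u. if u \<in> U then w u i else 0)" for i
  have "q i \<in> hom_space n s \<rho> U s \<rho> (W i)" if i: "i < r" for i
    unfolding q_def
  proof (rule restrict_in_hom_space)
    show "w x i \<in> W i" if "x \<in> U" for x
      using w(1) i that by blast
    show "linear_on s s U (\<lambda>x. w x i)"
      unfolding linear_on_def
    proof (intro conjI ballI allI)
      fix x y assume xy: "x \<in> U" "y \<in> U"
      have sum: "x + y = (\<Sum>i<r. w x i + w y i)"
        using w(2)[OF xy(1)] w(2)[OF xy(2)] by (simp add: sum.distrib)
      show "w (x + y) i = w x i + w y i"
        using w(1)[OF xy(1)] w(1)[OF xy(2)] sub(2)
        by (intro uniq[OF subspace_add[OF subspace_U xy] _ sum i] subspace_add)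
    next
      fix c x assume x: "x \<in> U"
      have sum: "s c x = (\<Sum>i<r. s c (w x i))"
        using w(2)[OF x] by (simp flip: scale_sum_right)
      show "w (s c x) i = s c (w x i)"
        using w(1)[OF x] sub(2)
        by (intro uniq[OF subspace_scale[OF subspace_U x] _ sum i] subspace_scale)
    qed
    show "w (\<rho> \<sigma> x) i = \<rho> \<sigma> (w x i)" if \<sigma>: "\<sigma> permutes {1..n}" and x: "x \<in> U" for \<sigma> x
    proof (rule uniq[OF rho_in[OF \<sigma> x] _ _ i])
      show "\<rho> \<sigma> (w x i) \<in> W i" if "i < r" for i
        using D(1)[OF that] w(1)[OF x that] \<sigma> by (auto simp: subrep_def)
      have "\<rho> \<sigma> x = \<rho> \<sigma> (\<Sum>i<r. w x i)"
        using w(2)[OF x] by simp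
      also have "\<dots> = (\<Sum>i<r. \<rho> \<sigma> (w x i))"
        using w(1)[OF x] sub by (intro rho_sum[OF \<sigma>]) auto
      finally show "\<rho> \<sigma> x = (\<Sum>i<r. \<rho> \<sigma> (w x i))" .
    qed
  qed
  moreover have "q i x = (if i = j then x else 0)" if "i < r" "j < r" "x \<in> W j" for i j x
  proof -
    have "w x i = (if i = j then x else 0)"
      using that sub subspace_0 by (intro uniq) auto
    then show ?thesis
      using that sub by (auto simp: q_def)
  qed
  moreover have "u = (\<Sum>i<r. q i u)" if "u \<in> U" for u
    using w(2)[OF that] that by (simp add: q_def)
  ultimately show ?thesis
    by (intro that[of q]) auto
qed

end

lemma sum_apply: "(\<Sum>i\<in>I. f i) x = (\<Sum>i\<in>I. f i x)" for f :: "'i \<Rightarrow> 'a \<Rightarrow> 'b::ab_group_add"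
  by (induction I rule: infinite_finite_induct) (auto simp: zero_fun_def)

section \<open>Multiplicities as dimensions of spaces of equivariant maps\<close>

lemma hom_space_comp:
  assumes "sym_rep s n \<rho> U" "sym_rep s' n \<rho>' U'" "sym_rep s'' n \<rho>'' U''"
    and f: "f \<in> hom_space n s \<rho> U s' \<rho>' U'" and g: "g \<in> hom_space n s' \<rho>' U' s'' \<rho>'' U''"
  shows "(\<lambda>x. g (f x)) \<in> hom_space n s \<rho> U s'' \<rho>'' U''"
proof -
  interpret U: sym_rep s n \<rho> U by fact
  interpret U': sym_rep s' n \<rho>' U' by fact
  interpret U'': sym_rep s'' n \<rho>'' U'' by fact
  note F = hom_spaceD[OF f] and G = hom_spaceD[OF g]
  have "g 0 = 0"
    by (rule linear_on_zero[OF G(3) U'.subspace_U U'.vector_space_axioms U''.vector_space_axioms])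
  then show ?thesis
    using F G unfolding hom_space_def linear_on_def by auto
qed

lemma rep_iso_inverse:
  assumes "sym_rep s n \<rho> U" "sym_rep s' n \<rho>' U'" "rep_iso n s \<rho> U s' \<rho>' U'"
  shows "\<exists>f g. f \<in> hom_space n s \<rho> U s' \<rho>' U' \<and> g \<in> hom_space n s' \<rho>' U' s \<rho> U \<and>
    (\<forall>x\<in>U. g (f x) = x) \<and> (\<forall>y\<in>U'. f (g y) = y)"
proof -
  interpret U: sym_rep s n \<rho> U by fact
  interpret U': sym_rep s' n \<rho>' U' by fact
  obtain f where f: "bij_betw f U U'" "linear_on s s' U f"
    "\<And>\<sigma> x. \<sigma> permutes {1..n} \<Longrightarrow> x \<in> U \<Longrightarrow> f (\<rho> \<sigma> x) = \<rho>' \<sigma> (f x)"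
    using assms(3) by (auto simp: rep_iso_def)
  define g where "g = inv_into U f"
  have fU: "f x \<in> U'" "g (f x) = x" if "x \<in> U" for x
    using f(1) that by (auto simp: g_def bij_betw_def)
  have gU: "g y \<in> U" "f (g y) = y" if "y \<in> U'" for y
    using f(1) that by (auto simp: g_def bij_betw_def inv_into_into f_inv_into_f)
  have uniq: "g y = x" if "x \<in> U" "f x = y" for x y
    using that fU by auto
  have "(\<lambda>x. if x \<in> U then f x else 0) \<in> hom_space n s \<rho> U s' \<rho>' U'"
    using fU f by (intro U.restrict_in_hom_space) auto
  moreover have "(\<lambda>x. if x \<in> U' then g x else 0) \<in> hom_space n s' \<rho>' U' s \<rho> U"
  proof (rule U'.restrict_in_hom_space)
    show "linear_on s' s U' g"
      unfolding linear_on_def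
    proof (intro conjI ballI allI)
      show "g (x + y) = g x + g y" if "x \<in> U'" "y \<in> U'" for x y
        using f(2) gU[OF that(1)] gU[OF that(2)] U.subspace_add[OF U.subspace_U]
        by (intro uniq) (auto simp: linear_on_def)
      show "g (s' c x) = s c (g x)" if "x \<in> U'" for c x
        using f(2) gU[OF that(1)] U.subspace_scale[OF U.subspace_U]
        by (intro uniq) (auto simp: linear_on_def)
    qed
    show "g (\<rho>' \<sigma> x) = \<rho> \<sigma> (g x)" if "\<sigma> permutes {1..n}" "x \<in> U'" for \<sigma> x
      using that U.rho_in f(3) gU by (intro uniq) auto
  qed (use gU in auto)
  ultimately show ?thesis
    using fU gU by (intro exI[of _ "\<lambda>x. if x \<in> U then f x else 0"]
        exI[of _ "\<lambda>x. if x \<in> U' then g x else 0"]) simp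
qed

context sym_rep
begin

text \<open>The basis consists of the maps \<open>\<psi> i\<close>, the projection onto
  \<open>W i\<close> followed by an isomorphism to \<open>S\<close>, for the summands isomorphic to
  \<open>S\<close>. The hypothesis \<open>scalar\<close> replaces algebraic closedness: it makes
  every equivariant map from such a summand to \<open>S\<close> a multiple of the chosen
  isomorphism.\<close>

theorem hom_space_basis:
  assumes S: "sym_rep s' n \<rho>' S" and irr: "irreducible_rep s' n \<rho>' S"
    and scalar: "\<And>f. f \<in> hom_space n s' \<rho>' S s' \<rho>' S \<Longrightarrow> \<exists>c. \<forall>x\<in>S. f x = s' c x"
    and dec: "irreducible_decomposition s n \<rho> U r W"
  shows "\<exists>B. finite B \<and> B \<subseteq> hom_space n s \<rho> U s' \<rho>' S \<and>
    module.independent (hom_scale s') B \<and> hom_space n s \<rho> U s' \<rho>' S \<subseteq> module.span (hom_scale s') B \<and>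
    card B = card {i \<in> {..<r}. rep_iso n s' \<rho>' S s \<rho> (W i)}"
proof -
  interpret S: sym_rep s' n \<rho>' S by fact
  interpret H: vector_space "hom_scale s'"
    by (rule vector_space_hom_scale[OF S.vector_space_axioms])
  define I where "I = {i \<in> {..<r}. rep_iso n s' \<rho>' S s \<rho> (W i)}"
  have I: "i < r" "rep_iso n s' \<rho>' S s \<rho> (W i)" if "i \<in> I" for i
    using that by (simp_all add: I_def)
  have notI: "\<not> rep_iso n s' \<rho>' S s \<rho> (W i)" if "i < r" "i \<notin> I" for i
    using that by (simp add: I_def)
  have finI: "finite I" and Isub: "I \<subseteq> {..<r}"
    by (auto simp: I_def)
  note D = irreducible_decompositionE[OF vector_space_axioms dec]
  obtain q where q: "\<And>i. i < r \<Longrightarrow> q i \<in> hom_space n s \<rho> U s \<rho> (W i)"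
    "\<And>i x. i < r \<Longrightarrow> x \<in> W i \<Longrightarrow> q i x = x"
    "\<And>i j x. i < r \<Longrightarrow> j < r \<Longrightarrow> i \<noteq> j \<Longrightarrow> x \<in> W j \<Longrightarrow> q i x = 0"
    "\<And>u. u \<in> U \<Longrightarrow> u = (\<Sum>i<r. q i u)"
    using decomposition_projections[OF dec] by blast
  have W: "sym_rep s n \<rho> (W i)" "W i \<subseteq> U" if "i < r" for i
    using sym_rep_subrep D(1)[OF that] by (auto simp: subrep_def)
  have "\<forall>i\<in>I. \<exists>f g. f \<in> hom_space n s' \<rho>' S s \<rho> (W i) \<and> g \<in> hom_space n s \<rho> (W i) s' \<rho>' S \<and>
      (\<forall>x\<in>S. g (f x) = x) \<and> (\<forall>y\<in>W i. f (g y) = y)"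
  proof
    fix i assume "i \<in> I"
    then show "\<exists>f g. f \<in> hom_space n s' \<rho>' S s \<rho> (W i) \<and> g \<in> hom_space n s \<rho> (W i) s' \<rho>' S \<and>
      (\<forall>x\<in>S. g (f x) = x) \<and> (\<forall>y\<in>W i. f (g y) = y)"
      using rep_iso_inverse[OF S W(1) I(2), of i] I(1) by blast
  qed
  from bchoice[OF this] obtain f where "\<forall>i\<in>I. \<exists>g. f i \<in> hom_space n s' \<rho>' S s \<rho> (W i) \<and>
      g \<in> hom_space n s \<rho> (W i) s' \<rho>' S \<and> (\<forall>x\<in>S. g (f i x) = x) \<and> (\<forall>y\<in>W i. f i (g y) = y)"
    by blast
  from bchoice[OF this] obtain g where fg': "\<forall>i\<in>I. f i \<in> hom_space n s' \<rho>' S s \<rho> (W i) \<and>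
      g i \<in> hom_space n s \<rho> (W i) s' \<rho>' S \<and> (\<forall>x\<in>S. g i (f i x) = x) \<and>
      (\<forall>y\<in>W i. f i (g i y) = y)"
    by blast
  have f: "f i \<in> hom_space n s' \<rho>' S s \<rho> (W i)"
    and g: "g i \<in> hom_space n s \<rho> (W i) s' \<rho>' S"
    and gf: "\<And>x. x \<in> S \<Longrightarrow> g i (f i x) = x"
    and fg: "\<And>y. y \<in> W i \<Longrightarrow> f i (g i y) = y" if "i \<in> I" for i
    using bspec[OF fg' that] by blast+
  define \<psi> where "\<psi> i = (\<lambda>x. g i (q i x))" for i
  have \<psi>: "\<psi> i \<in> hom_space n s \<rho> U s' \<rho>' S" if "i \<in> I" for i
    unfolding \<psi>_def using I(1)[OF that]
    by (intro hom_space_comp[OF sym_rep_axioms W(1) S q(1) g[OF that]])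
  have g0: "g i 0 = 0" if "i \<in> I" for i
    using linear_on_zero[OF hom_spaceD(3)[OF g[OF that]] sym_rep.subspace_U[OF W(1)] vector_space_axioms
        S.vector_space_axioms] I(1)[OF that] by auto
  have \<psi>f: "\<psi> i (f j x) = (if i = j then x else 0)" if "i \<in> I" "j \<in> I" "x \<in> S" for i j x
    using q(2)[OF I(1)[OF that(1)], of "f j x"] q(3)[OF I(1)[OF that(1)] I(1)[OF that(2)], of "f j x"]
      hom_spaceD(1)[OF f[OF that(2)] that(3)] gf[OF that(1,3)] g0[OF that(1)]
    by (auto simp: \<psi>_def)
  \<comment> \<open>A test vector: \<open>\<psi> i\<close> maps \<open>f j v\<close> to
    \<open>v\<close> if i = j and to 0 otherwise, which gives both the injectivity of \<psi> and the
    independence of its values.\<close>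
  obtain v where v: "v \<in> S" "v \<noteq> 0"
    using conjunct1[OF irr[unfolded irreducible_rep_def]] S.subspace_0[OF S.subspace_U] by blast
  have inj: "inj_on \<psi> I"
  proof (rule inj_onI)
    fix i j assume ij: "i \<in> I" "j \<in> I" "\<psi> i = \<psi> j"
    show "i = j"
    proof (rule ccontr)
      assume ne: "i \<noteq> j"
      have "v = \<psi> i (f i v)"
        using \<psi>f[OF ij(1) ij(1) v(1)] unfolding if_P[OF refl] by (rule sym)
      also have "\<dots> = \<psi> j (f i v)"
        by (rule fun_cong[OF ij(3)])
      also have "\<dots> = 0"
        unfolding \<psi>f[OF ij(2) ij(1) v(1)] by (rule if_not_P) (use ne in blast)
      finally show False
        using v(2) by contradiction
    qed
  qed
  have "H.independent (\<psi> ` I)"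
  proof (rule H.independent_if_scalars_zero)
    fix c x assume sum: "(\<Sum>x\<in>\<psi> ` I. hom_scale s' (c x) x) = 0" and "x \<in> \<psi> ` I"
    then obtain j where j: "j \<in> I" "x = \<psi> j"
      by auto
    have "0 = (\<Sum>i\<in>I. hom_scale s' (c (\<psi> i)) (\<psi> i)) (f j v)"
      using sum by (simp add: sum.reindex[OF inj])
    also have "\<dots> = (\<Sum>i\<in>I. s' (c (\<psi> i)) (\<psi> i (f j v)))"
      by (simp add: sum_apply hom_scale_def)
    also have "\<dots> = (\<Sum>i\<in>I. if i = j then s' (c (\<psi> i)) v else 0)"
      using \<psi>f j v by (intro sum.cong) auto
    also have "\<dots> = s' (c x) v"
      using j finI by simp
    finally show "c x = 0"
      using v by simp
  qed (use finI in simp)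
  moreover have "h \<in> H.span (\<psi> ` I)" if h: "h \<in> hom_space n s \<rho> U s' \<rho>' S" for h
  proof -
    have hW: "(\<lambda>x. if x \<in> W i then h x else 0) \<in> hom_space n s \<rho> (W i) s' \<rho>' S" if "i < r" for i
      using W[OF that] hom_spaceD[OF h]
      by (intro sym_rep.restrict_in_hom_space[OF W(1)[OF that]] linear_on_subset[OF hom_spaceD(3)[OF h]])
        auto
    \<comment> \<open>By Schur's lemma, \<open>h\<close> would be an isomorphism to \<open>S\<close>
      on any summand where it does not vanish, so only the summands indexed by \<open>I\<close>
      contribute.\<close>
    have zero: "h x = 0" if "i < r" "i \<notin> I" "x \<in> W i" for i x
    proof (rule ccontr)
      note Wi = W(1)[OF that(1)]
      assume "h x \<noteq> 0"
      then have bij: "bij_betw (\<lambda>x. if x \<in> W i then h x else 0) (W i) S"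
        using that D(2) by (intro sym_rep.schur[OF W(1) S hW _ irr]) auto
      then have "rep_iso n s \<rho> (W i) s' \<rho>' S"
        using hom_spaceD(3,4)[OF hW[OF that(1)]] unfolding rep_iso_def by blast
      then obtain f g where fg: "f \<in> hom_space n s \<rho> (W i) s' \<rho>' S" "g \<in> hom_space n s' \<rho>' S s \<rho> (W i)"
        "\<And>x. x \<in> W i \<Longrightarrow> g (f x) = x" "\<And>y. y \<in> S \<Longrightarrow> f (g y) = y"
        using rep_iso_inverse[OF Wi S] by blast
      have "bij_betw g S (W i)"
        using hom_spaceD(1)[OF fg(1)] hom_spaceD(1)[OF fg(2)] fg(3,4) by (intro bij_betwI[of g _ _ f]) auto
      then have "rep_iso n s' \<rho>' S s \<rho> (W i)"
        using hom_spaceD(3,4)[OF fg(2)] unfolding rep_iso_def by blast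
      then show False
        using notI[OF that(1,2)] by contradiction
    qed
    have "\<exists>c. \<forall>x\<in>S. h (f i x) = s' c x" if "i \<in> I" for i
    proof -
      have i: "i < r"
        using I(1)[OF that] .
      note fi = f[OF that]
      obtain c where "\<forall>x\<in>S. (if f i x \<in> W i then h (f i x) else 0) = s' c x"
        using scalar[OF hom_space_comp[OF S W(1)[OF i] S fi hW[OF i]]] by blast
      then show ?thesis
        using hom_spaceD(1)[OF fi] by auto
    qed
    then obtain c where c: "\<And>i x. i \<in> I \<Longrightarrow> x \<in> S \<Longrightarrow> h (f i x) = s' (c i) x"
      by metis
    have "h = (\<Sum>i\<in>I. hom_scale s' (c i) (\<psi> i))"
    proof
      fix u
      have R: "(\<Sum>i\<in>I. hom_scale s' (c i) (\<psi> i)) u = (\<Sum>i\<in>I. s' (c i) (\<psi> i u))"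
        by (simp add: sum_apply hom_scale_def)
      show "h u = (\<Sum>i\<in>I. hom_scale s' (c i) (\<psi> i)) u"
      proof (cases "u \<in> U")
        case False
        then show ?thesis
          unfolding R using hom_spaceD(2)[OF h False] hom_spaceD(2)[OF \<psi> False] by simp
      next
        case True
        have qW: "q i u \<in> W i" if "i < r" for i
          using hom_spaceD(1)[OF q(1)[OF that] True] .
        have "h u = h (\<Sum>i<r. q i u)"
          using q(4)[OF True] by simp
        also have "\<dots> = (\<Sum>i<r. h (q i u))"
          using qW W by (intro linear_on_sum[OF hom_spaceD(3)[OF h] subspace_U vector_space_axioms
                S.vector_space_axioms]) auto
        also have "\<dots> = (\<Sum>i\<in>I. h (q i u))"
          using zero[OF _ _ qW] Isub by (intro sum.mono_neutral_right) auto
        also have "\<dots> = (\<Sum>i\<in>I. s' (c i) (\<psi> i u))"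
        proof (rule sum.cong)
          fix i assume i: "i \<in> I"
          then have "h (q i u) = h (f i (g i (q i u)))"
            using fg[OF i qW[OF I(1)[OF i]]] by simp
          also have "\<dots> = s' (c i) (\<psi> i u)"
            using c[OF i hom_spaceD(1)[OF g[OF i] qW[OF I(1)[OF i]]]] by (simp add: \<psi>_def)
          finally show "h (q i u) = s' (c i) (\<psi> i u)" .
        qed simp
        finally show ?thesis
          unfolding R .
      qed
    qed
    moreover have "(\<Sum>i\<in>I. hom_scale s' (c i) (\<psi> i)) \<in> H.span (\<psi> ` I)"
      by (intro H.span_sum H.span_scale H.span_base imageI)
    ultimately show ?thesis
      by metis
  qed
  ultimately show ?thesis
    using \<psi> card_image[OF inj] finI unfolding I_def[symmetric]
    by (intro exI[of _ "\<psi> ` I"]) auto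
qed

text \<open>In every decomposition the number of summands isomorphic to \<open>S\<close> is the
  dimension of the space of equivariant maps to \<open>S\<close>. Hence it does not depend on the
  decomposition, and the definite description in \<open>rep_multiplicity\<close> denotes it.\<close>

lemma rep_multiplicity_basis:
  assumes S: "sym_rep s' n \<rho>' S" and irr: "irreducible_rep s' n \<rho>' S"
    and scalar: "\<And>f. f \<in> hom_space n s' \<rho>' S s' \<rho>' S \<Longrightarrow> \<exists>c. \<forall>x\<in>S. f x = s' c x"
    and fin: "finite_dimensional s U"
  shows "\<exists>B. finite B \<and> B \<subseteq> hom_space n s \<rho> U s' \<rho>' S \<and>
    module.independent (hom_scale s') B \<and> hom_space n s \<rho> U s' \<rho>' S \<subseteq> module.span (hom_scale s') B \<and>
    card B = rep_multiplicity n s' \<rho>' S s \<rho> U"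
proof -
  interpret S: sym_rep s' n \<rho>' S by fact
  interpret H: vector_space "hom_scale s'"
    by (rule vector_space_hom_scale[OF S.vector_space_axioms])
  obtain r W where dec: "irreducible_decomposition s n \<rho> U r W"
    using exists_irreducible_decomposition[OF sym_rep_axioms fin] by blast
  have dim: "card {i \<in> {..<r}. rep_iso n s' \<rho>' S s \<rho> (W i)} = H.dim (hom_space n s \<rho> U s' \<rho>' S)"
    if "irreducible_decomposition s n \<rho> U r W" for r W
    using hom_space_basis[OF S irr scalar that] H.basis_card_eq_dim by metis
  have "rep_multiplicity n s' \<rho>' S s \<rho> U = H.dim (hom_space n s \<rho> U s' \<rho>' S)"
    unfolding rep_multiplicity_def
    by (rule the_equality) (use dec dim in metis)+
  then show ?thesis
    using hom_space_basis[OF S irr scalar dec] dim[OF dec] by simp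
qed

end

section \<open>Antisymmetrizers\<close>

definition perm_subgroup :: "nat \<Rightarrow> (nat \<Rightarrow> nat) set \<Rightarrow> bool" where
  "perm_subgroup n C \<longleftrightarrow> C \<subseteq> {\<pi>. \<pi> permutes {1..n}} \<and> id \<in> C \<and>
    (\<forall>\<pi>\<in>C. \<forall>\<tau>\<in>C. \<pi> \<circ> \<tau> \<in> C) \<and> (\<forall>\<pi>\<in>C. inv \<pi> \<in> C)"

lemma perm_subgroupD:
  assumes "perm_subgroup n C"
  shows "\<pi> \<in> C \<Longrightarrow> \<pi> permutes {1..n}" "id \<in> C" "\<pi> \<in> C \<Longrightarrow> \<tau> \<in> C \<Longrightarrow> \<pi> \<circ> \<tau> \<in> C"
    "\<pi> \<in> C \<Longrightarrow> inv \<pi> \<in> C" "finite C"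
proof -
  have "C \<subseteq> {\<pi>. \<pi> permutes {1..n}}"
    using assms by (simp add: perm_subgroup_def)
  then show "finite C"
    by (rule finite_subset) (simp add: finite_permutations)
qed (use assms in \<open>auto simp: perm_subgroup_def\<close>)

lemma sum_compose_right:
  assumes C: "perm_subgroup n C" and \<tau>: "\<tau> \<in> C"
  shows "(\<Sum>\<pi>\<in>C. f \<pi>) = (\<Sum>\<pi>\<in>C. f (\<pi> \<circ> \<tau>))"
proof -
  have "\<tau> permutes {1..n}"
    by (rule perm_subgroupD(1)[OF C \<tau>])
  then have "\<pi> \<circ> \<tau> \<circ> inv \<tau> = \<pi>" "\<pi> \<circ> inv \<tau> \<circ> \<tau> = \<pi>" for \<pi> :: "nat \<Rightarrow> nat"
    by (simp_all add: permutes_inv_o flip: o_assoc)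
  then show ?thesis
    using perm_subgroupD[OF C] \<tau>
    by (intro sum.reindex_bij_witness[of _ "\<lambda>\<pi>. \<pi> \<circ> \<tau>" "\<lambda>\<pi>. \<pi> \<circ> inv \<tau>"]) simp_all
qed

text \<open>The signed sum of the elements of \<open>C\<close> in the group algebra, applied to
  \<open>x\<close>; Young's column antisymmetrizer if \<open>C\<close> is a column stabilizer. The
  set \<open>C\<close> is arbitrary, since its images under conjugation occur as well.\<close>

definition alternator ::
    "('k::field \<Rightarrow> 'v::ab_group_add \<Rightarrow> 'v) \<Rightarrow> ((nat \<Rightarrow> nat) \<Rightarrow> 'v \<Rightarrow> 'v) \<Rightarrow> (nat \<Rightarrow> nat) set \<Rightarrow> 'v \<Rightarrow> 'v"
  where
  "alternator s \<rho> C x = (\<Sum>\<pi>\<in>C. s (of_int (sign \<pi>)) (\<rho> \<pi> x))"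

lemma sign_comp_permutes:
  "\<sigma> permutes {1..n::nat} \<Longrightarrow> \<tau> permutes {1..n} \<Longrightarrow> sign (\<sigma> \<circ> \<tau>) = sign \<sigma> * sign \<tau>"
  using permutation_permutes by (intro sign_compose) blast+

lemma alternator_hom:
  assumes "sym_rep s n \<rho> U" "sym_rep s' n \<rho>' U'" and f: "f \<in> hom_space n s \<rho> U s' \<rho>' U'"
    and C: "C \<subseteq> {\<pi>. \<pi> permutes {1..n}}" and x: "x \<in> U"
  shows "f (alternator s \<rho> C x) = alternator s' \<rho>' C (f x)"
proof -
  interpret U: sym_rep s n \<rho> U by fact
  interpret U': sym_rep s' n \<rho>' U' by fact
  have "f (alternator s \<rho> C x) = (\<Sum>\<pi>\<in>C. f (s (of_int (sign \<pi>)) (\<rho> \<pi> x)))"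
    unfolding alternator_def using C U.rho_in[OF _ x] U.subspace_scale[OF U.subspace_U]
    by (intro linear_on_sum[OF hom_spaceD(3)[OF f] U.subspace_U U.vector_space_axioms
          U'.vector_space_axioms]) auto
  also have "\<dots> = alternator s' \<rho>' C (f x)"
    unfolding alternator_def
  proof (rule sum.cong)
    fix \<pi> assume "\<pi> \<in> C"
    then have \<pi>: "\<pi> permutes {1..n}"
      using C by auto
    show "f (s (of_int (sign \<pi>)) (\<rho> \<pi> x)) = s' (of_int (sign \<pi>)) (\<rho>' \<pi> (f x))"
      using hom_spaceD(3)[OF f] hom_spaceD(4)[OF f \<pi> x] U.rho_in[OF \<pi> x] by (simp add: linear_on_def)
  qed simp
  finally show ?thesis .
qed

context sym_rep
begin

lemma alternator_in: "C \<subseteq> {\<pi>. \<pi> permutes {1..n}} \<Longrightarrow> x \<in> U \<Longrightarrow> alternator s \<rho> C x \<in> U"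
  unfolding alternator_def by (intro subspace_sum[OF subspace_U] subspace_scale[OF subspace_U] rho_in) auto

lemma alternator_linear:
  assumes "C \<subseteq> {\<pi>. \<pi> permutes {1..n}}"
  shows "linear_on s s U (alternator s \<rho> C)"
  unfolding linear_on_def
proof (intro conjI ballI allI)
  fix x y assume xy: "x \<in> U" "y \<in> U"
  have "alternator s \<rho> C (x + y) = (\<Sum>\<pi>\<in>C. s (of_int (sign \<pi>)) (\<rho> \<pi> x) + s (of_int (sign \<pi>)) (\<rho> \<pi> y))"
    unfolding alternator_def using assms rho_add[OF _ xy]
    by (intro sum.cong) (auto simp: scale_right_distrib)
  then show "alternator s \<rho> C (x + y) = alternator s \<rho> C x + alternator s \<rho> C y"
    by (simp add: alternator_def sum.distrib)
next
  fix c x assume x: "x \<in> U"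
  have "alternator s \<rho> C (s c x) = (\<Sum>\<pi>\<in>C. s c (s (of_int (sign \<pi>)) (\<rho> \<pi> x)))"
    unfolding alternator_def using assms rho_scale[OF _ x]
    by (intro sum.cong) (auto simp: mult.commute)
  then show "alternator s \<rho> C (s c x) = s c (alternator s \<rho> C x)"
    by (simp add: alternator_def scale_sum_right)
qed

lemma alternator_rho:
  assumes C: "perm_subgroup n C" and \<tau>: "\<tau> \<in> C" and x: "x \<in> U"
  shows "alternator s \<rho> C (\<rho> \<tau> x) = s (of_int (sign \<tau>)) (alternator s \<rho> C x)"
proof -
  have "alternator s \<rho> C x = (\<Sum>\<pi>\<in>C. s (of_int (sign (\<pi> \<circ> \<tau>))) (\<rho> (\<pi> \<circ> \<tau>) x))"
    unfolding alternator_def by (rule sum_compose_right[OF C \<tau>])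
  also have "\<dots> = (\<Sum>\<pi>\<in>C. s (of_int (sign \<tau>)) (s (of_int (sign \<pi>)) (\<rho> \<pi> (\<rho> \<tau> x))))"
    using perm_subgroupD(1)[OF C] \<tau> x
    by (intro sum.cong) (simp_all add: sign_comp_permutes[of _ n] rho_comp mult.commute)
  also have "\<dots> = s (of_int (sign \<tau>)) (alternator s \<rho> C (\<rho> \<tau> x))"
    by (simp add: alternator_def scale_sum_right)
  finally show ?thesis
    by (simp flip: of_int_mult)
qed

text \<open>Replacing \<open>x\<close> by \<open>\<rho> \<tau> x\<close> changes the sign of the
  alternator but not its argument, and 2 is invertible. This is what kills two entries in one row of
  a tabloid, and two points of the same colour.\<close>

lemma alternator_eq_0:
  assumes C: "perm_subgroup n C" and \<tau>: "\<tau> \<in> C" "sign \<tau> = -1" and x: "x \<in> U" "\<rho> \<tau> x = x"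
  shows "alternator s \<rho> C x = 0"
proof -
  have "alternator s \<rho> C x = - alternator s \<rho> C x"
    using alternator_rho[OF C \<tau>(1) x(1)] \<tau>(2) x(2) by simp
  then have "s 2 (alternator s \<rho> C x) = 0"
    by (metis add.right_inverse one_add_one scale_left_distrib scale_one)
  then show ?thesis
    by simp
qed

text \<open>Each element of \<open>K\<close> changes the alternator of \<open>C\<close> only by its
  sign, which cancels the sign in the inner sum. For K = C this is the quasi-idempotence of the
  antisymmetrizer.\<close>

lemma alternator_absorb:
  assumes C: "perm_subgroup n C" and K: "K \<subseteq> C" and x: "x \<in> U"
  shows "alternator s \<rho> C (alternator s \<rho> K x) = s (of_nat (card K)) (alternator s \<rho> C x)"
proof -
  have Cp: "C \<subseteq> {\<pi>. \<pi> permutes {1..n}}"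
    using C by (simp add: perm_subgroup_def)
  note L = alternator_linear[OF Cp]
  have "alternator s \<rho> C (alternator s \<rho> K x) = (\<Sum>\<pi>\<in>K. alternator s \<rho> C (s (of_int (sign \<pi>)) (\<rho> \<pi> x)))"
    unfolding alternator_def[of _ _ K] using K Cp x
    by (intro linear_on_sum[OF L subspace_U vector_space_axioms vector_space_axioms]
        subspace_scale[OF subspace_U] rho_in) auto
  also have "\<dots> = (\<Sum>\<pi>\<in>K. alternator s \<rho> C x)"
  proof (rule sum.cong)
    fix \<pi> assume "\<pi> \<in> K"
    then have \<pi>: "\<pi> \<in> C" "\<pi> permutes {1..n}"
      using K Cp by auto
    have "alternator s \<rho> C (s (of_int (sign \<pi>)) (\<rho> \<pi> x)) = s (of_int (sign \<pi>)) (alternator s \<rho> C (\<rho> \<pi> x))"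
      using L rho_in[OF \<pi>(2) x] unfolding linear_on_def by blast
    also have "\<dots> = alternator s \<rho> C x"
      using alternator_rho[OF C \<pi>(1) x] by (simp flip: of_int_mult)
    finally show "alternator s \<rho> C (s (of_int (sign \<pi>)) (\<rho> \<pi> x)) = alternator s \<rho> C x" .
  qed simp
  finally show ?thesis
    by (simp add: sum_constant_scale)
qed

text \<open>Conjugation preserves signs. If \<sigma> normalizes \<open>C\<close>, its action
  commutes with the alternator.\<close>

lemma rho_alternator:
  assumes \<sigma>: "\<sigma> permutes {1..n}" and C: "C \<subseteq> {\<pi>. \<pi> permutes {1..n}}" and x: "x \<in> U"
  shows "\<rho> \<sigma> (alternator s \<rho> C x) = alternator s \<rho> ((\<lambda>\<pi>. \<sigma> \<circ> \<pi> \<circ> inv \<sigma>) ` C) (\<rho> \<sigma> x)"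
proof -
  have inv: "inv \<sigma> \<circ> \<sigma> = id" "inv \<sigma> permutes {1..n}"
    using permutes_inv_o[OF \<sigma>] permutes_inv[OF \<sigma>] by auto
  have inj: "inj_on (\<lambda>\<pi>. \<sigma> \<circ> \<pi> \<circ> inv \<sigma>) C"
  proof (rule inj_onI)
    fix \<pi> \<pi>' assume "\<sigma> \<circ> \<pi> \<circ> inv \<sigma> = \<sigma> \<circ> \<pi>' \<circ> inv \<sigma>"
    then have "inv \<sigma> \<circ> (\<sigma> \<circ> \<pi> \<circ> inv \<sigma>) \<circ> \<sigma> = inv \<sigma> \<circ> (\<sigma> \<circ> \<pi>' \<circ> inv \<sigma>) \<circ> \<sigma>"
      by simp
    then have "(inv \<sigma> \<circ> \<sigma>) \<circ> \<pi> \<circ> (inv \<sigma> \<circ> \<sigma>) = (inv \<sigma> \<circ> \<sigma>) \<circ> \<pi>' \<circ> (inv \<sigma> \<circ> \<sigma>)"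
      by (simp only: o_assoc)
    then show "\<pi> = \<pi>'"
      by (simp add: inv(1))
  qed
  have "\<rho> \<sigma> (alternator s \<rho> C x) = (\<Sum>\<pi>\<in>C. \<rho> \<sigma> (s (of_int (sign \<pi>)) (\<rho> \<pi> x)))"
    unfolding alternator_def using C x
    by (intro rho_sum[OF \<sigma>] subspace_scale[OF subspace_U] rho_in) auto
  also have "\<dots> = (\<Sum>\<pi>\<in>C. s (of_int (sign (\<sigma> \<circ> \<pi> \<circ> inv \<sigma>))) (\<rho> (\<sigma> \<circ> \<pi> \<circ> inv \<sigma>) (\<rho> \<sigma> x)))"
  proof (rule sum.cong)
    fix \<pi> assume "\<pi> \<in> C"
    then have \<pi>: "\<pi> permutes {1..n}"
      using C by auto
    have \<sigma>\<pi>: "\<sigma> \<circ> \<pi> permutes {1..n}"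
      by (rule permutes_compose[OF \<pi> \<sigma>])
    have "sign (inv \<sigma>) = sign \<sigma>"
      using \<sigma> permutation_permutes by (intro sign_inverse) blast
    then have "sign (\<sigma> \<circ> \<pi> \<circ> inv \<sigma>) = sign \<pi>"
      using sign_comp_permutes[OF \<sigma>\<pi> inv(2)] sign_comp_permutes[OF \<sigma> \<pi>] by simp
    moreover have "\<rho> (\<sigma> \<circ> \<pi> \<circ> inv \<sigma>) (\<rho> \<sigma> x) = \<rho> \<sigma> (\<rho> \<pi> x)"
      using rho_comp[OF \<sigma>\<pi> inv(2) rho_in[OF \<sigma> x]] rho_inv'[OF \<sigma> x] rho_comp[OF \<sigma> \<pi> x] by simp
    ultimately show "\<rho> \<sigma> (s (of_int (sign \<pi>)) (\<rho> \<pi> x)) =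
        s (of_int (sign (\<sigma> \<circ> \<pi> \<circ> inv \<sigma>))) (\<rho> (\<sigma> \<circ> \<pi> \<circ> inv \<sigma>) (\<rho> \<sigma> x))"
      using rho_scale[OF \<sigma> rho_in[OF \<pi> x]] by simp
  qed simp
  also have "\<dots> = alternator s \<rho> ((\<lambda>\<pi>. \<sigma> \<circ> \<pi> \<circ> inv \<sigma>) ` C) (\<rho> \<sigma> x)"
    unfolding alternator_def by (simp add: sum.reindex[OF inj])
  finally show ?thesis .
qed

end

section \<open>Specht modules\<close>

text \<open>Induction on the rows. Suppose that all rows before row \<open>i\<close> agree and (i,
  j) is in \<open>A\<close> but not in \<open>D\<close>. By \<open>down\<close>, column
  \<open>j\<close> of \<open>D\<close> then lies entirely before row \<open>i\<close>, hence inside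
  \<open>A\<close>, and column \<open>j\<close> of \<open>A\<close> is strictly larger. So row
  \<open>i\<close> of \<open>A\<close> is contained in that of \<open>D\<close>, and it has the same
  size.\<close>

lemma same_margins_eq:
  fixes A D :: "(nat \<times> 'b) set"
  assumes fin: "finite A" "finite D"
    and rows: "\<And>i. card {p \<in> A. fst p = i} = card {p \<in> D. fst p = i}"
    and cols: "\<And>j. card {p \<in> A. snd p = j} = card {p \<in> D. snd p = j}"
    and down: "\<And>i i' j. (i, j) \<in> D \<Longrightarrow> i' \<le> i \<Longrightarrow> (i', j) \<in> D"
  shows "A = D"
proof -
  have "{p \<in> A. fst p = i} = {p \<in> D. fst p = i}" for i
  proof (induction i rule: less_induct)
    case (less i)
    have "(i, j) \<in> D" if A: "(i, j) \<in> A" for j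
    proof (rule ccontr)
      assume nD: "(i, j) \<notin> D"
      have "{p \<in> D. snd p = j} \<subseteq> {p \<in> A. snd p = j}"
      proof
        fix p assume p: "p \<in> {p \<in> D. snd p = j}"
        then have "(fst p, j) \<in> D"
          by (cases p) auto
        then have "fst p < i"
          using nD down[of "fst p" j i] by (meson not_less)
        then show "p \<in> {p \<in> A. snd p = j}"
          using less[of "fst p"] p by blast
      qed
      then have sub: "{p \<in> D. snd p = j} \<subset> {p \<in> A. snd p = j}"
        using A nD by (metis (mono_tags, lifting) mem_Collect_eq psubsetI snd_conv)
      show False
        using psubset_card_mono[OF _ sub] fin(1) cols[of j] by simp
    qed
    then show ?case
      using fin rows[of i] by (intro card_subset_eq) auto
  qed
  then show ?thesis
    by blast
qed

lemma finite_young_diagram: "finite (young_diagram \<mu>)"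
proof (rule finite_subset)
  show "young_diagram \<mu> \<subseteq> Sigma {..<length \<mu>} (\<lambda>i. {..<\<mu> ! i})"
    by (auto simp: young_diagram_def)
qed auto

lemma card_young_diagram: "card (young_diagram \<mu>) = sum_list \<mu>"
proof -
  have "young_diagram \<mu> = Sigma {..<length \<mu>} (\<lambda>i. {..<\<mu> ! i})"
    by (auto simp: young_diagram_def)
  then show ?thesis
    by (simp add: sum_list_sum_nth atLeast0LessThan)
qed

lemma exists_tableau: "\<exists>t. tableau \<mu> t"
  unfolding tableau_def
  by (rule finite_same_card_bij) (auto simp: finite_young_diagram card_young_diagram)

lemma young_diagram_down:
  assumes "sorted_wrt (\<ge>) \<mu>" "(i, j) \<in> young_diagram \<mu>" "i' \<le> i"
  shows "(i', j) \<in> young_diagram \<mu>"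
proof (cases "i' = i")
  case False
  then have "\<mu> ! i \<le> \<mu> ! i'"
    using assms by (auto simp: young_diagram_def sorted_wrt_iff_nth_less)
  then show ?thesis
    using assms by (auto simp: young_diagram_def)
qed (use assms in simp)

lemma tableau_in: "tableau \<mu> t \<Longrightarrow> c \<in> young_diagram \<mu> \<Longrightarrow> t c \<in> {1..sum_list \<mu>}"
  unfolding tableau_def by (rule bij_betw_apply)

lemma tableau_eq_iff:
  "tableau \<mu> t \<Longrightarrow> c \<in> young_diagram \<mu> \<Longrightarrow> c' \<in> young_diagram \<mu> \<Longrightarrow> t c = t c' \<longleftrightarrow> c = c'"
  unfolding tableau_def by (meson bij_betw_imp_inj_on inj_on_eq_iff)

lemma tableau_surj: "tableau \<mu> t \<Longrightarrow> x \<in> {1..sum_list \<mu>} \<Longrightarrow> \<exists>c\<in>young_diagram \<mu>. x = t c"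
  unfolding tableau_def bij_betw_def by blast

lemma tableau_comp:
  "tableau \<mu> t \<Longrightarrow> \<sigma> permutes {1..sum_list \<mu>} \<Longrightarrow> tableau \<mu> (\<sigma> \<circ> t)"
  unfolding tableau_def using bij_betw_trans permutes_imp_bij by blast

lemma tableau_permutation:
  assumes t: "tableau \<mu> t" and s: "tableau \<mu> s"
  shows "\<exists>\<sigma>. \<sigma> permutes {1..sum_list \<mu>} \<and> (\<forall>c\<in>young_diagram \<mu>. \<sigma> (t c) = s c)"
proof -
  define \<sigma> where "\<sigma> x = (if x \<in> {1..sum_list \<mu>} then s (inv_into (young_diagram \<mu>) t x) else x)" for x
  have "bij_betw (s \<circ> inv_into (young_diagram \<mu>) t) {1..sum_list \<mu>} {1..sum_list \<mu>}"
    using s t unfolding tableau_def by (blast intro: bij_betw_trans bij_betw_inv_into)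
  then have "bij_betw \<sigma> {1..sum_list \<mu>} {1..sum_list \<mu>}"
    by (rule bij_betw_cong[THEN iffD1, rotated]) (simp add: \<sigma>_def)
  then have "\<sigma> permutes {1..sum_list \<mu>}"
    by (rule bij_imp_permutes) (auto simp: \<sigma>_def)
  moreover have "\<sigma> (t c) = s c" if "c \<in> young_diagram \<mu>" for c
    using tableau_in[OF t that] bij_betw_inv_into_left[OF t[unfolded tableau_def] that]
    by (simp add: \<sigma>_def)
  ultimately show ?thesis
    by blast
qed

lemma tableau_cells: "tableau \<mu> t \<Longrightarrow> bij_betw \<beta> (young_diagram \<mu>) (young_diagram \<mu>) \<Longrightarrow> tableau \<mu> (t \<circ> \<beta>)"
  unfolding tableau_def by (rule bij_betw_trans)

lemma tabloid_comp: "tabloid \<mu> (\<sigma> \<circ> t) = (\<lambda>i. \<sigma> ` tabloid \<mu> t i)"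
  by (simp add: tabloid_def image_image fun_eq_iff)

lemma tableau_in_tabloid_iff:
  "tableau \<mu> t \<Longrightarrow> c \<in> young_diagram \<mu> \<Longrightarrow> t c \<in> tabloid \<mu> t i \<longleftrightarrow> fst c = i"
  unfolding tabloid_def tableau_def
  by (subst inj_on_image_mem_iff[OF bij_betw_imp_inj_on]) auto

lemma tabloid_cong: "(\<And>c. c \<in> young_diagram \<mu> \<Longrightarrow> t c = t' c) \<Longrightarrow> tabloid \<mu> t = tabloid \<mu> t'"
  by (auto simp: tabloid_def fun_eq_iff image_iff)

lemma perm_subgroup_column_stabilizer: "perm_subgroup (sum_list \<mu>) (column_stabilizer \<mu> t)"
proof -
  have "inv \<pi> ` A = A" if "\<pi> permutes {1..sum_list \<mu>}" "\<pi> ` A = A" for \<pi> A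
    using that by (metis image_inv_f_f permutes_inj)
  moreover have "(\<pi> \<circ> \<tau>) ` A = A" if "\<pi> ` A = A" "\<tau> ` A = A" for \<pi> \<tau> :: "nat \<Rightarrow> nat" and A
    using that by (metis image_comp)
  ultimately show ?thesis
    unfolding perm_subgroup_def column_stabilizer_def
    by (auto simp: permutes_id permutes_inv intro: permutes_compose)
qed

text \<open>It is enough that no entry leaves its column: an injective map of a finite column into
  itself is onto.\<close>

lemma column_stabilizer_iff:
  assumes t: "tableau \<mu> t"
  shows "\<pi> \<in> column_stabilizer \<mu> t \<longleftrightarrow> \<pi> permutes {1..sum_list \<mu>} \<and>
    (\<forall>c\<in>young_diagram \<mu>. \<exists>c'\<in>young_diagram \<mu>. \<pi> (t c) = t c' \<and> snd c' = snd c)"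
proof (intro iffI conjI ballI; (elim conjE)?)
  show "\<pi> permutes {1..sum_list \<mu>}" if "\<pi> \<in> column_stabilizer \<mu> t"
    using that by (simp add: column_stabilizer_def)
  show "\<exists>c'\<in>young_diagram \<mu>. \<pi> (t c) = t c' \<and> snd c' = snd c"
    if "\<pi> \<in> column_stabilizer \<mu> t" "c \<in> young_diagram \<mu>" for c
  proof -
    have "\<pi> ` t ` {c' \<in> young_diagram \<mu>. snd c' = snd c} = t ` {c' \<in> young_diagram \<mu>. snd c' = snd c}"
      using that(1) unfolding column_stabilizer_def by blast
    then have "\<pi> (t c) \<in> t ` {c' \<in> young_diagram \<mu>. snd c' = snd c}"
      using that(2) by blast
    then show ?thesis
      by auto
  qed
  assume \<pi>: "\<pi> permutes {1..sum_list \<mu>}"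
    "\<forall>c\<in>young_diagram \<mu>. \<exists>c'\<in>young_diagram \<mu>. \<pi> (t c) = t c' \<and> snd c' = snd c"
  have "\<pi> ` t ` {c \<in> young_diagram \<mu>. snd c = j} = t ` {c \<in> young_diagram \<mu>. snd c = j}" for j
  proof (rule endo_inj_surj)
    show "\<pi> ` t ` {c \<in> young_diagram \<mu>. snd c = j} \<subseteq> t ` {c \<in> young_diagram \<mu>. snd c = j}"
      using \<pi>(2) by fastforce
    show "inj_on \<pi> (t ` {c \<in> young_diagram \<mu>. snd c = j})"
      by (rule permutes_inj_on[OF \<pi>(1)])
  qed (simp add: finite_young_diagram)
  then show "\<pi> \<in> column_stabilizer \<mu> t"
    using \<pi>(1) by (simp add: column_stabilizer_def)
qed

lemma column_stabilizer_comp: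
  assumes t: "tableau \<mu> t" and \<sigma>: "\<sigma> permutes {1..sum_list \<mu>}"
  shows "column_stabilizer \<mu> (\<sigma> \<circ> t) = (\<lambda>\<pi>. \<sigma> \<circ> \<pi> \<circ> inv \<sigma>) ` column_stabilizer \<mu> t"
proof -
  have 1: "\<sigma> \<circ> \<pi> \<circ> inv \<sigma> \<in> column_stabilizer \<mu> (\<sigma> \<circ> t)"
    if "\<pi> \<in> column_stabilizer \<mu> t" "tableau \<mu> t" "\<sigma> permutes {1..sum_list \<mu>}" for \<pi> \<sigma> t
    using that permutes_inverses(2)[OF that(3)]
    unfolding column_stabilizer_iff[OF that(2)] column_stabilizer_iff[OF tableau_comp[OF that(2,3)]]
    by (fastforce intro: permutes_compose permutes_inv)
  have inv: "inv \<sigma> permutes {1..sum_list \<mu>}" "inv (inv \<sigma>) = \<sigma>" "inv \<sigma> \<circ> \<sigma> = id" "\<sigma> \<circ> inv \<sigma> = id"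
    using permutes_inv[OF \<sigma>] permutes_inv_inv[OF \<sigma>] permutes_inv_o[OF \<sigma>] by auto
  have "\<pi> \<in> (\<lambda>\<pi>. \<sigma> \<circ> \<pi> \<circ> inv \<sigma>) ` column_stabilizer \<mu> t" if "\<pi> \<in> column_stabilizer \<mu> (\<sigma> \<circ> t)" for \<pi>
  proof (rule image_eqI)
    have "inv \<sigma> \<circ> (\<sigma> \<circ> t) = t"
      by (simp add: o_assoc inv(3))
    then show "inv \<sigma> \<circ> \<pi> \<circ> \<sigma> \<in> column_stabilizer \<mu> t"
      using 1[OF that tableau_comp[OF t \<sigma>] inv(1)] inv(2) by simp
    have "\<sigma> \<circ> (inv \<sigma> \<circ> \<pi> \<circ> \<sigma>) \<circ> inv \<sigma> = (\<sigma> \<circ> inv \<sigma>) \<circ> \<pi> \<circ> (\<sigma> \<circ> inv \<sigma>)"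
      by (simp only: o_assoc)
    then show "\<pi> = \<sigma> \<circ> (inv \<sigma> \<circ> \<pi> \<circ> \<sigma>) \<circ> inv \<sigma>"
      by (simp add: inv(4))
  qed
  then show ?thesis
    using 1[OF _ t \<sigma>] by blast
qed

lemma column_stabilizer_cong:
  assumes "\<And>c. c \<in> young_diagram \<mu> \<Longrightarrow> t c = t' c"
  shows "column_stabilizer \<mu> t = column_stabilizer \<mu> t'"
proof -
  have "t ` {c \<in> young_diagram \<mu>. snd c = j} = t' ` {c \<in> young_diagram \<mu>. snd c = j}" for j
    using assms by (intro image_cong) auto
  then show ?thesis
    by (simp add: column_stabilizer_def)
qed

lemma polytabloid_cong:
  assumes "\<And>c. c \<in> young_diagram \<mu> \<Longrightarrow> t c = t' c"
  shows "polytabloid \<mu> t = polytabloid \<mu> t'"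
proof -
  have "tabloid \<mu> (\<pi> \<circ> t) = tabloid \<mu> (\<pi> \<circ> t')" for \<pi>
    using assms by (intro tabloid_cong) simp
  then show ?thesis
    using column_stabilizer_cong[OF assms] by (simp add: polytabloid_def fun_eq_iff)
qed

text \<open>
  If no two entries of one column of \<open>t\<close> lie in one row of \<open>s\<close>, then \<open>t\<close> can be rearranged within
  its columns to have the rows of \<open>s\<close>: the positions (row in \<open>s\<close>, column in \<open>t\<close>) of the entries
  have the row and column sums of the diagram, and the diagram is determined by these.
\<close>

lemma tableau_rearrange:
  assumes \<mu>: "sorted_wrt (\<ge>) \<mu>" and t: "tableau \<mu> t" and s: "tableau \<mu> s"
    and sep: "\<And>a b c e. \<lbrakk>a \<in> young_diagram \<mu>; b \<in> young_diagram \<mu>; c \<in> young_diagram \<mu>;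
      e \<in> young_diagram \<mu>; snd a = snd b; fst c = fst e; t a = s c; t b = s e\<rbrakk> \<Longrightarrow> a = b"
  shows "\<exists>\<pi>\<in>column_stabilizer \<mu> t. tabloid \<mu> (\<pi> \<circ> t) = tabloid \<mu> s"
proof -
  let ?D = "young_diagram \<mu>"
  \<comment> \<open>\<open>b c\<close> is the cell at which \<open>t\<close> has the entry that
    \<open>s\<close> has at \<open>c\<close>.\<close>
  define b where "b c = inv_into ?D t (s c)" for c
  have b: "b c \<in> ?D" "t (b c) = s c" if "c \<in> ?D" for c
    using tableau_surj[OF t tableau_in[OF s that]] by (auto simp: b_def inv_into_into f_inv_into_f)
  have b_inj: "c = e" if "c \<in> ?D" "e \<in> ?D" "b c = b e" for c e
    using b[OF that(1)] b[OF that(2)] that tableau_eq_iff[OF s that(1,2)] by simp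
  have b_bij: "bij_betw b ?D ?D"
    using b(1) b_inj finite_young_diagram[of \<mu>]
    by (metis bij_betw_def endo_inj_surj image_subsetI inj_onI)
  define F where "F c = (fst c, snd (b c))" for c
  have F_inj: "inj_on F ?D"
  proof (rule inj_onI)
    fix c e assume ce: "c \<in> ?D" "e \<in> ?D" "F c = F e"
    then have "b c = b e"
      using b by (intro sep[of "b c" "b e" c e]) (auto simp: F_def)
    then show "c = e"
      using b_inj ce by blast
  qed
  have "F ` ?D = ?D"
  proof (rule same_margins_eq)
    fix i
    have "{p \<in> F ` ?D. fst p = i} = F ` {c \<in> ?D. fst c = i}"
      by (auto simp: F_def)
    then show "card {p \<in> F ` ?D. fst p = i} = card {p \<in> ?D. fst p = i}"
      using inj_on_subset[OF F_inj, of "{c \<in> ?D. fst c = i}"] by (simp add: card_image)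
  next
    fix j
    have "{p \<in> F ` ?D. snd p = j} = F ` {c \<in> ?D. snd (b c) = j}"
      by (auto simp: F_def)
    then have "card {p \<in> F ` ?D. snd p = j} = card {c \<in> ?D. snd (b c) = j}"
      using inj_on_subset[OF F_inj, of "{c \<in> ?D. snd (b c) = j}"] by (simp add: card_image)
    also have "\<dots> = card (b ` {c \<in> ?D. snd (b c) = j})"
      using bij_betw_imp_inj_on[OF b_bij] by (intro card_image[symmetric]) (auto intro: inj_on_subset)
    also have "b ` {c \<in> ?D. snd (b c) = j} = {p \<in> ?D. snd p = j}"
    proof -
      have "b ` {c \<in> ?D. snd (b c) = j} = {p \<in> b ` ?D. snd p = j}"
        by blast
      then show ?thesis
        by (simp add: bij_betw_imp_surj_on[OF b_bij])
    qed
    finally show "card {p \<in> F ` ?D. snd p = j} = card {p \<in> ?D. snd p = j}" .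
  qed (use finite_young_diagram young_diagram_down[OF \<mu>] in auto)
  then have F_bij: "bij_betw F ?D ?D"
    using F_inj by (simp add: bij_betw_def)
  \<comment> \<open>The entry of \<open>s\<close> at \<open>G c\<close> lies in row
    \<open>fst c\<close> of \<open>s\<close> and in column \<open>snd c\<close> of \<open>t\<close>.
    Putting it at \<open>c\<close> keeps the columns of \<open>t\<close> and produces the rows of
    \<open>s\<close>.\<close>
  define G where "G = inv_into ?D F"
  have G: "G c \<in> ?D" "fst (G c) = fst c" "snd (b (G c)) = snd c" if "c \<in> ?D" for c
  proof -
    show "G c \<in> ?D"
      using bij_betw_apply[OF bij_betw_inv_into[OF F_bij] that] by (simp add: G_def)
    have "F (G c) = c"
      using bij_betw_inv_into_right[OF F_bij that] by (simp add: G_def)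
    then show "fst (G c) = fst c" "snd (b (G c)) = snd c"
      unfolding F_def by (metis fst_conv snd_conv)+
  qed
  have G_bij: "bij_betw G ?D ?D"
    using bij_betw_inv_into[OF F_bij] by (simp add: G_def)
  obtain \<pi> where \<pi>: "\<pi> permutes {1..sum_list \<mu>}" and \<pi>t: "\<And>c. c \<in> ?D \<Longrightarrow> \<pi> (t c) = s (G c)"
    using tableau_permutation[OF t tableau_cells[OF s G_bij]] by auto
  have "\<exists>c'\<in>?D. \<pi> (t c) = t c' \<and> snd c' = snd c" if "c \<in> ?D" for c
    using b[OF G(1)[OF that]] G(3)[OF that] \<pi>t[OF that] by (intro bexI[of _ "b (G c)"]) auto
  then have "\<pi> \<in> column_stabilizer \<mu> t"
    using \<pi> by (simp add: column_stabilizer_iff[OF t])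
  moreover have "tabloid \<mu> (\<pi> \<circ> t) i = tabloid \<mu> s i" for i
  proof -
    have "G ` {c \<in> ?D. fst c = i} = {c \<in> ?D. fst c = i}"
      using G(1,2) bij_betw_imp_inj_on[OF G_bij] finite_young_diagram[of \<mu>]
      by (intro endo_inj_surj) (auto intro: inj_on_subset)
    moreover have "tabloid \<mu> (\<pi> \<circ> t) i = s ` G ` {c \<in> ?D. fst c = i}"
      unfolding tabloid_def image_image using \<pi>t by (intro image_cong) auto
    ultimately show ?thesis
      by (simp add: tabloid_def)
  qed
  ultimately show ?thesis
    by blast
qed

section \<open>Polytabloids and the irreducibility of Specht modules\<close>

definition delta :: "(nat \<Rightarrow> nat set) \<Rightarrow> (nat \<Rightarrow> nat set) \<Rightarrow> 'k::field" where
  "delta T = (\<lambda>T'. if T = T' then 1 else 0)"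

lemma vector_space_fun_scale: "vector_space fun_scale"
  by unfold_locales (auto simp: fun_scale_def fun_eq_iff algebra_simps)

lemma sym_rep_tabloid_act:
  "sym_rep (fun_scale :: 'k::field_char_0 \<Rightarrow> _) n tabloid_act UNIV"
proof -
  interpret vector_space "fun_scale :: 'k \<Rightarrow> ((nat \<Rightarrow> nat set) \<Rightarrow> 'k) \<Rightarrow> _"
    by (rule vector_space_fun_scale)
  show ?thesis
  proof
    show "linear_on fun_scale fun_scale UNIV (tabloid_act \<sigma> :: ((nat \<Rightarrow> nat set) \<Rightarrow> 'k) \<Rightarrow> _)" for \<sigma>
      by (simp add: linear_on_def tabloid_act_def fun_scale_def fun_eq_iff)
    show "tabloid_act id x = x" for x :: "(nat \<Rightarrow> nat set) \<Rightarrow> 'k"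
      by (simp add: tabloid_act_def)
    show "tabloid_act (\<sigma> \<circ> \<tau>) x = tabloid_act \<sigma> (tabloid_act \<tau> x)"
      if "\<sigma> permutes {1..n}" "\<tau> permutes {1..n}" for \<sigma> \<tau> and x :: "(nat \<Rightarrow> nat set) \<Rightarrow> 'k"
      using that by (simp add: tabloid_act_def o_inv_distrib permutes_bij image_comp)
  qed auto
qed

lemma tabloid_act_delta:
  assumes "bij \<sigma>"
  shows "tabloid_act \<sigma> (delta T :: _ \<Rightarrow> 'k::field) = delta (\<lambda>i. \<sigma> ` T i)"
proof -
  have "T = (\<lambda>i. inv \<sigma> ` T' i) \<longleftrightarrow> (\<lambda>i. \<sigma> ` T i) = T'" for T'
  proof -
    have "inv \<sigma> ` \<sigma> ` A = A" "\<sigma> ` inv \<sigma> ` A = A" for A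
      using assms by (simp_all add: bij_def image_inv_f_f image_f_inv_f)
    then show ?thesis
      unfolding fun_eq_iff by metis
  qed
  then show ?thesis
    by (simp add: tabloid_act_def delta_def)
qed

text \<open>Replaces the formula for coefficients by an element of the group algebra applied to one
  tabloid, so that the rules for alternators apply to polytabloids.\<close>

lemma polytabloid_eq_alternator:
  "(polytabloid \<mu> t :: _ \<Rightarrow> 'b::field) = alternator fun_scale tabloid_act (column_stabilizer \<mu> t) (delta (tabloid \<mu> t))"
proof
  fix T
  have act: "tabloid_act \<pi> (delta (tabloid \<mu> t) :: _ \<Rightarrow> 'b) = delta (tabloid \<mu> (\<pi> \<circ> t))"
    if "\<pi> \<in> column_stabilizer \<mu> t" for \<pi>
    using tabloid_act_delta[where 'k='b, OF permutes_bij[OF perm_subgroupD(1)[OF perm_subgroup_column_stabilizer that]]]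
    by (simp add: tabloid_comp)
  show "(polytabloid \<mu> t T :: 'b) =
      alternator fun_scale tabloid_act (column_stabilizer \<mu> t) (delta (tabloid \<mu> t)) T"
    unfolding polytabloid_def alternator_def sum_apply
    by (intro sum.cong refl) (simp add: act, auto simp: fun_scale_def delta_def)
qed

lemma column_stabilizer_row:
  assumes t: "tableau \<mu> t" and \<pi>: "\<pi> \<in> column_stabilizer \<mu> t" and c: "c \<in> young_diagram \<mu>"
    and row: "\<pi> (t c) \<in> tabloid \<mu> t (fst c)"
  shows "\<pi> (t c) = t c"
proof -
  obtain c' where "c' \<in> young_diagram \<mu>" "\<pi> (t c) = t c'" "snd c' = snd c"
    using \<pi> c unfolding column_stabilizer_iff[OF t] by blast
  moreover obtain c'' where "c'' \<in> young_diagram \<mu>" "\<pi> (t c) = t c''" "fst c'' = fst c"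
    using row by (auto simp: tabloid_def)
  ultimately show ?thesis
    using tableau_eq_iff[OF t] by (metis prod.expand)
qed

text \<open>A column permutation that also keeps the rows of \<open>t\<close> fixes every entry,
  because a cell is determined by its row and column. So only the identity contributes to this
  coefficient.\<close>

lemma polytabloid_tabloid:
  assumes t: "tableau \<mu> t"
  shows "polytabloid \<mu> t (tabloid \<mu> t) = 1"
proof -
  have id: "id \<in> column_stabilizer \<mu> t" and fin: "finite (column_stabilizer \<mu> t)"
    using perm_subgroupD[OF perm_subgroup_column_stabilizer] by blast+
  have eq_id: "\<pi> = id" if \<pi>: "\<pi> \<in> column_stabilizer \<mu> t" and eq: "tabloid \<mu> (\<pi> \<circ> t) = tabloid \<mu> t" for \<pi>
  proof
    fix x
    show "\<pi> x = id x"
    proof (cases "x \<in> {1..sum_list \<mu>}")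
      case True
      then obtain c where c: "c \<in> young_diagram \<mu>" "x = t c"
        using tableau_surj[OF t] by blast
      have "\<pi> (t c) \<in> tabloid \<mu> (\<pi> \<circ> t) (fst c)"
        using c(1) by (auto simp: tabloid_def)
      then show ?thesis
        using column_stabilizer_row[OF t \<pi> c(1)] eq c(2) by simp
    next
      case False
      then show ?thesis
        using permutes_not_in[OF perm_subgroupD(1)[OF perm_subgroup_column_stabilizer \<pi>]] by simp
    qed
  qed
  have "(if tabloid \<mu> (\<pi> \<circ> t) = tabloid \<mu> t then of_int (sign \<pi>) else 0) = (if \<pi> = id then 1 else 0)"
    if "\<pi> \<in> column_stabilizer \<mu> t" for \<pi>
    using eq_id[OF that] by auto
  then have "polytabloid \<mu> t (tabloid \<mu> t) = (\<Sum>\<pi>\<in>column_stabilizer \<mu> t. if \<pi> = id then 1 else 0)"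
    unfolding polytabloid_def by (rule sum.cong[OF refl])
  then show ?thesis
    using id fin by simp
qed

lemma polytabloid_nonzero: "tableau \<mu> t \<Longrightarrow> polytabloid \<mu> t \<noteq> 0"
  using polytabloid_tabloid by (metis zero_fun_apply zero_neq_one)

lemma tabloid_act_polytabloid:
  fixes \<mu> :: "nat list"
  assumes t: "tableau \<mu> t" and \<sigma>: "\<sigma> permutes {1..sum_list \<mu>}"
  shows "tabloid_act \<sigma> (polytabloid \<mu> t :: _ \<Rightarrow> 'k::field_char_0) = polytabloid \<mu> (\<sigma> \<circ> t)"
proof -
  interpret sym_rep "fun_scale :: 'k \<Rightarrow> _" "sum_list \<mu>" tabloid_act UNIV
    by (rule sym_rep_tabloid_act)
  have C: "column_stabilizer \<mu> t \<subseteq> {\<pi>. \<pi> permutes {1..sum_list \<mu>}}"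
    by (auto simp: column_stabilizer_def)
  show ?thesis
    unfolding polytabloid_eq_alternator rho_alternator[OF \<sigma> C UNIV_I] column_stabilizer_comp[OF t \<sigma>]
    by (simp add: tabloid_act_delta permutes_bij[OF \<sigma>] tabloid_comp)
qed

text \<open>The dichotomy of \<open>tableau_rearrange\<close>: either a column permutation of
  \<open>t\<close> yields the rows of \<open>s\<close>, and the result is the polytabloid of
  \<open>t\<close> up to sign; or two entries share a column of \<open>t\<close> and a row of
  \<open>s\<close>, and their transposition makes the alternator vanish.\<close>

lemma alternator_delta:
  fixes \<mu> :: "nat list"
  assumes \<mu>: "sorted_wrt (\<ge>) \<mu>" and t: "tableau \<mu> t" and s: "tableau \<mu> s"
  shows "\<exists>c. alternator fun_scale tabloid_act (column_stabilizer \<mu> t)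
    (delta (tabloid \<mu> s) :: _ \<Rightarrow> 'k::field_char_0) = fun_scale c (polytabloid \<mu> t)"
proof -
  interpret sym_rep "fun_scale :: 'k \<Rightarrow> _" "sum_list \<mu>" tabloid_act UNIV
    by (rule sym_rep_tabloid_act)
  note G = perm_subgroup_column_stabilizer[of \<mu> t]
  show ?thesis
  proof (cases "\<exists>\<pi>\<in>column_stabilizer \<mu> t. tabloid \<mu> (\<pi> \<circ> t) = tabloid \<mu> s")
    case True
    then obtain \<pi> where \<pi>: "\<pi> \<in> column_stabilizer \<mu> t" "tabloid \<mu> (\<pi> \<circ> t) = tabloid \<mu> s"
      by blast
    have "tabloid_act \<pi> (delta (tabloid \<mu> t)) = (delta (tabloid \<mu> s) :: _ \<Rightarrow> 'k)"
      using tabloid_act_delta[where 'k='k, OF permutes_bij[OF perm_subgroupD(1)[OF G \<pi>(1)]]] \<pi>(2)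
      by (simp add: tabloid_comp)
    then show ?thesis
      using alternator_rho[OF G \<pi>(1) UNIV_I, of "delta (tabloid \<mu> t)"]
      unfolding polytabloid_eq_alternator by metis
  next
    case False
    then obtain a b c e where cells: "a \<in> young_diagram \<mu>" "b \<in> young_diagram \<mu>"
      "c \<in> young_diagram \<mu>" "e \<in> young_diagram \<mu>" "snd a = snd b" "fst c = fst e" "t a = s c" "t b = s e"
      and ne: "a \<noteq> b"
      using tableau_rearrange[OF \<mu> t s] by blast
    define \<tau> where "\<tau> = transpose (t a) (t b)"
    have tne: "t a \<noteq> t b"
      using tableau_eq_iff[OF t cells(1,2)] ne by simp
    have \<tau>p: "\<tau> permutes {1..sum_list \<mu>}"
      unfolding \<tau>_def using tableau_in[OF t cells(1)] tableau_in[OF t cells(2)] by (rule permutes_swap_id)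
    have \<tau>: "\<tau> \<in> column_stabilizer \<mu> t"
      unfolding column_stabilizer_iff[OF t]
    proof (intro conjI ballI \<tau>p)
      fix x assume x: "x \<in> young_diagram \<mu>"
      show "\<exists>c'\<in>young_diagram \<mu>. \<tau> (t x) = t c' \<and> snd c' = snd x"
        using x cells(1,2,5) tableau_eq_iff[OF t x cells(1)] tableau_eq_iff[OF t x cells(2)]
        unfolding \<tau>_def transpose_def by (cases "x = a"; cases "x = b") auto
    qed
    have "\<tau> ` tabloid \<mu> s i = tabloid \<mu> s i" for i
      unfolding \<tau>_def
    proof (rule transpose_image_eq)
      have "t a \<in> tabloid \<mu> s i \<longleftrightarrow> fst c = i" "t b \<in> tabloid \<mu> s i \<longleftrightarrow> fst e = i"
        using tableau_in_tabloid_iff[OF s] cells by metis+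
      then show "t a \<in> tabloid \<mu> s i \<longleftrightarrow> t b \<in> tabloid \<mu> s i"
        using cells(6) by simp
    qed
    then have "tabloid_act \<tau> (delta (tabloid \<mu> s)) = (delta (tabloid \<mu> s) :: _ \<Rightarrow> 'k)"
      using tabloid_act_delta[where 'k='k, OF permutes_bij[OF \<tau>p]] by simp
    then have "alternator fun_scale tabloid_act (column_stabilizer \<mu> t) (delta (tabloid \<mu> s) :: _ \<Rightarrow> 'k) = 0"
      using tne by (intro alternator_eq_0[OF G \<tau>]) (auto simp: \<tau>_def sign_swap_id)
    then show ?thesis
      by (metis scale_zero_left)
  qed
qed

lemma subrep_specht:
  "subrep (fun_scale :: 'k::field_char_0 \<Rightarrow> _) (sum_list \<mu>) tabloid_act UNIV (specht \<mu>)"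
proof -
  interpret sym_rep "fun_scale :: 'k \<Rightarrow> _" "sum_list \<mu>" tabloid_act UNIV
    by (rule sym_rep_tabloid_act)
  have "tabloid_act \<sigma> x \<in> specht \<mu>" if \<sigma>: "\<sigma> permutes {1..sum_list \<mu>}" and "x \<in> specht \<mu>"
    for \<sigma> and x :: "_ \<Rightarrow> 'k"
    using that(2) unfolding specht_def
  proof (induction rule: span_induct_alt)
    case base
    have "tabloid_act \<sigma> (0 :: _ \<Rightarrow> 'k) = 0"
      by (simp add: tabloid_act_def fun_eq_iff)
    then show ?case
      by (metis span_zero)
  next
    case (step c x y)
    then obtain t where t: "tableau \<mu> t" "x = polytabloid \<mu> t"
      by blast
    have "polytabloid \<mu> (\<sigma> \<circ> t) \<in> span {polytabloid \<mu> t |t. tableau \<mu> t}"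
      using tableau_comp[OF t(1) \<sigma>] by (intro span_base) blast
    moreover have "tabloid_act \<sigma> (fun_scale c x + y) =
        fun_scale c (polytabloid \<mu> (\<sigma> \<circ> t)) + tabloid_act \<sigma> y"
      unfolding rho_add[OF \<sigma> UNIV_I UNIV_I] rho_scale[OF \<sigma> UNIV_I] t(2)
        tabloid_act_polytabloid[OF t(1) \<sigma>] ..
    ultimately show ?case
      using step(2) by (metis (no_types, lifting) span_add span_scale)
  qed
  then show ?thesis
    unfolding subrep_def specht_def by auto
qed

lemma sym_rep_specht:
  "sym_rep (fun_scale :: 'k::field_char_0 \<Rightarrow> _) (sum_list \<mu>) tabloid_act (specht \<mu>)"
  by (rule sym_rep.sym_rep_subrep[OF sym_rep_tabloid_act subrep_specht])

lemma polytabloid_in_specht: "tableau \<mu> t \<Longrightarrow> polytabloid \<mu> t \<in> specht \<mu>"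
  unfolding specht_def
  by (rule module.span_base) (use vector_space_fun_scale module_iff_vector_space in blast)+

text \<open>Polytabloids are combinations of tabloids of shape \<mu>, and
  \<open>alternator_delta\<close> sends each of these into the line of the polytabloid of
  \<open>t\<close>. Both parts of Schur's lemma for Specht modules, and the evaluation of
  equivariant maps in the comparison of multiplicities, rest on this.\<close>

lemma alternator_specht:
  fixes x :: "(nat \<Rightarrow> nat set) \<Rightarrow> 'k::field_char_0"
  assumes \<mu>: "sorted_wrt (\<ge>) \<mu>" and t: "tableau \<mu> t" and "x \<in> specht \<mu>"
  shows "\<exists>c. alternator fun_scale tabloid_act (column_stabilizer \<mu> t) x = fun_scale c (polytabloid \<mu> t)"
proof -
  interpret sym_rep "fun_scale :: 'k \<Rightarrow> _" "sum_list \<mu>" tabloid_act UNIV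
    by (rule sym_rep_tabloid_act)
  let ?\<kappa> = "alternator fun_scale tabloid_act (column_stabilizer \<mu> t) :: (_ \<Rightarrow> 'k) \<Rightarrow> _"
  have "column_stabilizer \<mu> t \<subseteq> {\<pi>. \<pi> permutes {1..sum_list \<mu>}}"
    by (auto simp: column_stabilizer_def)
  note L = alternator_linear[OF this]
  have add: "?\<kappa> (x + y) = ?\<kappa> x + ?\<kappa> y" and scale: "?\<kappa> (fun_scale c x) = fun_scale c (?\<kappa> x)" for x y c
    using L by (auto simp: linear_on_def)
  let ?N = "{x. \<exists>c. ?\<kappa> x = fun_scale c (polytabloid \<mu> t)}"
  have N: "subspace ?N"
    unfolding subspace_def
  proof (intro conjI ballI allI)
    show "0 \<in> ?N"
      using scale[of 0 0] by (auto intro!: exI[of _ 0])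
    show "x + y \<in> ?N" if xy: "x \<in> ?N" "y \<in> ?N" for x y
    proof -
      obtain a b where "?\<kappa> x = fun_scale a (polytabloid \<mu> t)" "?\<kappa> y = fun_scale b (polytabloid \<mu> t)"
        using xy by blast
      then show ?thesis
        using add[of x y] by (auto simp: scale_left_distrib intro!: exI[of _ "a + b"])
    qed
    show "fun_scale c x \<in> ?N" if x: "x \<in> ?N" for c x
      using x scale[of c x] by auto
  qed
  have delta_N: "delta (tabloid \<mu> s) \<in> ?N" if "tableau \<mu> s" for s
    using alternator_delta[OF \<mu> t that] by blast
  have "polytabloid \<mu> s \<in> ?N" if s: "tableau \<mu> s" for s
  proof (subst polytabloid_eq_alternator[of \<mu> s], subst alternator_def[of _ _ "column_stabilizer \<mu> s"], intro subspace_sum[OF N] subspace_scale[OF N])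
    fix \<pi> assume "\<pi> \<in> column_stabilizer \<mu> s"
    then have \<pi>: "\<pi> permutes {1..sum_list \<mu>}"
      by (simp add: column_stabilizer_def)
    show "tabloid_act \<pi> (delta (tabloid \<mu> s)) \<in> ?N"
      using delta_N[OF tableau_comp[OF s \<pi>]] by (simp add: tabloid_act_delta permutes_bij[OF \<pi>] tabloid_comp)
  qed
  then have "specht \<mu> \<subseteq> ?N"
    unfolding specht_def by (intro span_minimal N) blast
  then show ?thesis
    using assms(3) by blast
qed

lemma alternator_polytabloid:
  assumes "tableau \<mu> t"
  shows "alternator fun_scale tabloid_act (column_stabilizer \<mu> t) (polytabloid \<mu> t :: _ \<Rightarrow> 'k::field_char_0) =
    fun_scale (of_nat (card (column_stabilizer \<mu> t))) (polytabloid \<mu> t)"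
proof -
  interpret sym_rep "fun_scale :: 'k \<Rightarrow> _" "sum_list \<mu>" tabloid_act UNIV
    by (rule sym_rep_tabloid_act)
  show ?thesis
    unfolding polytabloid_eq_alternator
    by (rule alternator_absorb[OF perm_subgroup_column_stabilizer order_refl UNIV_I])
qed

lemma card_column_stabilizer: "of_nat (card (column_stabilizer \<mu> t)) \<noteq> (0 :: 'k::field_char_0)"
  using perm_subgroupD(2,5)[OF perm_subgroup_column_stabilizer[of \<mu> t]] by auto

text \<open>Any two tableaux of the same shape differ by a permutation of the entries, so the
  symmetric group moves any polytabloid to any other.\<close>

lemma specht_generated:
  fixes W :: "((nat \<Rightarrow> nat set) \<Rightarrow> 'k::field_char_0) set"
  assumes t: "tableau \<mu> t" and W: "subrep fun_scale (sum_list \<mu>) tabloid_act (specht \<mu>) W"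
    and e: "polytabloid \<mu> t \<in> W"
  shows "W = specht \<mu>"
proof -
  interpret vector_space "fun_scale :: 'k \<Rightarrow> ((nat \<Rightarrow> nat set) \<Rightarrow> 'k) \<Rightarrow> _"
    by (rule vector_space_fun_scale)
  have "polytabloid \<mu> s \<in> W" if s: "tableau \<mu> s" for s
  proof -
    obtain \<sigma> where \<sigma>: "\<sigma> permutes {1..sum_list \<mu>}" "\<And>c. c \<in> young_diagram \<mu> \<Longrightarrow> \<sigma> (t c) = s c"
      using tableau_permutation[OF t s] by blast
    have "polytabloid \<mu> s = (polytabloid \<mu> (\<sigma> \<circ> t) :: _ \<Rightarrow> 'k)"
      using \<sigma>(2) by (intro polytabloid_cong) simp
    also have "\<dots> = tabloid_act \<sigma> (polytabloid \<mu> t)"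
      by (rule tabloid_act_polytabloid[OF t \<sigma>(1), symmetric])
    also have "\<dots> \<in> W"
      using W e \<sigma>(1) unfolding subrep_def by blast
    finally show ?thesis .
  qed
  moreover have "subspace W"
    using W by (simp add: subrep_def)
  ultimately have "specht \<mu> \<subseteq> W"
    unfolding specht_def by (intro span_minimal) blast
  then show ?thesis
    using W by (auto simp: subrep_def)
qed

text \<open>An equivariant projection takes the place of the usual invariant form. If the
  antisymmetrizer \<kappa> of \<open>t\<close> is nonzero somewhere on a subrepresentation, then the
  polytabloid of \<open>t\<close> lies in it, and it is everything. So \<kappa> vanishes on a proper
  subrepresentation \<open>W\<close>. Applying a projection \<open>P\<close> onto \<open>W\<close>
  to \<kappa> of the polytabloid, a nonzero multiple of it, shows that \<open>P\<close> kills this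
  generator; hence P = 0 and \<open>W\<close> is zero.\<close>

lemma irreducible_specht:
  assumes \<mu>: "sorted_wrt (\<ge>) \<mu>"
  shows "irreducible_rep (fun_scale :: 'k::field_char_0 \<Rightarrow> _) (sum_list \<mu>) tabloid_act (specht \<mu>)"
  unfolding irreducible_rep_def
proof (intro conjI allI impI)
  obtain t where t: "tableau \<mu> t"
    using exists_tableau by blast
  interpret S: sym_rep "fun_scale :: 'k \<Rightarrow> _" "sum_list \<mu>" tabloid_act "specht \<mu>"
    by (rule sym_rep_specht)
  have e: "polytabloid \<mu> t \<in> specht \<mu>" "polytabloid \<mu> t \<noteq> (0 :: _ \<Rightarrow> 'k)"
    using polytabloid_in_specht polytabloid_nonzero t by blast+
  then show "specht \<mu> \<noteq> {0 :: _ \<Rightarrow> 'k}"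
    by blast
  let ?\<kappa> = "alternator fun_scale tabloid_act (column_stabilizer \<mu> t) :: (_ \<Rightarrow> 'k) \<Rightarrow> _"
  have C: "column_stabilizer \<mu> t \<subseteq> {\<pi>. \<pi> permutes {1..sum_list \<mu>}}"
    by (auto simp: column_stabilizer_def)
  have full: "X = specht \<mu>"
    if X: "subrep fun_scale (sum_list \<mu>) tabloid_act (specht \<mu>) X" and x: "x \<in> X" "?\<kappa> x \<noteq> 0"
    for X :: "(_ \<Rightarrow> 'k) set" and x
  proof -
    interpret X: sym_rep "fun_scale :: 'k \<Rightarrow> _" "sum_list \<mu>" tabloid_act X
      by (rule S.sym_rep_subrep[OF X])
    obtain c where c: "?\<kappa> x = fun_scale c (polytabloid \<mu> t)"
      using alternator_specht[OF \<mu> t, of x] X x(1) unfolding subrep_def by blast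
    then have "c \<noteq> 0"
      using x(2) by auto
    moreover have "fun_scale (1 / c) (?\<kappa> x) \<in> X"
      using X.alternator_in[OF C x(1)] by (rule S.subspace_scale[OF X.subspace_U])
    ultimately have "polytabloid \<mu> t \<in> X"
      using c by simp
    then show ?thesis
      by (rule specht_generated[OF t X])
  qed
  fix W :: "(_ \<Rightarrow> 'k) set"
  assume W: "subrep fun_scale (sum_list \<mu>) tabloid_act (specht \<mu>) W"
  interpret W: sym_rep "fun_scale :: 'k \<Rightarrow> _" "sum_list \<mu>" tabloid_act W
    by (rule S.sym_rep_subrep[OF W])
  show "W = {0} \<or> W = specht \<mu>"
  proof (rule disjCI)
    assume ne: "W \<noteq> specht \<mu>"
    obtain P where P: "P \<in> hom_space (sum_list \<mu>) fun_scale tabloid_act (specht \<mu>) fun_scale tabloid_act W"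
      "\<And>x. x \<in> W \<Longrightarrow> P x = x"
      using S.maschke[OF W] by blast
    have "P (?\<kappa> (polytabloid \<mu> t)) = ?\<kappa> (P (polytabloid \<mu> t))"
      by (rule alternator_hom[OF S.sym_rep_axioms W.sym_rep_axioms P(1) C e(1)])
    also have "\<dots> = 0"
      using full[OF W hom_spaceD(1)[OF P(1) e(1)]] ne by blast
    finally have "fun_scale (of_nat (card (column_stabilizer \<mu> t))) (P (polytabloid \<mu> t)) = 0"
      unfolding alternator_polytabloid[OF t] using hom_spaceD(3)[OF P(1)] e(1)
      unfolding linear_on_def by metis
    then have "P (polytabloid \<mu> t) = 0"
      using card_column_stabilizer[where 'k='k, of \<mu> t] by auto
    then have "{x \<in> specht \<mu>. P x = 0} = specht \<mu>"
      using e(1) by (intro specht_generated[OF t] S.subrep_kernel[OF W.sym_rep_axioms P(1)]) blast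
    then have "\<forall>x\<in>specht \<mu>. P x = 0"
      by blast
    then show "W = {0}"
      using P(2) W S.subspace_0[OF W.subspace_U] by (fastforce simp: subrep_def)
  qed
qed

text \<open>Being equivariant, \<open>f\<close> maps the polytabloid of \<open>t\<close> to a
  multiple of itself, since up to a nonzero factor the image is a value of the antisymmetrizer.
  Subtracting this multiple of the identity leaves an endomorphism \<open>g\<close> that kills a
  generator.\<close>

lemma specht_endomorphism:
  assumes \<mu>: "sorted_wrt (\<ge>) \<mu>"
    and f: "f \<in> hom_space (sum_list \<mu>) fun_scale tabloid_act (specht \<mu>) fun_scale tabloid_act
      (specht \<mu> :: ((nat \<Rightarrow> nat set) \<Rightarrow> 'k::field_char_0) set)"
  shows "\<exists>c. \<forall>x\<in>specht \<mu>. f x = fun_scale c x"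
proof -
  obtain t where t: "tableau \<mu> t"
    using exists_tableau by blast
  interpret S: sym_rep "fun_scale :: 'k \<Rightarrow> _" "sum_list \<mu>" tabloid_act "specht \<mu>"
    by (rule sym_rep_specht)
  have e: "polytabloid \<mu> t \<in> (specht \<mu> :: (_ \<Rightarrow> 'k) set)"
    using polytabloid_in_specht t by blast
  let ?\<kappa> = "alternator fun_scale tabloid_act (column_stabilizer \<mu> t) :: (_ \<Rightarrow> 'k) \<Rightarrow> _"
  let ?m = "of_nat (card (column_stabilizer \<mu> t)) :: 'k"
  have C: "column_stabilizer \<mu> t \<subseteq> {\<pi>. \<pi> permutes {1..sum_list \<mu>}}"
    by (auto simp: column_stabilizer_def)
  note F = hom_spaceD[OF f]
  obtain c where c: "?\<kappa> (f (polytabloid \<mu> t)) = fun_scale c (polytabloid \<mu> t)"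
    using alternator_specht[OF \<mu> t F(1)[OF e]] by blast
  have "fun_scale ?m (f (polytabloid \<mu> t)) = f (?\<kappa> (polytabloid \<mu> t))"
    unfolding alternator_polytabloid[OF t] using F(3) e by (simp add: linear_on_def)
  also have "\<dots> = fun_scale c (polytabloid \<mu> t)"
    using alternator_hom[OF S.sym_rep_axioms S.sym_rep_axioms f C e] c by simp
  finally have "fun_scale (1 / ?m) (fun_scale ?m (f (polytabloid \<mu> t))) = fun_scale (1 / ?m) (fun_scale c (polytabloid \<mu> t))"
    by simp
  then have fe: "f (polytabloid \<mu> t) = fun_scale (c / ?m) (polytabloid \<mu> t)"
    using card_column_stabilizer[where 'k='k, of \<mu> t] by simp
  define g where "g x = (if x \<in> specht \<mu> then f x - fun_scale (c / ?m) x else 0)" for x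
  have "g \<in> hom_space (sum_list \<mu>) fun_scale tabloid_act (specht \<mu>) fun_scale tabloid_act (specht \<mu>)"
    unfolding g_def
  proof (rule S.restrict_in_hom_space)
    show "f x - fun_scale (c / ?m) x \<in> specht \<mu>" if "x \<in> specht \<mu>" for x
      using F(1)[OF that] that S.subspace_diff[OF S.subspace_U] S.subspace_scale[OF S.subspace_U] by blast
    show "linear_on fun_scale fun_scale (specht \<mu>) (\<lambda>x. f x - fun_scale (c / ?m) x)"
      using F(3) by (auto simp: linear_on_def algebra_simps)
    show "f (tabloid_act \<sigma> x) - fun_scale (c / ?m) (tabloid_act \<sigma> x) = tabloid_act \<sigma> (f x - fun_scale (c / ?m) x)"
      if "\<sigma> permutes {1..sum_list \<mu>}" "x \<in> specht \<mu>" for \<sigma> x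
      using F(4)[OF that] by (simp add: tabloid_act_def fun_scale_def fun_eq_iff)
  qed
  note ker = S.subrep_kernel[OF S.sym_rep_axioms this]
  have "{x \<in> specht \<mu>. g x = 0} = specht \<mu>"
    by (rule specht_generated[OF t ker]) (use e fe in \<open>simp add: g_def\<close>)
  then have "g x = 0" if "x \<in> specht \<mu>" for x
    using that by blast
  then have "\<forall>x\<in>specht \<mu>. f x = fun_scale (c / ?m) x"
    unfolding g_def by (metis eq_iff_diff_eq_0)
  then show ?thesis
    by blast
qed

section \<open>Finitely generated \<open>FI_d\<close>-modules\<close>

context FI_module
begin

lemma act_add: "\<alpha> \<in> FI_hom d m n \<Longrightarrow> x \<in> V m \<Longrightarrow> y \<in> V m \<Longrightarrow>
    act m n \<alpha> (x + y) = act m n \<alpha> x + act m n \<alpha> y"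
  and act_scale: "\<alpha> \<in> FI_hom d m n \<Longrightarrow> x \<in> V m \<Longrightarrow> act m n \<alpha> (scale c x) = scale c (act m n \<alpha> x)"
  using act_linear unfolding linear_on_def by blast+

lemma act_zero: "\<alpha> \<in> FI_hom d m n \<Longrightarrow> act m n \<alpha> 0 = 0"
  by (rule linear_on_zero[OF act_linear subspace_V vector_space_axioms vector_space_axioms])

lemma perm_act_act:
  assumes "\<sigma> permutes {1..n}" "\<alpha> \<in> FI_hom d m n" "x \<in> V m"
  shows "perm_act act n \<sigma> (act m n \<alpha> x) = act m n (FI_comp m n n (FI_perm n \<sigma>) \<alpha>) x"
  unfolding perm_act_def using act_comp[OF FI_perm_in_hom[OF assms(1)] assms(2,3)] by simp

lemma act_preimage_subspace:
  assumes \<alpha>: "\<alpha> \<in> FI_hom d m n" and W: "subspace W"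
  shows "subspace {x \<in> V m. act m n \<alpha> x \<in> W}"
  unfolding subspace_def
proof (intro conjI ballI allI)
  show "0 \<in> {x \<in> V m. act m n \<alpha> x \<in> W}"
    using act_zero[OF \<alpha>] subspace_0[OF W] subspace_0[OF subspace_V] by simp
  show "x + y \<in> {x \<in> V m. act m n \<alpha> x \<in> W}"
    if "x \<in> {x \<in> V m. act m n \<alpha> x \<in> W}" "y \<in> {x \<in> V m. act m n \<alpha> x \<in> W}" for x y
    using that act_add[OF \<alpha>] subspace_add[OF W] subspace_add[OF subspace_V] by simp
  show "scale c x \<in> {x \<in> V m. act m n \<alpha> x \<in> W}" if "x \<in> {x \<in> V m. act m n \<alpha> x \<in> W}" for c x
    using that act_scale[OF \<alpha>] subspace_scale[OF W] subspace_scale[OF subspace_V] by simp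
qed

text \<open>The spans of the images of the generators form a submodule, and it contains the
  generators themselves because of the identity morphisms.\<close>

lemma finitely_generated_span:
  assumes finitely_generated
  shows "\<exists>S. finite S \<and> S \<subseteq> Sigma UNIV V \<and>
    (\<forall>n. V n = span {act m n \<alpha> x |m x \<alpha>. (m, x) \<in> S \<and> \<alpha> \<in> FI_hom d m n})"
proof -
  obtain S where S: "finite S" "S \<subseteq> Sigma UNIV V"
    and gen: "\<And>W. submodule W \<Longrightarrow> S \<subseteq> Sigma UNIV W \<Longrightarrow> W = V"
    using assms unfolding finitely_generated_def by blast
  define G where "G n = {act m n \<alpha> x |m x \<alpha>. (m, x) \<in> S \<and> \<alpha> \<in> FI_hom d m n}" for n
  have GV: "G n \<subseteq> V n" for n
    using S(2) act_in by (auto simp: G_def)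
  have sub: "act m n \<alpha> ` span (G m) \<subseteq> span (G n)" if \<alpha>: "\<alpha> \<in> FI_hom d m n" for m n \<alpha>
  proof -
    have "span (G m) \<subseteq> {x \<in> V m. act m n \<alpha> x \<in> span (G n)}"
    proof (rule span_minimal[OF _ act_preimage_subspace[OF \<alpha> subspace_span]])
      show "G m \<subseteq> {x \<in> V m. act m n \<alpha> x \<in> span (G n)}"
      proof
        fix y assume y: "y \<in> G m"
        then obtain l x \<beta> where lx: "(l, x) \<in> S" "\<beta> \<in> FI_hom d l m" "y = act l m \<beta> x"
          by (auto simp: G_def)
        have "act m n \<alpha> y = act l n (FI_comp l m n \<alpha> \<beta>) x"
          using lx S(2) by (simp add: act_comp[OF \<alpha> lx(2)] subset_iff)
        then have "act m n \<alpha> y \<in> G n"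
          using lx(1) FI_comp_in_hom[OF \<alpha> lx(2)] unfolding G_def by blast
        then show "y \<in> {x \<in> V m. act m n \<alpha> x \<in> span (G n)}"
          using y GV span_base by blast
      qed
    qed
    then show ?thesis
      by blast
  qed
  have "submodule (\<lambda>n. span (G n))"
    unfolding submodule_def using sub span_minimal[OF GV subspace_V] subspace_span by blast
  moreover have "S \<subseteq> Sigma UNIV (\<lambda>n. span (G n))"
  proof
    fix p assume p: "p \<in> S"
    obtain m x where mx: "p = (m, x)"
      by fastforce
    then have "x = act m m (FI_id m) x"
      using p S(2) act_id by (simp add: subset_iff)
    then have "x \<in> G m"
      using p mx FI_id_in_hom unfolding G_def by blast
    then show "p \<in> Sigma UNIV (\<lambda>n. span (G n))"
      using mx span_base by blast
  qed
  ultimately have "(\<lambda>n. span (G n)) = V"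
    by (rule gen)
  then have "V n = span (G n)" for n
    by (simp add: fun_eq_iff)
  then show ?thesis
    using S unfolding G_def by blast
qed

lemma finite_generators:
  assumes "finite S"
  shows "finite {act m n \<alpha> x |m x \<alpha>. (m, x) \<in> S \<and> \<alpha> \<in> FI_hom d m n}"
proof -
  have "{act m n \<alpha> x |m x \<alpha>. (m, x) \<in> S \<and> \<alpha> \<in> FI_hom d m n} =
      (\<Union>p\<in>S. (\<lambda>\<alpha>. act (fst p) n \<alpha> (snd p)) ` FI_hom d (fst p) n)"
    by force
  then show ?thesis
    using assms finite_FI_hom by simp
qed

lemma finitely_generated_finite_dimensional:
  assumes finitely_generated
  shows "finite_dimensional scale (V n)"
proof -
  obtain S where S: "finite S"
    "\<forall>n. V n = span {act m n \<alpha> x |m x \<alpha>. (m, x) \<in> S \<and> \<alpha> \<in> FI_hom d m n}"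
    using finitely_generated_span[OF assms] by blast
  let ?G = "{act m n \<alpha> x |m x \<alpha>. (m, x) \<in> S \<and> \<alpha> \<in> FI_hom d m n}"
  have V: "V n = span ?G"
    by (rule S(2)[rule_format])
  show ?thesis
    unfolding finite_dimensional_def V
    by (intro exI[of _ ?G] conjI finite_generators[OF S(1)] span_superset refl)
qed

text \<open>A morphism into a larger object factors through a standard inclusion with some colour
  \<open>i\<close>, so \<open>phi act i n\<close> is applied first.\<close>

lemma killed_by_longer:
  assumes v: "v \<in> V n" "\<And>i. i \<in> {1..d} \<Longrightarrow> phi act i n v = 0"
    and \<alpha>: "\<alpha> \<in> FI_hom d n n'" and "n < n'"
  shows "act n n' \<alpha> v = 0"
proof -
  obtain i \<beta> where i: "i \<in> {1..d}" and \<beta>: "\<beta> \<in> FI_hom d (n + 1) n'"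
    "\<alpha> = FI_comp n (n + 1) n' \<beta> (FI_incl i n)"
    using FI_factor_incl[OF \<alpha> assms(4)] by blast
  have "act n n' \<alpha> v = act (n + 1) n' \<beta> (phi act i n v)"
    unfolding \<beta>(2) phi_def by (rule act_comp[OF \<beta>(1) FI_incl_in_hom[OF i] v(1)])
  then show ?thesis
    using v(2)[OF i] act_zero[OF \<beta>(1)] by simp
qed

lemma subrep_V: "subrep scale n (perm_act act n) (V n) (V n)"
  using act_in[OF FI_perm_in_hom] subspace_V by (auto simp: subrep_def perm_act_def)

lemma phi_sum_single:
  assumes "i \<in> {1..d}" "x \<in> V n"
  shows "phi act i n x \<in> {\<Sum>i=1..d. phi act i n (y i) |y. \<forall>i\<in>{1..d}. y i \<in> V n}"
proof -
  have "(\<Sum>j=1..d. phi act j n (if j = i then x else 0)) = (\<Sum>j=1..d. if j = i then phi act i n x else 0)"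
    using act_zero[OF FI_incl_in_hom] by (intro sum.cong) (auto simp: phi_def)
  also have "\<dots> = phi act i n x"
    using assms(1) by simp
  finally show ?thesis
    using assms(2) subspace_0[OF subspace_V] by (intro CollectI exI[of _ "\<lambda>j. if j = i then x else 0"]) auto
qed

lemma phi_sum_in_V: "{\<Sum>i=1..d. phi act i n (x i) |x. \<forall>i\<in>{1..d}. x i \<in> V n} \<subseteq> V (n + 1)"
  using act_in[OF FI_incl_in_hom] by (auto simp: phi_def intro!: subspace_sum[OF subspace_V])

text \<open>A morphism from [m] with m \<le> n misses some point \<open>y\<close> of [n + 1]. The
  transposition of \<open>y\<close> and n + 1 turns it into a morphism that ends with a standard
  inclusion, coloured by the colour of \<open>y\<close>; so the image of a generator lies in the
  image of a \<open>phi\<close>, up to a permutation.\<close>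

lemma generated_in_degree_subrep:
  assumes gen: "V (n + 1) = span {act m (n + 1) \<alpha> x |m x \<alpha>. (m, x) \<in> S \<and> \<alpha> \<in> FI_hom d m (n + 1)}"
    and S: "S \<subseteq> Sigma UNIV V" and deg: "\<And>m x. (m, x) \<in> S \<Longrightarrow> m \<le> n"
  shows "subrep_generated scale (n + 1) (perm_act act (n + 1)) (V (n + 1))
    {\<Sum>i=1..d. phi act i n (x i) |x. \<forall>i\<in>{1..d}. x i \<in> V n} = V (n + 1)"
proof -
  let ?X = "{\<Sum>i=1..d. phi act i n (x i) |x. \<forall>i\<in>{1..d}. x i \<in> V n}"
  have "V (n + 1) \<subseteq> W" if W: "subrep scale (n + 1) (perm_act act (n + 1)) (V (n + 1)) W" "?X \<subseteq> W" for W
  proof -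
    have "act m (n + 1) \<alpha> x \<in> W" if mx: "(m, x) \<in> S" and \<alpha>: "\<alpha> \<in> FI_hom d m (n + 1)" for m x \<alpha>
    proof -
      have xV: "x \<in> V m"
        using mx S by auto
      have "card (fst \<alpha> ` {1..m}) < card {1..n + 1}"
        using inj_fst_FI_hom[OF \<alpha>] deg[OF mx] by (simp add: card_image)
      then obtain y where y: "y \<in> {1..n + 1}" "y \<notin> fst \<alpha> ` {1..m}"
        by (metis card_mono finite_atLeastAtMost finite_imageI not_less subsetI)
      define i where "i = snd \<alpha> y"
      have i: "i \<in> {1..d}"
        unfolding i_def by (rule snd_FI_hom[OF \<alpha> y])
      define \<sigma> where "\<sigma> = transpose y (n + 1)"
      have \<sigma>: "\<sigma> permutes {1..n + 1}"
        unfolding \<sigma>_def using y(1) by (intro permutes_swap_id) auto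
      have \<sigma>y: "\<sigma> y = n + 1"
        by (simp add: \<sigma>_def)
      define \<alpha>' where "\<alpha>' = FI_comp m (n + 1) (n + 1) (FI_perm (n + 1) \<sigma>) \<alpha>"
      have \<alpha>': "\<alpha>' \<in> FI_hom d m (n + 1)"
        unfolding \<alpha>'_def by (rule FI_comp_in_hom[OF FI_perm_in_hom[OF \<sigma>] \<alpha>])
      have fst: "fst \<alpha>' z = \<sigma> (fst \<alpha> z)" if "z \<in> {1..m}" for z
        unfolding \<alpha>'_def by (rule fst_FI_comp_perm[OF \<alpha> that])
      have incl: "fst (FI_incl i n) ` {1..n} = {1..n}"
        by (simp add: FI_incl_def)
      have "\<exists>\<beta>\<in>FI_hom d m n. \<alpha>' = FI_comp m n (n + 1) (FI_incl i n) \<beta>"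
      proof (rule FI_factor_right[OF \<alpha>' FI_incl_in_hom[OF i]])
        show "fst \<alpha>' ` {1..m} \<subseteq> fst (FI_incl i n) ` {1..n}"
          unfolding incl
        proof
          fix z assume "z \<in> fst \<alpha>' ` {1..m}"
          then obtain u where u: "u \<in> {1..m}" "z = \<sigma> (fst \<alpha> u)"
            using fst by auto
          then have "fst \<alpha> u \<noteq> y" "fst \<alpha> u \<in> {1..n + 1}"
            using y(2) fst_FI_hom_image[OF \<alpha>] by blast+
          then have "z \<noteq> n + 1" "z \<in> {1..n + 1}"
            using inj_eq[OF permutes_inj[OF \<sigma>], of "fst \<alpha> u" y] \<sigma>y permutes_in_image[OF \<sigma>] u(2)
            by metis+
          then show "z \<in> {1..n}"
            by auto
        qed
        fix z assume "z \<in> {1..n + 1}" "z \<notin> fst (FI_incl i n) ` {1..n}"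
        then have z: "z = n + 1"
          unfolding incl by auto
        have "snd \<alpha>' (\<sigma> y) = snd \<alpha> y"
          unfolding \<alpha>'_def by (rule snd_FI_comp_perm[OF \<sigma> \<alpha> y])
        then show "snd \<alpha>' z = snd (FI_incl i n) z"
          by (simp add: z \<sigma>y i_def FI_incl_def)
      qed
      then obtain \<beta> where \<beta>: "\<beta> \<in> FI_hom d m n" "\<alpha>' = FI_comp m n (n + 1) (FI_incl i n) \<beta>"
        by blast
      have "act m (n + 1) \<alpha>' x = phi act i n (act m n \<beta> x)"
        unfolding \<beta>(2) phi_def by (rule act_comp[OF FI_incl_in_hom[OF i] \<beta>(1) xV])
      then have "act m (n + 1) \<alpha>' x \<in> W"
        using W(2) phi_sum_single[OF i act_in[OF \<beta>(1) xV]] by auto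
      then have "perm_act act (n + 1) \<sigma> (act m (n + 1) \<alpha>' x) \<in> W"
        using W(1) \<sigma> by (auto simp: subrep_def)
      \<comment> \<open>\<sigma> is an involution, so applying it once more undoes the passage from
        \<alpha> to \<open>\<alpha>'\<close>.\<close>
      moreover have "perm_act act (n + 1) \<sigma> (act m (n + 1) \<alpha>' x) = act m (n + 1) \<alpha> x"
      proof -
        have "perm_act act (n + 1) \<sigma> (perm_act act (n + 1) \<sigma> (act m (n + 1) \<alpha> x)) =
            act (n + 1) (n + 1) (FI_perm (n + 1) (\<sigma> \<circ> \<sigma>)) (act m (n + 1) \<alpha> x)"
          unfolding perm_act_def FI_comp_perm_perm[OF \<sigma> \<sigma>, symmetric]
          by (rule act_comp[OF FI_perm_in_hom[OF \<sigma>] FI_perm_in_hom[OF \<sigma>] act_in[OF \<alpha> xV], symmetric])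
        also have "\<dots> = act m (n + 1) \<alpha> x"
          using act_id[OF act_in[OF \<alpha> xV]] by (simp add: \<sigma>_def FI_perm_id)
        finally show ?thesis
          unfolding perm_act_act[OF \<sigma> \<alpha> xV] \<alpha>'_def .
      qed
      ultimately show ?thesis
        by simp
    qed
    then have "span {act m (n + 1) \<alpha> x |m x \<alpha>. (m, x) \<in> S \<and> \<alpha> \<in> FI_hom d m (n + 1)} \<subseteq> W"
      using W(1) by (intro span_minimal) (auto simp: subrep_def)
    then show ?thesis
      using gen by blast
  qed
  moreover have "V (n + 1) \<in> {W. subrep scale (n + 1) (perm_act act (n + 1)) (V (n + 1)) W \<and> ?X \<subseteq> W}"
    using subrep_V phi_sum_in_V by simp
  ultimately show ?thesis
    unfolding subrep_generated_def by (intro antisym Inter_lower Inter_greatest) blast+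
qed

lemma finitely_generated_phi_span:
  assumes finitely_generated
  shows "\<forall>\<^sub>F n in sequentially. subrep_generated scale (n + 1) (perm_act act (n + 1)) (V (n + 1))
    {\<Sum>i=1..d. phi act i n (x i) |x. \<forall>i\<in>{1..d}. x i \<in> V n} = V (n + 1)"
proof -
  obtain S where S: "finite S" "S \<subseteq> Sigma UNIV V"
    "\<forall>n. V n = span {act m n \<alpha> x |m x \<alpha>. (m, x) \<in> S \<and> \<alpha> \<in> FI_hom d m n}"
    using finitely_generated_span[OF assms] by blast
  obtain N where N: "\<forall>m\<in>fst ` S. m \<le> N"
    using finite_nat_set_iff_bounded_le[of "fst ` S"] S(1) by auto
  show ?thesis
    unfolding eventually_sequentially
    using N by (intro exI[of _ N] allI impI generated_in_degree_subrep[OF S(3)[rule_format] S(2)]) force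
qed

text \<open>Finite spanning sets of the spaces up to degree \<open>N\<close> generate everything:
  from there on, induction on the degree applies, since in each later degree a submodule is a
  subrepresentation that contains the images of the \<open>phi\<close>.\<close>

lemma finitely_generatedI:
  assumes fin: "\<And>n. finite_dimensional scale (V n)"
    and gen: "\<forall>\<^sub>F n in sequentially. subrep_generated scale (n + 1) (perm_act act (n + 1)) (V (n + 1))
      {\<Sum>i=1..d. phi act i n (x i) |x. \<forall>i\<in>{1..d}. x i \<in> V n} = V (n + 1)"
  shows finitely_generated
proof -
  obtain N where N: "\<And>n. n \<ge> N \<Longrightarrow> subrep_generated scale (n + 1) (perm_act act (n + 1)) (V (n + 1))
      {\<Sum>i=1..d. phi act i n (x i) |x. \<forall>i\<in>{1..d}. x i \<in> V n} = V (n + 1)"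
    using gen unfolding eventually_sequentially by blast
  obtain B where B: "\<And>n. finite (B n)" "\<And>n. B n \<subseteq> V n" "\<And>n. span (B n) = V n"
    using fin unfolding finite_dimensional_def by metis
  have "W = V" if W: "submodule W" and SW: "Sigma {..N} B \<subseteq> Sigma UNIV W" for W
  proof
    have WV: "W n \<subseteq> V n" "subspace (W n)" for n
      using W by (auto simp: submodule_def)
    have act_W: "act m n \<alpha> x \<in> W n" if "\<alpha> \<in> FI_hom d m n" "x \<in> W m" for m n \<alpha> x
      using W that unfolding submodule_def by blast
    fix n
    show "W n = V n"
    proof (induction n rule: less_induct)
      case (less n)
      show ?case
      proof (cases "n \<le> N")
        case True
        then have "B n \<subseteq> W n"
          using SW by auto
        then show ?thesis
          using span_minimal[OF _ WV(2)] B(3) WV(1) by blast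
      next
        case False
        define m where "m = n - 1"
        have n: "n = m + 1" "m \<ge> N"
          using False by (auto simp: m_def)
        have "subrep scale n (perm_act act n) (V n) (W n)"
          using WV act_W[OF FI_perm_in_hom] by (auto simp: subrep_def perm_act_def)
        moreover have "{\<Sum>i=1..d. phi act i m (x i) |x. \<forall>i\<in>{1..d}. x i \<in> V m} \<subseteq> W n"
          using less[of m] n(1) act_W[OF FI_incl_in_hom, of _ _ m]
          by (auto simp: phi_def intro!: subspace_sum[OF WV(2)])
        ultimately have "subrep_generated scale n (perm_act act n) (V n)
            {\<Sum>i=1..d. phi act i m (x i) |x. \<forall>i\<in>{1..d}. x i \<in> V m} \<subseteq> W n"
          unfolding subrep_generated_def by (intro Inter_lower) simp
        then show ?thesis
          using N[OF n(2)] WV(1)[of n] unfolding n(1) by blast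
      qed
    qed
  qed
  then show ?thesis
    unfolding finitely_generated_def using B(1,2)
    by (intro exI[of _ "Sigma {..N} B"]) auto
qed

end

section \<open>Leading words\<close>

text \<open>
  A morphism \<open>(f, g) : [m] \<rightarrow> [n]\<close> is encoded as a word of length \<open>n\<close>, with the letter \<open>d + q\<close> at
  the position \<open>f q\<close> and the colour \<open>g p\<close> at each position \<open>p\<close> outside the image of \<open>f\<close>.
\<close>

definition letter :: "nat \<Rightarrow> nat \<Rightarrow> fi_mor \<Rightarrow> nat \<Rightarrow> nat" where
  "letter d m \<alpha> p = (if p \<in> fst \<alpha> ` {1..m} then d + inv_into {1..m} (fst \<alpha>) p else snd \<alpha> p)"

definition word :: "nat \<Rightarrow> nat \<Rightarrow> nat \<Rightarrow> fi_mor \<Rightarrow> nat list" where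
  "word d m n \<alpha> = map (\<lambda>i. letter d m \<alpha> (Suc i)) [0..<n]"

lemma length_word [simp]: "length (word d m n \<alpha>) = n"
  by (simp add: word_def)

lemma nth_word [simp]: "i < n \<Longrightarrow> word d m n \<alpha> ! i = letter d m \<alpha> (Suc i)"
  by (simp add: word_def)

lemma letter_image:
  assumes "\<alpha> \<in> FI_hom d m n" "q \<in> {1..m}"
  shows "letter d m \<alpha> (fst \<alpha> q) = d + q"
  using assms inv_into_f_f[OF inj_fst_FI_hom[OF assms(1)] assms(2)] by (simp add: letter_def)

lemma letter_off: "p \<notin> fst \<alpha> ` {1..m} \<Longrightarrow> letter d m \<alpha> p = snd \<alpha> p"
  by (simp add: letter_def)

lemma letter_gt_iff:
  assumes "\<alpha> \<in> FI_hom d m n" "p \<in> {1..n}"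
  shows "letter d m \<alpha> p > d \<longleftrightarrow> p \<in> fst \<alpha> ` {1..m}"
proof (cases "p \<in> fst \<alpha> ` {1..m}")
  case True
  then obtain q where "q \<in> {1..m}" "p = fst \<alpha> q"
    by blast
  then show ?thesis
    using letter_image[OF assms(1)] by auto
next
  case False
  then have "letter d m \<alpha> p \<in> {1..d}"
    using snd_FI_hom[OF assms False] by (simp add: letter_off)
  then show ?thesis
    using False by auto
qed

lemma letter_eq_iff:
  assumes "\<alpha> \<in> FI_hom d m n" "p \<in> {1..n}" "q \<in> {1..m}"
  shows "letter d m \<alpha> p = d + q \<longleftrightarrow> p = fst \<alpha> q"
proof
  assume eq: "letter d m \<alpha> p = d + q"
  then have "letter d m \<alpha> p > d"
    using assms(3) by simp
  then obtain q' where "q' \<in> {1..m}" "p = fst \<alpha> q'"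
    using letter_gt_iff[OF assms(1,2)] by blast
  then show "p = fst \<alpha> q"
    using letter_image[OF assms(1)] eq by simp
qed (use letter_image[OF assms(1,3)] in simp)

lemma letter_range:
  assumes "\<alpha> \<in> FI_hom d m n" "p \<in> {1..n}"
  shows "letter d m \<alpha> p \<in> {1..d + m}"
proof (cases "p \<in> fst \<alpha> ` {1..m}")
  case True
  then obtain q where "q \<in> {1..m}" "p = fst \<alpha> q"
    by blast
  then show ?thesis
    using letter_image[OF assms(1)] by simp
next
  case False
  then show ?thesis
    using snd_FI_hom[OF assms False] by (simp add: letter_off)
qed

lemma FI_hom_eq_letter:
  assumes \<alpha>: "\<alpha> \<in> FI_hom d m n" and \<beta>: "\<beta> \<in> FI_hom d m n"
    and eq: "\<And>p. p \<in> {1..n} \<Longrightarrow> letter d m \<alpha> p = letter d m \<beta> p"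
  shows "\<alpha> = \<beta>"
proof (rule FI_hom_eqI[OF \<alpha> \<beta>])
  show "fst \<alpha> x = fst \<beta> x" if "x \<in> {1..m}" for x
  proof -
    have *: "fst \<alpha> x \<in> {1..n}"
      using fst_FI_hom_image[OF \<alpha>] that by blast
    then show ?thesis
      using letter_image[OF \<alpha> that] eq[OF *] letter_eq_iff[OF \<beta> * that] by simp
  qed
  fix y assume y: "y \<in> {1..n}" "y \<notin> fst \<alpha> ` {1..m}"
  then have "y \<notin> fst \<beta> ` {1..m}"
    using letter_gt_iff[OF \<alpha> y(1)] letter_gt_iff[OF \<beta> y(1)] eq[OF y(1)] by simp
  then show "snd \<alpha> y = snd \<beta> y"
    using eq[OF y(1)] y(2) by (simp add: letter_off)
qed

lemma word_inj:
  assumes "\<alpha> \<in> FI_hom d m n" "\<beta> \<in> FI_hom d m n" "word d m n \<alpha> = word d m n \<beta>"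
  shows "\<alpha> = \<beta>"
proof (rule FI_hom_eq_letter[OF assms(1,2)])
  fix p assume "p \<in> {1..n}"
  then have "p - 1 < n" "Suc (p - 1) = p"
    by auto
  then show "letter d m \<alpha> p = letter d m \<beta> p"
    using assms(3) nth_word by metis
qed

text \<open>With \<open>letter_comp_off\<close> this describes composition by words: the letters of
  \<gamma> are spread over the image of \<iota>, and the colours of \<iota> are inserted at the
  remaining positions.\<close>

lemma letter_comp_image:
  assumes \<iota>: "\<iota> \<in> FI_hom d n n'" and \<gamma>: "\<gamma> \<in> FI_hom d m n" and p: "p \<in> {1..n}"
  shows "letter d m (FI_comp m n n' \<iota> \<gamma>) (fst \<iota> p) = letter d m \<gamma> p"
proof -
  have hom: "FI_comp m n n' \<iota> \<gamma> \<in> FI_hom d m n'"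
    by (rule FI_comp_in_hom[OF \<iota> \<gamma>])
  have ip: "fst \<iota> p \<in> {1..n'}"
    using fst_FI_hom_image[OF \<iota>] p by blast
  show ?thesis
  proof (cases "p \<in> fst \<gamma> ` {1..m}")
    case True
    then obtain q where q: "q \<in> {1..m}" "p = fst \<gamma> q"
      by blast
    then show ?thesis
      using letter_image[OF hom q(1)] letter_image[OF \<gamma> q(1)] by (simp add: fst_FI_comp)
  next
    case False
    have *: "fst \<iota> p \<notin> fst \<iota> ` fst \<gamma> ` {1..m}"
      using False inj_on_image_mem_iff[OF inj_fst_FI_hom[OF \<iota>] p fst_FI_hom_image[OF \<gamma>]] by simp
    then have "fst \<iota> p \<notin> fst (FI_comp m n n' \<iota> \<gamma>) ` {1..m}"
      by (auto simp: fst_FI_comp)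
    then show ?thesis
      using False snd_FI_comp[OF \<iota> ip *] p inv_into_f_f[OF inj_fst_FI_hom[OF \<iota>] p]
      by (simp add: letter_off)
  qed
qed

lemma letter_comp_off:
  assumes \<iota>: "\<iota> \<in> FI_hom d n n'" and \<gamma>: "\<gamma> \<in> FI_hom d m n"
    and p: "p \<in> {1..n'}" "p \<notin> fst \<iota> ` {1..n}"
  shows "letter d m (FI_comp m n n' \<iota> \<gamma>) p = snd \<iota> p"
proof -
  have *: "p \<notin> fst \<iota> ` fst \<gamma> ` {1..m}"
    using p(2) fst_FI_hom_image[OF \<gamma>] by blast
  then have "p \<notin> fst (FI_comp m n n' \<iota> \<gamma>) ` {1..m}"
    by (auto simp: fst_FI_comp)
  then show ?thesis
    using snd_FI_comp[OF \<iota> p(1) *] p(2) by (simp add: letter_off)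
qed

lemma word_less_iff:
  "word d m n \<alpha> < word d m' n \<beta> \<longleftrightarrow> (\<exists>p\<in>{1..n}. letter d m \<alpha> p < letter d m' \<beta> p \<and>
    (\<forall>q\<in>{1..<p}. letter d m \<alpha> q = letter d m' \<beta> q))"
proof -
  have "word d m n \<alpha> < word d m' n \<beta> \<longleftrightarrow> (\<exists>i<n. take i (word d m n \<alpha>) = take i (word d m' n \<beta>) \<and>
      letter d m \<alpha> (Suc i) < letter d m' \<beta> (Suc i))"
    unfolding list_less_def lexord_take_index_conv by auto
  also have "\<dots> \<longleftrightarrow> (\<exists>i<n. (\<forall>j<i. letter d m \<alpha> (Suc j) = letter d m' \<beta> (Suc j)) \<and>
      letter d m \<alpha> (Suc i) < letter d m' \<beta> (Suc i))"
    by (intro ex_cong1 conj_cong refl) (auto simp: list_eq_iff_nth_eq)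
  also have "\<dots> \<longleftrightarrow> (\<exists>p\<in>{1..n}. letter d m \<alpha> p < letter d m' \<beta> p \<and>
    (\<forall>q\<in>{1..<p}. letter d m \<alpha> q = letter d m' \<beta> q))"
  proof
    assume "\<exists>i<n. (\<forall>j<i. letter d m \<alpha> (Suc j) = letter d m' \<beta> (Suc j)) \<and>
      letter d m \<alpha> (Suc i) < letter d m' \<beta> (Suc i)"
    then obtain i where i: "i < n" "\<forall>j<i. letter d m \<alpha> (Suc j) = letter d m' \<beta> (Suc j)"
      "letter d m \<alpha> (Suc i) < letter d m' \<beta> (Suc i)"
      by blast
    have "letter d m \<alpha> q = letter d m' \<beta> q" if "q \<in> {1..<Suc i}" for q
      using i(2)[rule_format, of "q - 1"] that by (cases q) auto
    then show "\<exists>p\<in>{1..n}. letter d m \<alpha> p < letter d m' \<beta> p \<and>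
      (\<forall>q\<in>{1..<p}. letter d m \<alpha> q = letter d m' \<beta> q)"
      using i by (intro bexI[of _ "Suc i"]) auto
  next
    assume "\<exists>p\<in>{1..n}. letter d m \<alpha> p < letter d m' \<beta> p \<and>
      (\<forall>q\<in>{1..<p}. letter d m \<alpha> q = letter d m' \<beta> q)"
    then obtain p where "p \<in> {1..n}" "letter d m \<alpha> p < letter d m' \<beta> p"
      "\<forall>q\<in>{1..<p}. letter d m \<alpha> q = letter d m' \<beta> q"
      by blast
    then show "\<exists>i<n. (\<forall>j<i. letter d m \<alpha> (Suc j) = letter d m' \<beta> (Suc j)) \<and>
      letter d m \<alpha> (Suc i) < letter d m' \<beta> (Suc i)"
      by (intro exI[of _ "p - 1"]) auto
  qed
  finally show ?thesis .
qed

text \<open>An increasing \<iota> inserts the same letters at the same places of both words, so the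
  first difference is only moved, from \<open>p\<close> to \<open>fst \<iota> p\<close>.\<close>

lemma word_comp_less:
  assumes \<iota>: "\<iota> \<in> FI_hom d n n'" "strict_mono_on {1..n} (fst \<iota>)"
    and \<gamma>: "\<gamma> \<in> FI_hom d m n" "\<delta> \<in> FI_hom d m' n" and less: "word d m n \<gamma> < word d m' n \<delta>"
  shows "word d m n' (FI_comp m n n' \<iota> \<gamma>) < word d m' n' (FI_comp m' n n' \<iota> \<delta>)"
proof -
  obtain p where p: "p \<in> {1..n}" "letter d m \<gamma> p < letter d m' \<delta> p"
    "\<forall>q\<in>{1..<p}. letter d m \<gamma> q = letter d m' \<delta> q"
    using less unfolding word_less_iff by blast
  have ip: "fst \<iota> p \<in> {1..n'}"
    using fst_FI_hom_image[OF \<iota>(1)] p(1) by blast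
  have "letter d m (FI_comp m n n' \<iota> \<gamma>) q = letter d m' (FI_comp m' n n' \<iota> \<delta>) q"
    if q: "q \<in> {1..<fst \<iota> p}" for q
  proof (cases "q \<in> fst \<iota> ` {1..n}")
    case True
    then obtain u where u: "u \<in> {1..n}" "q = fst \<iota> u"
      by blast
    have "u < p"
      using strict_mono_on_less[OF \<iota>(2) u(1) p(1)] q u(2) by simp
    then show ?thesis
      using p(3) u letter_comp_image[OF \<iota>(1) \<gamma>(1) u(1)] letter_comp_image[OF \<iota>(1) \<gamma>(2) u(1)] by simp
  next
    case False
    have "q \<in> {1..n'}"
      using q ip by simp
    then show ?thesis
      using letter_comp_off[OF \<iota>(1) \<gamma>(1) _ False] letter_comp_off[OF \<iota>(1) \<gamma>(2) _ False] by simp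
  qed
  then show ?thesis
    unfolding word_less_iff
    using ip p(2) letter_comp_image[OF \<iota>(1) \<gamma>(1) p(1)] letter_comp_image[OF \<iota>(1) \<gamma>(2) p(1)]
    by (intro bexI[of _ "fst \<iota> p"]) auto
qed

text \<open>The embedding of words is the first component of \<iota>. Each letter above
  \<open>d\<close> occurs exactly once in either word, so the letters of \<beta> that are skipped
  are colours, and they form the second component.\<close>

lemma subseq_word_factor:
  assumes \<alpha>: "\<alpha> \<in> FI_hom d m n" and \<beta>: "\<beta> \<in> FI_hom d m n'"
    and sub: "subseq (word d m n \<alpha>) (word d m n' \<beta>)"
  shows "\<exists>\<iota>\<in>FI_hom d n n'. strict_mono_on {1..n} (fst \<iota>) \<and> \<beta> = FI_comp m n n' \<iota> \<alpha>"
proof -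
  obtain h where h: "strict_mono_on {..<n} h" "\<And>i. i < n \<Longrightarrow> h i < n'"
    "\<And>i. i < n \<Longrightarrow> word d m n' \<beta> ! h i = word d m n \<alpha> ! i"
    using subseq_embedding[OF sub] unfolding length_word by blast
  \<comment> \<open>Positions in a list start at 0, points of [n] at 1.\<close>
  define f where "f = (\<lambda>p\<in>{1..n}. Suc (h (p - 1)))"
  have f: "f p \<in> {1..n'}" "letter d m \<beta> (f p) = letter d m \<alpha> p" if "p \<in> {1..n}" for p
  proof -
    have p: "p - 1 < n" "Suc (p - 1) = p"
      using that by auto
    then show "f p \<in> {1..n'}" "letter d m \<beta> (f p) = letter d m \<alpha> p"
      using that h(2,3)[OF p(1)] by (auto simp: f_def)
  qed
  have mono: "strict_mono_on {1..n} f"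
  proof (rule strict_mono_onI)
    fix p q assume "p \<in> {1..n}" "q \<in> {1..n}" "p < q"
    then show "f p < f q"
      using strict_mono_onD[OF h(1), of "p - 1" "q - 1"] by (simp add: f_def)
  qed
  have img: "fst \<beta> q = f (fst \<alpha> q)" if q: "q \<in> {1..m}" for q
  proof -
    have "fst \<alpha> q \<in> {1..n}"
      using fst_FI_hom_image[OF \<alpha>] q by blast
    then show ?thesis
      using letter_eq_iff[OF \<beta> f(1) q] f(2) letter_image[OF \<alpha> q] by metis
  qed
  define k where "k = (\<lambda>p\<in>{1..n'} - f ` {1..n}. snd \<beta> p)"
  have off: "p \<notin> fst \<beta> ` {1..m}" if "p \<notin> f ` {1..n}" for p
  proof
    assume "p \<in> fst \<beta> ` {1..m}"
    then obtain q where "q \<in> {1..m}" "p = f (fst \<alpha> q)"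
      using img by auto
    then show False
      using that fst_FI_hom_image[OF \<alpha>] by blast
  qed
  have \<iota>: "(f, k) \<in> FI_hom d n n'"
    unfolding FI_hom_iff
  proof (intro conjI)
    show "f \<in> {1..n} \<rightarrow>\<^sub>E {1..n'}"
      using f(1) by (intro PiE_I) (auto simp: f_def)
    show "inj_on f {1..n}"
      by (rule strict_mono_on_imp_inj_on[OF mono])
    show "k \<in> {1..n'} - f ` {1..n} \<rightarrow>\<^sub>E {1..d}"
      unfolding k_def restrict_PiE_iff using snd_FI_hom[OF \<beta>] off by blast
  qed
  have "\<beta> = FI_comp m n n' (f, k) \<alpha>"
  proof (rule FI_hom_eq_letter[OF \<beta> FI_comp_in_hom[OF \<iota> \<alpha>]])
    fix p assume p: "p \<in> {1..n'}"
    show "letter d m \<beta> p = letter d m (FI_comp m n n' (f, k) \<alpha>) p"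
    proof (cases "p \<in> f ` {1..n}")
      case True
      then obtain q where "q \<in> {1..n}" "p = f q"
        by blast
      then show ?thesis
        using f(2) letter_comp_image[OF \<iota> \<alpha>] by simp
    next
      case False
      then show ?thesis
        using p off[OF False] letter_comp_off[OF \<iota> \<alpha> p] by (simp add: letter_off k_def)
    qed
  qed
  then show ?thesis
    using \<iota> mono by (intro bexI[of _ "(f, k)"]) simp_all
qed

text \<open>The vectors \<open>b e\<close> may be dependent, so \<open>v\<close> has no unique
  expansion; \<open>e\<close> is chosen with the least key such that \<open>v\<close> lies in the
  span of the terms up to \<open>e\<close>. If strictly smaller terms sufficed, the greatest of them
  would be a smaller bound.\<close>

lemma (in vector_space) exists_leading_term:
  fixes key :: "'e \<Rightarrow> 'o::linorder"
  assumes E: "finite E" and v: "v \<in> span (b ` E)" "v \<noteq> 0"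
  shows "\<exists>e\<in>E. v \<in> span (b ` {e'\<in>E. key e' \<le> key e}) \<and> v \<notin> span (b ` {e'\<in>E. key e' < key e})"
proof -
  define K where "K = {e\<in>E. v \<in> span (b ` {e'\<in>E. key e' \<le> key e})}"
  \<comment> \<open>As \<open>v\<close> is nonzero, a set of terms whose span contains it is not
    empty and has a greatest key.\<close>
  have top: "\<exists>e\<in>F. \<forall>e'\<in>F. key e' \<le> key e" if "F \<subseteq> E" "v \<in> span (b ` F)" for F
  proof -
    have F: "finite F" "F \<noteq> {}"
      using that v(2) finite_subset[OF _ E] by auto
    then have "Max (key ` F) \<in> key ` F"
      by (intro Max_in) auto
    then obtain e where "e \<in> F" "key e = Max (key ` F)"
      by (metis imageE)
    then show ?thesis
      using F by (auto intro!: bexI[of _ e])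
  qed
  obtain e where "e \<in> E" "\<forall>e'\<in>E. key e' \<le> key e"
    using top[of E] v(1) by blast
  moreover from this have "{e'\<in>E. key e' \<le> key e} = E"
    by auto
  ultimately have "e \<in> K"
    using v(1) by (simp add: K_def)
  moreover have finK: "finite K"
    using E by (simp add: K_def)
  ultimately have "Min (key ` K) \<in> key ` K"
    by (intro Min_in) auto
  then obtain e where e: "e \<in> K" "key e = Min (key ` K)"
    by (metis imageE)
  have min: "key e \<le> key e'" if "e' \<in> K" for e'
    using that finK e(2) by simp
  have "v \<notin> span (b ` {e'\<in>E. key e' < key e})"
  proof
    assume *: "v \<in> span (b ` {e'\<in>E. key e' < key e})"
    then obtain e2 where e2: "e2 \<in> E" "key e2 < key e" "\<forall>e'\<in>{e'\<in>E. key e' < key e}. key e' \<le> key e2"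
      using top[of "{e'\<in>E. key e' < key e}"] by blast
    then have "{e'\<in>E. key e' \<le> key e2} = {e'\<in>E. key e' < key e}"
      by auto
    then have "e2 \<in> K"
      using e2(1) * by (simp add: K_def)
    then show False
      using min e2(2) by fastforce
  qed
  then show ?thesis
    using e(1) by (auto simp: K_def)
qed

context FI_module
begin

text \<open>
  If \<open>v\<close> is killed by \<open>\<iota>\<close>, then \<open>\<iota>\<close> maps the leading term of \<open>v\<close> into the span of smaller words. By
  Higman's lemma this image is the leading term of another torsion element as soon as there is
  torsion in infinitely many degrees; but a leading term is never in the span of smaller words.
\<close>

lemma finitely_generated_no_torsion:
  assumes finitely_generated "d \<ge> 1"
  shows "\<forall>\<^sub>F n in sequentially. (\<Inter>i\<in>{1..d}. {x \<in> V n. phi act i n x = 0}) = {0}"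
proof (rule ccontr)
  define K where "K n = (\<Inter>i\<in>{1..d}. {x \<in> V n. phi act i n x = 0})" for n
  assume "\<not> ?thesis"
  then have "\<not> (\<forall>\<^sub>F n in sequentially. K n = {0})"
    by (simp add: K_def)
  then have inf: "infinite {n. K n \<noteq> {0}}"
    by (simp add: infinite_nat_iff_unbounded_le eventually_sequentially)
  obtain S where S: "finite S" "S \<subseteq> Sigma UNIV V"
    "\<forall>n. V n = span {act m n \<alpha> x |m x \<alpha>. (m, x) \<in> S \<and> \<alpha> \<in> FI_hom d m n}"
    using finitely_generated_span[OF assms(1)] by blast
  obtain gs where gs: "set gs = S"
    using finite_list[OF S(1)] by blast
  define deg where "deg j = fst (gs ! j)" for j
  define gen where "gen j = snd (gs ! j)" for j
  have gen_V: "gen j \<in> V (deg j)" if "j < length gs" for j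
    using that gs S(2) nth_mem[OF that] by (auto simp: gen_def deg_def subset_iff)
  define E where "E n = Sigma {..<length gs} (\<lambda>j. FI_hom d (deg j) n)" for n
  define b where "b n e = act (deg (fst e)) n (snd e) (gen (fst e))" for n and e :: "nat \<times> fi_mor"
  \<comment> \<open>The index of the generator comes first: it is unchanged by composition with
    \<iota>, so words are compared only for one generator and hence for one source [m].\<close>
  define key where "key n e = fst e # word d (deg (fst e)) n (snd e)" for n and e :: "nat \<times> fi_mor"
  have finE: "finite (E n)" for n
    using finite_FI_hom by (simp add: E_def)
  have bV: "b n e \<in> V n" if "e \<in> E n" for n e
    using that act_in[OF _ gen_V] by (auto simp: E_def b_def)
  have span_E: "V n = span (b n ` E n)" for n
  proof -
    have "{act m n \<alpha> x |m x \<alpha>. (m, x) \<in> S \<and> \<alpha> \<in> FI_hom d m n} \<subseteq> b n ` E n"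
    proof clarify
      fix m x \<alpha>1 \<alpha>2 assume mx: "(m, x) \<in> S" and \<alpha>: "(\<alpha>1, \<alpha>2) \<in> FI_hom d m n"
      obtain j where j: "j < length gs" "gs ! j = (m, x)"
        using mx gs by (metis in_set_conv_nth)
      then have "act m n (\<alpha>1, \<alpha>2) x = b n (j, (\<alpha>1, \<alpha>2))" "(j, (\<alpha>1, \<alpha>2)) \<in> E n"
        using \<alpha> by (auto simp: b_def E_def deg_def gen_def)
      then show "act m n (\<alpha>1, \<alpha>2) x \<in> b n ` E n"
        by blast
    qed
    then have "V n \<subseteq> span (b n ` E n)"
      unfolding S(3)[rule_format, of n] by (rule span_mono)
    moreover have "span (b n ` E n) \<subseteq> V n"
      using bV by (intro span_minimal subspace_V) blast
    ultimately show ?thesis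
      by blast
  qed
  have key_inj: "e = e'" if "e \<in> E n" "e' \<in> E n" "key n e = key n e'" for n e e'
  proof -
    obtain j \<alpha> j' \<beta> where ee: "e = (j, \<alpha>)" "e' = (j', \<beta>)"
      by (cases e, cases e')
    then have "j = j'" "word d (deg j) n \<alpha> = word d (deg j) n \<beta>"
      using that(3) by (auto simp: key_def)
    moreover from this have "\<alpha> \<in> FI_hom d (deg j) n" "\<beta> \<in> FI_hom d (deg j) n"
      using that(1,2) ee by (auto simp: E_def)
    ultimately show ?thesis
      using word_inj ee by blast
  qed
  define below where "below n e = span (b n ` {e'\<in>E n. key n e' < key n e})" for n e
  define below_eq where "below_eq n e = span (b n ` {e'\<in>E n. key n e' \<le> key n e})" for n e
  have below_eq: "below_eq n e = span (insert (b n e) (b n ` {e'\<in>E n. key n e' < key n e}))"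
    if "e \<in> E n" for n e
  proof -
    have "{e'\<in>E n. key n e' \<le> key n e} = insert e {e'\<in>E n. key n e' < key n e}"
      unfolding le_less using that key_inj by blast
    then show ?thesis
      by (simp add: below_eq_def)
  qed
  obtain r :: "nat \<Rightarrow> nat" where r: "strict_mono r" "\<forall>i. r i \<in> {n. K n \<noteq> {0}}"
    using infinite_enumerate[OF inf] by blast
  have "\<exists>v e. v \<in> K (r i) \<and> e \<in> E (r i) \<and> v \<in> below_eq (r i) e \<and> v \<notin> below (r i) e" for i
  proof -
    have "phi act i n 0 = 0" if "i \<in> {1..d}" for i n
      unfolding phi_def by (rule act_zero[OF FI_incl_in_hom[OF that]])
    then have "0 \<in> K (r i)"
      using subspace_0[OF subspace_V] by (simp add: K_def)
    then obtain v where v: "v \<in> K (r i)" "v \<noteq> 0"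
      using r(2)[rule_format, of i] by blast
    then have "v \<in> span (b (r i) ` E (r i))"
      using assms(2) span_E[of "r i"] by (force simp: K_def)
    from exists_leading_term[OF finE this v(2), of "key (r i)"] show ?thesis
      using v(1) unfolding below_def below_eq_def by blast
  qed
  then obtain v e where v: "\<And>i. v i \<in> K (r i)" and e: "\<And>i. e i \<in> E (r i)"
    and lead: "\<And>i. v i \<in> below_eq (r i) (e i)" "\<And>i. v i \<notin> below (r i) (e i)"
    by metis
  have "fst (e i) < length gs" for i
    using e[of i] by (cases "e i") (simp add: E_def)
  then have "range (\<lambda>i. fst (e i)) \<subseteq> {..<length gs}"
    by blast
  then have "finite (range (\<lambda>i. fst (e i)))"
    by (rule finite_subset) simp
  \<comment> \<open>One generator accounts for infinitely many of the leading terms, so their words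
    are over one finite alphabet.\<close>
  then obtain j where "infinite {i. fst (e i) = j}"
    using pigeonhole_infinite[of UNIV "\<lambda>i. fst (e i)"] by auto
  then obtain q :: "nat \<Rightarrow> nat" where q: "strict_mono q" "\<And>i. fst (e (q i)) = j"
    using infinite_enumerate[of "{i. fst (e i) = j}"] by auto
  define N where "N i = r (q i)" for i
  define \<alpha> where "\<alpha> i = snd (e (q i))" for i
  have e_eq: "e (q i) = (j, \<alpha> i)" for i
    using q(2) by (metis \<alpha>_def prod.collapse)
  have j: "j < length gs" and \<alpha>: "\<alpha> i \<in> FI_hom d (deg j) (N i)" for i
    using e[of "q i"] unfolding e_eq by (auto simp: E_def N_def)
  obtain i k where ik: "i < k" "subseq (word d (deg j) (N i) (\<alpha> i)) (word d (deg j) (N k) (\<alpha> k))"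
  proof (rule higman[of "{1..d + deg j}" "\<lambda>i. word d (deg j) (N i) (\<alpha> i)"])
    show "set (word d (deg j) (N i) (\<alpha> i)) \<subseteq> {1..d + deg j}" for i
      using letter_range[OF \<alpha>[of i]] by (auto simp: word_def)
  qed auto
  obtain \<iota> where \<iota>: "\<iota> \<in> FI_hom d (N i) (N k)" "strict_mono_on {1..N i} (fst \<iota>)"
    "\<alpha> k = FI_comp (deg j) (N i) (N k) \<iota> (\<alpha> i)"
    using subseq_word_factor[OF \<alpha> \<alpha> ik(2)] by blast
  have less: "N i < N k"
    using ik(1) q(1) r(1) by (simp add: N_def strict_mono_less)
  define x where "x = v (q i)"
  have xV: "x \<in> V (N i)"
    using v[of "q i"] assms(2) by (force simp: x_def N_def K_def)
  have b_comp: "act (N i) (N k) \<iota> (b (N i) (j', \<gamma>)) = b (N k) (j', FI_comp (deg j') (N i) (N k) \<iota> \<gamma>)"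
    if "(j', \<gamma>) \<in> E (N i)" for j' \<gamma>
    using that act_comp[OF \<iota>(1) _ gen_V] by (simp add: b_def E_def)
  have x_zero: "act (N i) (N k) \<iota> x = 0"
    using v[of "q i"] by (intro killed_by_longer[OF xV _ \<iota>(1) less]) (simp add: x_def N_def K_def)
  have "x \<in> span (insert (b (N i) (j, \<alpha> i)) (b (N i) ` {e'\<in>E (N i). key (N i) e' < key (N i) (j, \<alpha> i)}))"
    using lead(1)[of "q i"] below_eq[OF e[of "q i"]] unfolding e_eq N_def x_def by simp
  \<comment> \<open>\<open>c\<close> is the leading coefficient of \<open>x\<close>. It is nonzero,
    since otherwise \<open>x\<close> would lie in the span of the smaller terms.\<close>
  then obtain c where z: "x - scale c (b (N i) (j, \<alpha> i)) \<in> below (N i) (j, \<alpha> i)"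
    unfolding span_breakdown_eq below_def by blast
  have "c \<noteq> 0"
    using z lead(2)[of "q i"] unfolding e_eq by (auto simp: x_def N_def)
  have act_below: "act (N i) (N k) \<iota> y \<in> below (N k) (j, \<alpha> k)" if "y \<in> below (N i) (j, \<alpha> i)" for y
  proof -
    have "below (N i) (j, \<alpha> i) \<subseteq> {y \<in> V (N i). act (N i) (N k) \<iota> y \<in> below (N k) (j, \<alpha> k)}"
      unfolding below_def[of "N i"]
    proof (intro span_minimal act_preimage_subspace[OF \<iota>(1)])
      show "subspace (below (N k) (j, \<alpha> k))"
        by (simp add: below_def)
      show "b (N i) ` {e'\<in>E (N i). key (N i) e' < key (N i) (j, \<alpha> i)} \<subseteq>
          {y \<in> V (N i). act (N i) (N k) \<iota> y \<in> below (N k) (j, \<alpha> k)}"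
      proof
        fix y assume "y \<in> b (N i) ` {e'\<in>E (N i). key (N i) e' < key (N i) (j, \<alpha> i)}"
        then obtain j' \<gamma> where y: "y = b (N i) (j', \<gamma>)" "(j', \<gamma>) \<in> E (N i)"
          "key (N i) (j', \<gamma>) < key (N i) (j, \<alpha> i)"
          by auto
        have \<gamma>: "\<gamma> \<in> FI_hom d (deg j') (N i)" and j': "j' < length gs"
          using y(2) by (auto simp: E_def)
        let ?e = "(j', FI_comp (deg j') (N i) (N k) \<iota> \<gamma>)"
        have "?e \<in> E (N k)"
          using j' FI_comp_in_hom[OF \<iota>(1) \<gamma>] by (simp add: E_def)
        moreover have "key (N k) ?e < key (N k) (j, \<alpha> k)"
          using y(3) word_comp_less[OF \<iota>(1,2) \<gamma> \<alpha>[of i]] unfolding \<iota>(3) by (auto simp: key_def)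
        ultimately have "b (N k) ?e \<in> below (N k) (j, \<alpha> k)"
          unfolding below_def by (intro span_base) blast
        then show "y \<in> {y \<in> V (N i). act (N i) (N k) \<iota> y \<in> below (N k) (j, \<alpha> k)}"
          using y(1) b_comp[OF y(2)] bV[OF y(2)] by simp
      qed
    qed
    then show ?thesis
      using that by blast
  qed
  have E_i: "(j, \<alpha> i) \<in> E (N i)"
    using j \<alpha> by (simp add: E_def)
  \<comment> \<open>As \<iota> kills \<open>x\<close>, the image of the lower part of
    \<open>x\<close> is, up to the factor -c, the leading term in degree \<open>N k\<close>.\<close>
  have "act (N i) (N k) \<iota> (scale (-c) (b (N i) (j, \<alpha> i)) + x) =
      scale (-c) (b (N k) (j, \<alpha> k))"
    unfolding act_add[OF \<iota>(1) subspace_scale[OF subspace_V bV[OF E_i]] xV]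
      act_scale[OF \<iota>(1) bV[OF E_i]] b_comp[OF E_i] x_zero \<iota>(3)[symmetric] by (rule add_0_right)
  moreover have "scale (-c) (b (N i) (j, \<alpha> i)) + x = x - scale c (b (N i) (j, \<alpha> i))"
    by simp
  ultimately have "scale (-c) (b (N k) (j, \<alpha> k)) \<in> below (N k) (j, \<alpha> k)"
    using act_below[OF z] by simp
  then have "scale (- 1 / c) (scale (-c) (b (N k) (j, \<alpha> k))) \<in> below (N k) (j, \<alpha> k)"
    unfolding below_def by (rule span_scale)
  then have "b (N k) (j, \<alpha> k) \<in> below (N k) (j, \<alpha> k)"
    using \<open>c \<noteq> 0\<close> by simp
  \<comment> \<open>The leading term in degree \<open>N k\<close> is now redundant, which
    contradicts its choice for the torsion element of that degree.\<close>
  then have "below_eq (N k) (j, \<alpha> k) = below (N k) (j, \<alpha> k)"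
    using below_eq[of "(j, \<alpha> k)" "N k"] e[of "q k"] span_redundant
    unfolding below_def e_eq N_def by simp
  then show False
    using lead[of "q k"] unfolding e_eq N_def by simp
qed

end

section \<open>Inserting a column into a tableau\<close>

text \<open>The first \<open>d\<close> rows, of length at least c + l, are lengthened by one cell;
  the other rows have length at most \<open>c\<close> and stay. Columns count from 0, so the columns
  c, ..., c + l of the new diagram, l + 1 in number, have height exactly \<open>d\<close>.\<close>

locale column_insertion =
  fixes \<mu> \<mu>' :: "nat list" and d c l :: nat and t :: "nat \<times> nat \<Rightarrow> nat"
  assumes len: "length \<mu>' = length \<mu>" "d \<le> length \<mu>"
    and long: "\<And>i. i < d \<Longrightarrow> \<mu>' ! i = \<mu> ! i + 1" "\<And>i. i < d \<Longrightarrow> c + l \<le> \<mu> ! i"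
    and short: "\<And>i. d \<le> i \<Longrightarrow> i < length \<mu> \<Longrightarrow> \<mu>' ! i = \<mu> ! i"
      "\<And>i. d \<le> i \<Longrightarrow> i < length \<mu> \<Longrightarrow> \<mu> ! i \<le> c"
    and sorted: "sorted_wrt (\<ge>) \<mu>" "sorted_wrt (\<ge>) \<mu>'"
    and t: "tableau \<mu> t"
begin

abbreviation "D \<equiv> young_diagram \<mu>"
abbreviation "D' \<equiv> young_diagram \<mu>'"

definition "N = sum_list \<mu>"

text \<open>The columns of \<open>t\<close> from \<open>c\<close> on move one step to the right, and
  the freed column receives N + 1, ..., N + d from top to bottom. As rows count from 0, the point
  that \<open>FI_block\<close> inserts with colour \<open>j\<close> stands in row j - 1.\<close>

definition t' :: "nat \<times> nat \<Rightarrow> nat" where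
  "t' = (\<lambda>(i, j). if j < c then t (i, j) else if j = c then N + 1 + i else t (i, j - 1))"

definition shift :: "nat \<times> nat \<Rightarrow> nat \<times> nat" where
  "shift = (\<lambda>(i, j). (i, if j < c then j else j + 1))"

lemma t'_shift: "t' (shift x) = t x"
  by (cases x) (simp add: t'_def shift_def)

lemma t'_column: "t' (i, c) = N + 1 + i"
  by (simp add: t'_def)

lemma fst_shift: "fst (shift x) = fst x"
  by (cases x) (simp add: shift_def)

lemma snd_shift_eq_iff: "snd (shift x) = snd (shift y) \<longleftrightarrow> snd x = snd y"
  by (cases x; cases y) (auto simp: shift_def)

lemma snd_shift_neq: "snd (shift x) \<noteq> c"
  by (cases x) (auto simp: shift_def)

lemma inj_shift: "inj shift"
  by (auto simp: inj_def shift_def split: if_splits)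

lemma D'_eq: "D' = shift ` D \<union> (\<lambda>i. (i, c)) ` {..<d}"
proof (intro set_eqI iffI)
  fix x assume "x \<in> D'"
  then obtain i j where x: "x = (i, j)" "i < length \<mu>" "j < \<mu>' ! i"
    using len by (auto simp: young_diagram_def)
  consider "j < c" | "j = c" | "j > c"
    by linarith
  then show "x \<in> shift ` D \<union> (\<lambda>i. (i, c)) ` {..<d}"
  proof cases
    case 1
    then have "(i, j) \<in> D" "shift (i, j) = x"
      using x long(2)[of i] short(1)[of i] by (cases "i < d"; auto simp: young_diagram_def shift_def)+
    then show ?thesis
      by (metis UnI1 imageI)
  next
    case 2
    then have "i < d"
      using x short[of i] by (cases "i < d") auto
    then show ?thesis
      using x 2 by auto
  next
    case 3
    then have "i < d"
      using x short[of i] by (cases "i < d") auto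
    then have "(i, j - 1) \<in> D" "shift (i, j - 1) = x"
      using x 3 long(1)[of i] by (auto simp: young_diagram_def shift_def)
    then show ?thesis
      by (metis UnI1 imageI)
  qed
next
  fix x assume "x \<in> shift ` D \<union> (\<lambda>i. (i, c)) ` {..<d}"
  then show "x \<in> D'"
  proof
    assume "x \<in> shift ` D"
    then obtain i j where "x = shift (i, j)" "i < length \<mu>" "j < \<mu> ! i"
      by (auto simp: young_diagram_def)
    then show "x \<in> D'"
      using len long(1)[of i] short[of i] by (cases "i < d") (auto simp: young_diagram_def shift_def)
  next
    assume "x \<in> (\<lambda>i. (i, c)) ` {..<d}"
    then obtain i where i: "x = (i, c)" "i < d"
      by auto
    then show "x \<in> D'"
      using len long(1)[OF i(2)] long(2)[OF i(2)] by (auto simp: young_diagram_def)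
  qed
qed

lemma D'_cases:
  assumes "x \<in> D'"
  obtains y where "y \<in> D" "x = shift y" | i where "i < d" "x = (i, c)"
  using assms unfolding D'_eq by blast

lemma shift_in: "x \<in> D \<Longrightarrow> shift x \<in> D'"
  unfolding D'_eq by blast

lemma column_in: "i < d \<Longrightarrow> (i, c) \<in> D'"
  unfolding D'_eq by blast

lemma sum_\<mu>': "sum_list \<mu>' = N + d"
proof -
  have "card D' = card (shift ` D) + card ((\<lambda>i. (i, c)) ` {..<d})"
    unfolding D'_eq using finite_young_diagram snd_shift_neq
    by (intro card_Un_disjoint) (auto simp: image_iff, metis snd_conv)
  also have "card (shift ` D) = N"
    using card_image[OF inj_on_subset[OF inj_shift subset_UNIV], of D]
    by (simp add: card_young_diagram N_def)
  also have "card ((\<lambda>i. (i, c)) ` {..<d}) = d"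
    by (subst card_image) (auto simp: inj_on_def)
  finally show ?thesis
    by (simp add: card_young_diagram)
qed

lemma t'_column_image: "t' ` (\<lambda>i. (i, c)) ` {..<d} = {N + 1..N + d}"
proof (intro set_eqI iffI)
  fix y assume "y \<in> {N + 1..N + d}"
  then have "y = t' (y - N - 1, c)" "y - N - 1 < d"
    by (auto simp: t'_column)
  then show "y \<in> t' ` (\<lambda>i. (i, c)) ` {..<d}"
    by blast
qed (auto simp: t'_column)

lemma t'_tableau: "tableau \<mu>' t'"
proof -
  have "bij_betw t' (shift ` D) {1..N}"
  proof (rule bij_betw_imageI)
    show "inj_on t' (shift ` D)"
      using tableau_eq_iff[OF t] by (auto simp: inj_on_def t'_shift)
    show "t' ` shift ` D = {1..N}"
      using t by (simp add: image_image t'_shift tableau_def bij_betw_def N_def)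
  qed
  moreover have "bij_betw t' ((\<lambda>i. (i, c)) ` {..<d}) {N + 1..N + d}"
  proof (rule bij_betw_imageI)
    show "inj_on t' ((\<lambda>i. (i, c)) ` {..<d})"
      by (auto simp: inj_on_def t'_column)
    show "t' ` (\<lambda>i. (i, c)) ` {..<d} = {N + 1..N + d}"
      by (rule t'_column_image)
  qed
  ultimately have "bij_betw t' D' ({1..N} \<union> {N + 1..N + d})"
    unfolding D'_eq by (rule bij_betw_combine) auto
  moreover have "{1..N} \<union> {N + 1..N + d} = {1..sum_list \<mu>'}"
    by (auto simp: sum_\<mu>')
  ultimately show ?thesis
    by (simp add: tableau_def)
qed

lemma tabloid_t': "tabloid \<mu>' t' i = tabloid \<mu> t i \<union> (if i < d then {N + 1 + i} else {})"
proof -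
  have "{x \<in> D'. fst x = i} = shift ` {x \<in> D. fst x = i} \<union> (if i < d then {(i, c)} else {})"
    unfolding D'_eq by (auto simp: fst_shift)
  then show ?thesis
    by (simp add: tabloid_def image_Un image_image t'_shift t'_column)
qed

lemma tabloid_subset: "tabloid \<mu> t i \<subseteq> {1..N}"
  using tableau_in[OF t] by (auto simp: tabloid_def N_def)

lemma column_stabilizer_subset: "column_stabilizer \<mu> t \<subseteq> column_stabilizer \<mu>' t'"
proof
  fix \<pi> assume \<pi>: "\<pi> \<in> column_stabilizer \<mu> t"
  then have p: "\<pi> permutes {1..N}"
    by (simp add: column_stabilizer_def N_def)
  show "\<pi> \<in> column_stabilizer \<mu>' t'"
    unfolding column_stabilizer_iff[OF t'_tableau]
  proof (intro conjI ballI)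
    show "\<pi> permutes {1..sum_list \<mu>'}"
      by (rule permutes_subset[OF p]) (simp add: sum_\<mu>')
    fix x assume "x \<in> D'"
    then show "\<exists>x'\<in>D'. \<pi> (t' x) = t' x' \<and> snd x' = snd x"
    proof (cases rule: D'_cases)
      case (1 y)
      then obtain y' where "y' \<in> D" "\<pi> (t y) = t y'" "snd y' = snd y"
        using \<pi> unfolding column_stabilizer_iff[OF t] by blast
      then show ?thesis
        using 1 shift_in by (intro bexI[of _ "shift y'"]) (auto simp: t'_shift snd_shift_eq_iff)
    next
      case (2 i)
      then have "\<pi> (t' x) = t' x"
        using permutes_not_in[OF p] by (simp add: t'_column)
      then show ?thesis
        using \<open>x \<in> D'\<close> by blast
    qed
  qed
qed

lemma column_perm_in:
  assumes \<pi>: "\<pi> permutes {N + 1..N + d}"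
  shows "\<pi> \<in> column_stabilizer \<mu>' t'"
  unfolding column_stabilizer_iff[OF t'_tableau]
proof (intro conjI ballI)
  show "\<pi> permutes {1..sum_list \<mu>'}"
    by (rule permutes_subset[OF \<pi>]) (auto simp: sum_\<mu>')
  fix x assume "x \<in> D'"
  then show "\<exists>x'\<in>D'. \<pi> (t' x) = t' x' \<and> snd x' = snd x"
  proof (cases rule: D'_cases)
    case (1 y)
    then have "\<pi> (t' x) = t' x"
      using permutes_not_in[OF \<pi>] tableau_in[OF t 1(1)] by (simp add: t'_shift N_def)
    then show ?thesis
      using \<open>x \<in> D'\<close> by blast
  next
    case (2 i)
    then have "\<pi> (t' x) \<in> {N + 1..N + d}"
      using permutes_in_image[OF \<pi>] by (simp add: t'_column)
    then have "\<pi> (t' x) = t' (\<pi> (t' x) - N - 1, c)" "\<pi> (t' x) - N - 1 < d"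
      by (auto simp: t'_column)
    then show ?thesis
      using 2 column_in by (metis snd_conv)
  qed
qed

lemma column_stabilizer_restrict:
  assumes \<pi>: "\<pi> \<in> column_stabilizer \<mu>' t'" and p: "\<pi>' permutes {1..N}"
    and eq: "\<And>x. x \<in> {1..N} \<Longrightarrow> \<pi>' x = \<pi> x"
  shows "\<pi>' \<in> column_stabilizer \<mu> t"
  unfolding column_stabilizer_iff[OF t]
proof (intro conjI ballI)
  show "\<pi>' permutes {1..sum_list \<mu>}"
    using p by (simp add: N_def)
  fix y assume y: "y \<in> D"
  then obtain x' where x': "x' \<in> D'" "\<pi> (t' (shift y)) = t' x'" "snd x' = snd (shift y)"
    using \<pi> shift_in unfolding column_stabilizer_iff[OF t'_tableau] by blast
  have eqy: "\<pi>' (t y) = \<pi> (t' (shift y))"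
    using eq[of "t y"] tableau_in[OF t y] by (simp add: t'_shift N_def)
  from x'(1) show "\<exists>y'\<in>D. \<pi>' (t y) = t y' \<and> snd y' = snd y"
  proof (cases rule: D'_cases)
    case (1 y')
    then show ?thesis
      using x' eqy by (auto simp: t'_shift snd_shift_eq_iff)
  next
    case (2 i)
    then show ?thesis
      using x'(3) snd_shift_neq[of y] by simp
  qed
qed

lemma column_image:
  assumes "\<pi> \<in> column_stabilizer \<mu>' t'"
  shows "\<pi> ` {N + 1..N + d} = {N + 1..N + d}"
proof -
  have "{x \<in> D'. snd x = c} = (\<lambda>i. (i, c)) ` {..<d}"
  proof (intro set_eqI iffI)
    fix x assume x: "x \<in> {x \<in> D'. snd x = c}"
    then have "x \<in> D'"
      by blast
    then show "x \<in> (\<lambda>i. (i, c)) ` {..<d}"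
      using x by (cases rule: D'_cases) (auto simp: snd_shift_neq)
  qed (auto simp: column_in)
  moreover have "t' ` (\<lambda>i. (i, c)) ` {..<d} = {N + 1..N + d}"
    by (rule t'_column_image)
  ultimately have "t' ` {x \<in> D'. snd x = c} = {N + 1..N + d}"
    by simp
  then show ?thesis
    using assms unfolding column_stabilizer_def by (metis (mono_tags, lifting) mem_Collect_eq)
qed

text \<open>The columns of \<open>t'\<close> are those of \<open>t\<close> together with the new
  one, which is disjoint from them. A column permutation splits accordingly, so antisymmetrizing for
  \<open>t'\<close> is antisymmetrizing for \<open>t\<close> and then over the new points.\<close>

lemma column_stabilizer_product:
  "bij_betw (\<lambda>(\<sigma>, \<pi>). \<sigma> \<circ> \<pi>) ({\<sigma>. \<sigma> permutes {N + 1..N + d}} \<times> column_stabilizer \<mu> t)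
    (column_stabilizer \<mu>' t')"
proof (rule bij_betw_imageI)
  have perm: "\<pi> permutes {1..N}" if "\<pi> \<in> column_stabilizer \<mu> t" for \<pi>
    using that by (simp add: column_stabilizer_def N_def)
  show "inj_on (\<lambda>(\<sigma>, \<pi>). \<sigma> \<circ> \<pi>) ({\<sigma>. \<sigma> permutes {N + 1..N + d}} \<times> column_stabilizer \<mu> t)"
  proof (rule inj_onI; clarify)
    fix \<sigma> \<pi> \<sigma>' \<pi>'
    assume s: "\<sigma> permutes {N + 1..N + d}" "\<sigma>' permutes {N + 1..N + d}"
      and p: "\<pi> \<in> column_stabilizer \<mu> t" "\<pi>' \<in> column_stabilizer \<mu> t"
      and eq: "\<sigma> \<circ> \<pi> = \<sigma>' \<circ> \<pi>'"
    have "\<pi> x = \<pi>' x" for x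
    proof (cases "x \<in> {1..N}")
      case True
      then have "\<pi> x \<notin> {N + 1..N + d}" "\<pi>' x \<notin> {N + 1..N + d}"
        using permutes_in_image[OF perm[OF p(1)], of x] permutes_in_image[OF perm[OF p(2)], of x] by auto
      then show ?thesis
        using fun_cong[OF eq, of x] permutes_not_in[OF s(1)] permutes_not_in[OF s(2)] by simp
    next
      case False
      then show ?thesis
        using permutes_not_in[OF perm[OF p(1)]] permutes_not_in[OF perm[OF p(2)]] by simp
    qed
    then have "\<pi> = \<pi>'"
      by blast
    moreover have "\<sigma> = \<sigma> \<circ> \<pi> \<circ> inv \<pi>"
      using permutes_inv_o(1)[OF perm[OF p(1)]] by (simp flip: o_assoc)
    moreover have "\<sigma>' = \<sigma>' \<circ> \<pi>' \<circ> inv \<pi>'"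
      using permutes_inv_o(1)[OF perm[OF p(2)]] by (simp flip: o_assoc)
    ultimately show "\<sigma> = \<sigma>' \<and> \<pi> = \<pi>'"
      using eq by metis
  qed
  show "(\<lambda>(\<sigma>, \<pi>). \<sigma> \<circ> \<pi>) ` ({\<sigma>. \<sigma> permutes {N + 1..N + d}} \<times> column_stabilizer \<mu> t) =
      column_stabilizer \<mu>' t'"
  proof (intro set_eqI iffI)
    fix \<pi> assume "\<pi> \<in> (\<lambda>(\<sigma>, \<pi>). \<sigma> \<circ> \<pi>) ` ({\<sigma>. \<sigma> permutes {N + 1..N + d}} \<times> column_stabilizer \<mu> t)"
    then show "\<pi> \<in> column_stabilizer \<mu>' t'"
      using column_perm_in column_stabilizer_subset
        perm_subgroupD(3)[OF perm_subgroup_column_stabilizer[of \<mu>' t']] by auto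
  next
    fix \<pi> assume \<pi>: "\<pi> \<in> column_stabilizer \<mu>' t'"
    then have p: "\<pi> permutes {1..N + d}"
      by (simp add: column_stabilizer_def sum_\<mu>')
    note inj = permutes_inj_on[OF p]
    have im: "\<pi> ` {N + 1..N + d} = {N + 1..N + d}"
      by (rule column_image[OF \<pi>])
    have split: "{1..N} = {1..N + d} - {N + 1..N + d}"
      by auto
    have im': "\<pi> ` {1..N} = {1..N}"
      unfolding split using inj_on_image_set_diff[OF inj[of UNIV], of "{1..N + d}" "{N + 1..N + d}"]
        permutes_image[OF p] im by simp
    define \<sigma> where "\<sigma> x = (if x \<in> {N + 1..N + d} then \<pi> x else x)" for x
    define \<pi>1 where "\<pi>1 x = (if x \<in> {1..N} then \<pi> x else x)" for x
    have "bij_betw \<sigma> {N + 1..N + d} {N + 1..N + d}"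
      using inj im by (intro bij_betw_cong[THEN iffD1, OF _ bij_betw_imageI[of \<pi>]]) (auto simp: \<sigma>_def)
    then have \<sigma>: "\<sigma> permutes {N + 1..N + d}"
      by (rule bij_imp_permutes) (simp only: \<sigma>_def if_False)
    have "bij_betw \<pi>1 {1..N} {1..N}"
      using inj im' by (intro bij_betw_cong[THEN iffD1, OF _ bij_betw_imageI[of \<pi>]]) (auto simp: \<pi>1_def)
    then have "\<pi>1 permutes {1..N}"
      by (rule bij_imp_permutes) (simp only: \<pi>1_def if_False)
    then have \<pi>1: "\<pi>1 \<in> column_stabilizer \<mu> t"
      using \<pi> by (intro column_stabilizer_restrict) (auto simp: \<pi>1_def)
    have "\<pi> = \<sigma> \<circ> \<pi>1"
    proof
      fix x
      consider "x \<in> {1..N}" | "x \<in> {N + 1..N + d}" | "x \<notin> {1..N + d}"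
        by force
      then show "\<pi> x = (\<sigma> \<circ> \<pi>1) x"
      proof cases
        case 1
        then have "\<pi> x \<in> {1..N}"
          using im' by blast
        then show ?thesis
          using 1 by (simp add: \<sigma>_def \<pi>1_def)
      next
        case 2
        then show ?thesis
          by (simp add: \<sigma>_def \<pi>1_def)
      next
        case 3
        then show ?thesis
          using permutes_not_in[OF p] by (auto simp: \<sigma>_def \<pi>1_def)
      qed
    qed
    then show "\<pi> \<in> (\<lambda>(\<sigma>, \<pi>). \<sigma> \<circ> \<pi>) ` ({\<sigma>. \<sigma> permutes {N + 1..N + d}} \<times> column_stabilizer \<mu> t)"
      using \<sigma> \<pi>1 by auto
  qed
qed

text \<open>Keeps the coefficients of those tabloids in which N + 1 + i lies in row \<open>i\<close>
  for all i < d, and forgets these entries. The value 0 elsewhere makes sure that only tabloids with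
  entries up to \<open>N\<close> remain. The forgotten entries are fixed by permutations of the
  others, so the map is equivariant for these.\<close>

definition delete_column :: "((nat \<Rightarrow> nat set) \<Rightarrow> 'k::field) \<Rightarrow> (nat \<Rightarrow> nat set) \<Rightarrow> 'k" where
  "delete_column v T = (if \<forall>i. T i \<subseteq> {1..N}
    then v (\<lambda>i. T i \<union> (if i < d then {N + 1 + i} else {})) else 0)"

lemma delete_column_act:
  assumes \<sigma>: "\<sigma> permutes {1..N}"
  shows "delete_column (tabloid_act \<sigma> v) = tabloid_act \<sigma> (delete_column v)"
proof
  fix T :: "nat \<Rightarrow> nat set"
  have inv: "inv \<sigma> permutes {1..N}"
    by (rule permutes_inv[OF \<sigma>])
  have "inv \<sigma> ` T i \<subseteq> {1..N} \<longleftrightarrow> T i \<subseteq> {1..N}" for i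
    using permutes_in_image[OF inv] by (auto simp del: atLeastAtMost_iff)
  moreover have "inv \<sigma> ` (if i < d then {N + 1 + i} else {}) = (if i < d then {N + 1 + i} else {})" for i
    using permutes_not_in[OF inv, of "N + 1 + i"] by simp
  ultimately show "delete_column (tabloid_act \<sigma> v) T = tabloid_act \<sigma> (delete_column v) T"
    by (simp add: delete_column_def tabloid_act_def image_Un)
qed

text \<open>If a column permutation of \<open>t'\<close> leaves every new entry in its row, it
  leaves it in its cell, as the column is kept anyway. So the surviving terms are exactly those of
  the column permutations of \<open>t\<close>, with the same signs.\<close>

lemma delete_column_polytabloid:
  "delete_column (polytabloid \<mu>' t') = (polytabloid \<mu> t :: _ \<Rightarrow> 'k::field)"
proof
  fix T :: "nat \<Rightarrow> nat set"
  have perm: "\<pi> permutes {1..N}" if "\<pi> \<in> column_stabilizer \<mu> t" for \<pi>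
    using that by (simp add: column_stabilizer_def N_def)
  have sub: "tabloid \<mu> (\<pi> \<circ> t) i \<subseteq> {1..N}" if "\<pi> \<in> column_stabilizer \<mu> t" for \<pi> i
    using tabloid_subset[of i] permutes_image[OF perm[OF that]] unfolding tabloid_comp by blast
  define T' where "T' i = T i \<union> (if i < d then {N + 1 + i} else {})" for i
  show "delete_column (polytabloid \<mu>' t') T = (polytabloid \<mu> t T :: 'k)"
  proof (cases "\<forall>i. T i \<subseteq> {1..N}")
    case False
    then have "tabloid \<mu> (\<pi> \<circ> t) \<noteq> T" if "\<pi> \<in> column_stabilizer \<mu> t" for \<pi>
      using sub[OF that] by blast
    then show ?thesis
      unfolding delete_column_def if_not_P[OF False] polytabloid_def by simp
  next
    case True
    have iff: "tabloid \<mu>' (\<pi> \<circ> t') = T' \<longleftrightarrow> tabloid \<mu> (\<pi> \<circ> t) = T" if \<pi>: "\<pi> \<in> column_stabilizer \<mu> t" for \<pi>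
    proof -
      have eq: "tabloid \<mu>' (\<pi> \<circ> t') i = tabloid \<mu> (\<pi> \<circ> t) i \<union> (if i < d then {N + 1 + i} else {})" for i
        using permutes_not_in[OF perm[OF \<pi>], of "N + 1 + i"] by (simp add: tabloid_comp tabloid_t' image_Un)
      have "tabloid \<mu>' (\<pi> \<circ> t') i = T' i \<longleftrightarrow> tabloid \<mu> (\<pi> \<circ> t) i = T i" for i
      proof -
        have "N + 1 + i \<notin> T i" "N + 1 + i \<notin> tabloid \<mu> (\<pi> \<circ> t) i"
          using True sub[OF \<pi>] by fastforce+
        then show ?thesis
          unfolding eq T'_def by (simp add: insert_ident)
      qed
      then show ?thesis
        by (simp add: fun_eq_iff)
    qed
    have zero: "tabloid \<mu>' (\<pi> \<circ> t') \<noteq> T'"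
      if \<pi>: "\<pi> \<in> column_stabilizer \<mu>' t' - column_stabilizer \<mu> t" for \<pi>
    proof
      assume eq: "tabloid \<mu>' (\<pi> \<circ> t') = T'"
      have p: "\<pi> permutes {1..N + d}"
        using \<pi> by (simp add: column_stabilizer_def sum_\<mu>')
      have fixed: "\<pi> y = y" if y: "y \<in> {N + 1..N + d}" for y
      proof -
        define i where "i = y - N - 1"
        have i: "y = t' (i, c)" "i < d" "y = N + 1 + i"
          using y by (auto simp: t'_column i_def)
        have "y \<in> tabloid \<mu>' (\<pi> \<circ> t') i"
          unfolding eq T'_def using i by simp
        then obtain x where x: "x \<in> D'" "fst x = i" "y = \<pi> (t' x)"
          by (auto simp: tabloid_def)
        obtain x' where x': "x' \<in> D'" "\<pi> (t' x) = t' x'" "snd x' = snd x"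
          using bspec[OF conjunct2[OF iffD1[OF column_stabilizer_iff[OF t'_tableau] DiffD1[OF \<pi>]]] x(1)]
          by blast
        have "t' x' = t' (i, c)"
          using x(3) x'(2) i(1) by metis
        then have "x' = (i, c)"
          using tableau_eq_iff[OF t'_tableau x'(1) column_in[OF i(2)]] by simp
        then have "x = (i, c)"
          using x(2) x'(3) by (simp add: prod_eq_iff)
        then show ?thesis
          using x(3) i(1) by metis
      qed
      have "\<pi> permutes {1..N}"
      proof (rule permutes_superset[OF p])
        fix x assume "x \<in> {1..N + d} - {1..N}"
        then show "\<pi> x = x"
          by (intro fixed) auto
      qed
      then show False
        using \<pi> column_stabilizer_restrict by blast
    qed
    have "delete_column (polytabloid \<mu>' t') T = (polytabloid \<mu>' t' T' :: 'k)"
      using True by (simp add: delete_column_def T'_def[abs_def])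
    also have "\<dots> = (\<Sum>\<pi>\<in>column_stabilizer \<mu> t. if tabloid \<mu>' (\<pi> \<circ> t') = T' then of_int (sign \<pi>) else 0)"
      unfolding polytabloid_def using zero
      by (intro sum.mono_neutral_right column_stabilizer_subset
          perm_subgroupD(5)[OF perm_subgroup_column_stabilizer]) auto
    also have "\<dots> = polytabloid \<mu> t T"
      unfolding polytabloid_def using iff by (intro sum.cong) auto
    finally show ?thesis .
  qed
qed

text \<open>Pigeonhole: l + 1 disjoint columns of height \<open>d\<close> cannot all be met by at
  most \<open>l\<close> points.\<close>

lemma free_column:
  assumes "finite A" "card A \<le> l"
  obtains j where "c \<le> j" "\<And>i. i < d \<Longrightarrow> (i, j) \<in> D'" "\<And>i. i < d \<Longrightarrow> t' (i, j) \<notin> A"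
proof -
  have cells: "(i, j) \<in> D'" if "i < d" "j \<in> {c..c + l}" for i j
    using that len long[OF that(1)] by (auto simp: young_diagram_def)
  have "\<exists>j\<in>{c..c + l}. \<forall>i<d. t' (i, j) \<notin> A"
  proof (rule ccontr)
    assume "\<not> ?thesis"
    then obtain f where f: "\<And>j. j \<in> {c..c + l} \<Longrightarrow> f j < d \<and> t' (f j, j) \<in> A"
      by metis
    have "inj_on (\<lambda>j. t' (f j, j)) {c..c + l}"
    proof (rule inj_onI)
      fix j j' assume j: "j \<in> {c..c + l}" "j' \<in> {c..c + l}" "t' (f j, j) = t' (f j', j')"
      then have "(f j, j) = (f j', j')"
        using tableau_eq_iff[OF t'_tableau] cells f by blast
      then show "j = j'"
        by simp
    qed
    moreover have "(\<lambda>j. t' (f j, j)) ` {c..c + l} \<subseteq> A"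
      using f by blast
    ultimately have "card {c..c + l} \<le> card A"
      using assms(1) card_inj_on_le by blast
    then show False
      using assms(2) by simp
  qed
  then show ?thesis
    using that cells by auto
qed

lemma D'_long_column: "(i, j) \<in> D' \<Longrightarrow> c \<le> j \<Longrightarrow> i < d"
proof (rule ccontr)
  assume "(i, j) \<in> D'" "c \<le> j" "\<not> i < d"
  then show False
    using short[of i] len by (auto simp: young_diagram_def)
qed

text \<open>A column from \<open>c\<close> on has no cell in a row from \<open>d\<close> on, so
  \<open>g\<close> on its rows and the identity on the other columns give a bijection of the
  diagram. It serves to sort the colours in a column.\<close>

lemma permute_column:
  assumes j: "c \<le> j" "\<And>i. i < d \<Longrightarrow> (i, j) \<in> D'" and g: "bij_betw g {..<d} {..<d}"
  obtains \<pi> where "\<pi> \<in> column_stabilizer \<mu>' t'" "\<And>i. i < d \<Longrightarrow> \<pi> (t' (i, j)) = t' (g i, j)"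
proof -
  define \<beta> where "\<beta> = (\<lambda>(i, j'). if j' = j then (g i, j) else (i, j'))"
  have gd: "g i < d" if "i < d" for i
    using bij_betw_apply[OF g, of i] that by simp
  have in_D': "\<beta> x \<in> D'" if "x \<in> D'" for x
    using that j gd D'_long_column by (auto simp: \<beta>_def split: prod.split)
  have "inj_on \<beta> D'"
  proof (rule inj_onI)
    fix x y assume xy: "x \<in> D'" "y \<in> D'" "\<beta> x = \<beta> y"
    obtain i j1 i' j1' where e: "x = (i, j1)" "y = (i', j1')"
      by (cases x, cases y)
    show "x = y"
    proof (cases "j1 = j")
      case True
      then have "j1' = j" "g i = g i'" "i < d" "i' < d"
        using xy e j(1) D'_long_column by (auto simp: \<beta>_def split: if_splits)
      then show ?thesis
        using e True inj_onD[OF bij_betw_imp_inj_on[OF g], of i i'] by simp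
    next
      case False
      then show ?thesis
        using xy(3) e by (auto simp: \<beta>_def split: if_splits)
    qed
  qed
  then have bij: "bij_betw \<beta> D' D'"
    using in_D' finite_young_diagram[of \<mu>'] by (metis bij_betw_def endo_inj_surj image_subsetI)
  then obtain \<pi> where \<pi>: "\<pi> permutes {1..sum_list \<mu>'}" "\<forall>x\<in>D'. \<pi> (t' x) = t' (\<beta> x)"
    using tableau_permutation[OF t'_tableau tableau_cells[OF t'_tableau bij]] by auto
  have "snd (\<beta> x) = snd x" for x
    by (simp add: \<beta>_def split: prod.split)
  then have "\<pi> \<in> column_stabilizer \<mu>' t'"
    unfolding column_stabilizer_iff[OF t'_tableau] using \<pi> in_D' by blast
  moreover have "\<pi> (t' (i, j)) = t' (g i, j)" if "i < d" for i
    using \<pi>(2) j(2)[OF that] by (simp add: \<beta>_def)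
  ultimately show ?thesis
    by (rule that)
qed

text \<open>Columns \<open>j\<close> and \<open>c\<close> both have exactly \<open>d\<close> cells,
  so exchanging them is a bijection of the diagram that preserves each row and the set of all
  columns. Hence the polytabloid does not change.\<close>

lemma swap_columns:
  assumes j: "c \<le> j" "\<And>i. i < d \<Longrightarrow> (i, j) \<in> D'"
  obtains \<tau> where "\<tau> permutes {1..N + d}" "\<And>i. i < d \<Longrightarrow> \<tau> (t' (i, j)) = N + 1 + i"
    "column_stabilizer \<mu>' (\<tau> \<circ> t') = column_stabilizer \<mu>' t'" "tabloid \<mu>' (\<tau> \<circ> t') = tabloid \<mu>' t'"
proof -
  define \<beta> where "\<beta> = (\<lambda>(i::nat, j'). (i, transpose j c j'))"
  have in_D': "\<beta> x \<in> D'" if "x \<in> D'" for x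
  proof -
    obtain i j' where x: "x = (i, j')"
      by fastforce
    consider "j' = j" | "j' = c" | "j' \<noteq> j" "j' \<noteq> c"
      by blast
    then show ?thesis
      using that x j D'_long_column[of i j'] column_in by cases (auto simp: \<beta>_def)
  qed
  have invol: "\<beta> (\<beta> x) = x" for x
    by (simp add: \<beta>_def split: prod.split)
  have bij: "bij_betw \<beta> D' D'"
    using in_D' invol by (intro bij_betwI[of _ _ _ \<beta>]) auto
  then obtain \<tau> where \<tau>: "\<tau> permutes {1..sum_list \<mu>'}" "\<forall>x\<in>D'. \<tau> (t' x) = t' (\<beta> x)"
    using tableau_permutation[OF t'_tableau tableau_cells[OF t'_tableau bij]] by auto
  have image: "(\<tau> \<circ> t') ` {x \<in> D'. Q x} = t' ` {x \<in> D'. Q (\<beta> x)}" for Q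
  proof -
    have "(\<tau> \<circ> t') ` {x \<in> D'. Q x} = t' ` \<beta> ` {x \<in> D'. Q x}"
      unfolding image_image using \<tau>(2) by (intro image_cong) auto
    also have "\<beta> ` {x \<in> D'. Q x} = {x \<in> D'. Q (\<beta> x)}"
    proof (intro set_eqI iffI)
      fix x assume "x \<in> {x \<in> D'. Q (\<beta> x)}"
      then show "x \<in> \<beta> ` {x \<in> D'. Q x}"
        using in_D' invol[of x] by (intro image_eqI[of _ _ "\<beta> x"]) auto
    qed (use in_D' invol in auto)
    finally show ?thesis .
  qed
  have "snd (\<beta> x) = j' \<longleftrightarrow> snd x = transpose j c j'" for x j'
    by (cases x) (auto simp: \<beta>_def)
  then have col: "(\<tau> \<circ> t') ` {x \<in> D'. snd x = j'} = t' ` {x \<in> D'. snd x = transpose j c j'}" for j'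
    using image[of "\<lambda>x. snd x = j'"] by simp
  have reindex: "(\<forall>j'. Q (transpose j c j')) \<longleftrightarrow> (\<forall>j'. Q j')" for Q
    by (metis transpose_involutory)
  have "(\<forall>j'. \<pi> ` (\<tau> \<circ> t') ` {x \<in> D'. snd x = j'} = (\<tau> \<circ> t') ` {x \<in> D'. snd x = j'}) \<longleftrightarrow>
      (\<forall>j'. \<pi> ` t' ` {x \<in> D'. snd x = j'} = t' ` {x \<in> D'. snd x = j'})" for \<pi>
    unfolding col by (rule reindex)
  then have "column_stabilizer \<mu>' (\<tau> \<circ> t') = column_stabilizer \<mu>' t'"
    unfolding column_stabilizer_def by (simp only:)
  moreover have "tabloid \<mu>' (\<tau> \<circ> t') = tabloid \<mu>' t'"
  proof
    fix i
    have "fst (\<beta> x) = fst x" for x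
      by (simp add: \<beta>_def split: prod.split)
    then show "tabloid \<mu>' (\<tau> \<circ> t') i = tabloid \<mu>' t' i"
      using image[of "\<lambda>x. fst x = i"] by (simp add: tabloid_def)
  qed
  moreover have "\<tau> (t' (i, j)) = N + 1 + i" if "i < d" for i
    using \<tau>(2) j(2)[OF that] by (simp add: \<beta>_def t'_column)
  ultimately show ?thesis
    using \<tau>(1) by (intro that) (auto simp: sum_\<mu>')
qed

end

section \<open>Monotonicity of multiplicities\<close>

lemma subspace_hom_space:
  assumes "sym_rep s n \<rho> U" "sym_rep s' n \<rho>' U'"
  shows "module.subspace (hom_scale s') (hom_space n s \<rho> U s' \<rho>' U')"
proof -
  interpret U: sym_rep s n \<rho> U by fact
  interpret U': sym_rep s' n \<rho>' U' by fact
  interpret H: vector_space "hom_scale s'"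
    by (rule vector_space_hom_scale[OF U'.vector_space_axioms])
  have "\<rho>' \<sigma> 0 = 0" if "\<sigma> permutes {1..n}" for \<sigma>
    by (rule linear_on_zero[OF U'.rho_linear[OF that] U'.subspace_U U'.vector_space_axioms
          U'.vector_space_axioms])
  then have "0 \<in> hom_space n s \<rho> U s' \<rho>' U'"
    using U'.subspace_0[OF U'.subspace_U] by (auto simp: hom_space_def linear_on_def)
  moreover have "f + g \<in> hom_space n s \<rho> U s' \<rho>' U'"
    if "f \<in> hom_space n s \<rho> U s' \<rho>' U'" "g \<in> hom_space n s \<rho> U s' \<rho>' U'" for f g
    using that U'.subspace_add[OF U'.subspace_U] U'.rho_add
    by (auto simp: hom_space_def linear_on_def U'.scale_right_distrib)
  moreover have "hom_scale s' c f \<in> hom_space n s \<rho> U s' \<rho>' U'"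
    if "f \<in> hom_space n s \<rho> U s' \<rho>' U'" for c f
    using that U'.subspace_scale[OF U'.subspace_U] U'.rho_scale
    by (auto simp: hom_space_def linear_on_def hom_scale_def U'.scale_right_distrib mult.commute)
  ultimately show ?thesis
    by (auto simp: H.subspace_def)
qed

lemma card_le_of_injective:
  assumes s1: "vector_space s1" and s2: "vector_space s2" and X: "module.subspace s1 X"
    and f: "linear_on s1 s2 X f" "\<And>x. x \<in> X \<Longrightarrow> f x = 0 \<Longrightarrow> x = 0"
    and A: "finite A" "A \<subseteq> X" "module.independent s1 A"
    and B: "finite B" "f ` X \<subseteq> module.span s2 B"
  shows "card A \<le> card B"
proof -
  interpret V1: vector_space s1 by fact
  interpret V2: vector_space s2 by fact
  have inj: "inj_on f X"
  proof (rule inj_onI)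
    fix x y assume "x \<in> X" "y \<in> X" "f x = f y"
    then show "x = y"
      using f(2)[of "x - y"] linear_on_diff[OF f(1) X s1] V1.subspace_diff[OF X] by simp
  qed
  have "V2.independent (f ` A)"
  proof (rule V2.independent_if_scalars_zero)
    fix u y assume sum: "(\<Sum>y\<in>f ` A. s2 (u y) y) = 0" and y: "y \<in> f ` A"
    have "f (\<Sum>a\<in>A. s1 (u (f a)) a) = (\<Sum>a\<in>A. f (s1 (u (f a)) a))"
      using A(2) by (intro linear_on_sum[OF f(1) X s1 s2] V1.subspace_scale[OF X]) auto
    also have "\<dots> = (\<Sum>a\<in>A. s2 (u (f a)) (f a))"
      using f(1) A(2) by (intro sum.cong) (auto simp: linear_on_def)
    also have "\<dots> = 0"
      using sum by (simp add: sum.reindex[OF inj_on_subset[OF inj A(2)]])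
    finally have "(\<Sum>a\<in>A. s1 (u (f a)) a) = 0"
      using A(2) by (intro f(2) V1.subspace_sum[OF X] V1.subspace_scale[OF X]) auto
    then have "\<forall>a\<in>A. u (f a) = 0"
      using V1.independentD[OF A(3,1) order_refl, of "\<lambda>a. u (f a)"] by blast
    then show "u y = 0"
      using y by auto
  qed (use A(1) in simp)
  then have "card (f ` A) \<le> card B"
    using V2.independent_span_bound[OF B(1), of "f ` A"] A(2) B(2) by blast
  then show ?thesis
    by (simp add: card_image[OF inj_on_subset[OF inj A(2)]])
qed

lemma specht_multiplicity_basis:
  fixes s :: "'k::field_char_0 \<Rightarrow> 'v::ab_group_add \<Rightarrow> 'v"
  assumes "sorted_wrt (\<ge>) \<mu>" "sym_rep s (sum_list \<mu>) \<rho> U" "finite_dimensional s U"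
  shows "\<exists>B. finite B \<and> B \<subseteq> hom_space (sum_list \<mu>) s \<rho> U fun_scale tabloid_act (specht \<mu>) \<and>
    module.independent (hom_scale fun_scale) B \<and>
    hom_space (sum_list \<mu>) s \<rho> U fun_scale tabloid_act (specht \<mu>) \<subseteq> module.span (hom_scale fun_scale) B \<and>
    card B = specht_multiplicity \<mu> s \<rho> U"
  unfolding specht_multiplicity_def
  by (rule sym_rep.rep_multiplicity_basis[OF assms(2) sym_rep_specht irreducible_specht[OF assms(1)]
        specht_endomorphism[OF assms(1)] assms(3)])

locale FI_module_char_0 = FI_module scale d V act
  for scale :: "'k::field_char_0 \<Rightarrow> 'v::ab_group_add \<Rightarrow> 'v" and d V act
begin

lemma sym_rep_V: "sym_rep scale n (perm_act act n) (V n)"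
proof
  show "subspace (V n)"
    by (rule subspace_V)
  fix \<sigma> \<tau> x
  show "perm_act act n \<sigma> x \<in> V n" if "\<sigma> permutes {1..n}" "x \<in> V n"
    unfolding perm_act_def by (rule act_in[OF FI_perm_in_hom[OF that(1)] that(2)])
  show "linear_on scale scale (V n) (perm_act act n \<sigma>)" if "\<sigma> permutes {1..n}"
    unfolding perm_act_def by (rule act_linear[OF FI_perm_in_hom[OF that]])
  show "perm_act act n id x = x" if "x \<in> V n"
    unfolding perm_act_def FI_perm_id by (rule act_id[OF that])
  show "perm_act act n (\<sigma> \<circ> \<tau>) x = perm_act act n \<sigma> (perm_act act n \<tau> x)"
    if "\<sigma> permutes {1..n}" "\<tau> permutes {1..n}" "x \<in> V n"
    unfolding perm_act_def FI_comp_perm_perm[OF that(1,2), symmetric]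
    by (rule act_comp[OF FI_perm_in_hom[OF that(1)] FI_perm_in_hom[OF that(2)] that(3)])
qed

end

text \<open>The same \<open>l\<close> bounds the degrees of the generators and counts the columns:
  the image of a morphism applied to a generator has at most \<open>l\<close> points and misses one
  of the l + 1 columns of height \<open>d\<close>.\<close>

locale FI_column_insertion =
  FI_module_char_0 scale d V act + column_insertion \<mu> \<mu>' d c l t
  for scale :: "'k::field_char_0 \<Rightarrow> 'v::ab_group_add \<Rightarrow> 'v" and d V act \<mu> \<mu>' c l t +
  fixes S :: "(nat \<times> 'v) set"
  assumes S: "S \<subseteq> Sigma UNIV V"
    and gen: "V n = span {act m n \<alpha> x |m x \<alpha>. (m, x) \<in> S \<and> \<alpha> \<in> FI_hom d m n}"
    and deg: "(m, x) \<in> S \<Longrightarrow> m \<le> l"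
begin

abbreviation "\<rho> \<equiv> perm_act act N"
abbreviation "\<rho>' \<equiv> perm_act act (N + d)"
abbreviation "C \<equiv> column_stabilizer \<mu> t"
abbreviation "C' \<equiv> column_stabilizer \<mu>' t'"
abbreviation "K \<equiv> {\<sigma>. \<sigma> permutes {N + 1..N + d}}"
abbreviation "\<kappa> \<equiv> alternator scale \<rho>' K"
abbreviation "\<kappa>' \<equiv> alternator scale \<rho>' C'"
abbreviation "specht' \<equiv> specht \<mu>' :: ((nat \<Rightarrow> nat set) \<Rightarrow> 'k) set"
abbreviation "e' \<equiv> polytabloid \<mu>' t' :: (nat \<Rightarrow> nat set) \<Rightarrow> 'k"
abbreviation "Hom' \<equiv> hom_space (N + d) scale \<rho>' (V (N + d)) fun_scale tabloid_act specht'"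

definition "iota = act N (N + d) (FI_block d N)"

sublocale small: sym_rep scale N \<rho> "V N"
  by (rule sym_rep_V)

sublocale big: sym_rep scale "N + d" \<rho>' "V (N + d)"
  by (rule sym_rep_V)

lemma sym_rep_specht': "sym_rep fun_scale (N + d) tabloid_act specht'"
  using sym_rep_specht[of \<mu>'] by (simp add: sum_\<mu>')

lemma C_perm: "\<pi> \<in> C \<Longrightarrow> \<pi> permutes {1..N}" "\<pi> \<in> C \<Longrightarrow> \<pi> permutes {1..N + d}"
  and C'_perm: "\<pi> \<in> C' \<Longrightarrow> \<pi> permutes {1..N + d}"
  and K_perm: "\<pi> \<in> K \<Longrightarrow> \<pi> permutes {1..N + d}"
proof -
  show C': "\<pi> permutes {1..N + d}" if "\<pi> \<in> C'" for \<pi>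
    using that by (simp add: column_stabilizer_def sum_\<mu>')
  show "\<pi> \<in> C \<Longrightarrow> \<pi> permutes {1..N}"
    by (simp add: column_stabilizer_def N_def)
  show "\<pi> \<in> C \<Longrightarrow> \<pi> permutes {1..N + d}"
    using C' column_stabilizer_subset by blast
  show "\<pi> \<in> K \<Longrightarrow> \<pi> permutes {1..N + d}"
    using C' column_perm_in by blast
qed

lemma C'_group: "perm_subgroup (N + d) C'"
  using perm_subgroup_column_stabilizer[of \<mu>' t'] by (simp add: sum_\<mu>')

lemma iota_in: "y \<in> V N \<Longrightarrow> iota y \<in> V (N + d)"
  unfolding iota_def by (rule act_in[OF FI_block_in_hom])

lemma iota_perm:
  assumes \<sigma>: "\<sigma> permutes {1..N}" and y: "y \<in> V N"
  shows "iota (\<rho> \<sigma> y) = \<rho>' \<sigma> (iota y)"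
proof -
  have \<sigma>': "\<sigma> permutes {1..N + d}"
    by (rule permutes_subset[OF \<sigma>]) auto
  show ?thesis
    unfolding iota_def perm_act_def act_comp[OF FI_block_in_hom FI_perm_in_hom[OF \<sigma>] y, symmetric]
      act_comp[OF FI_perm_in_hom[OF \<sigma>'] FI_block_in_hom y, symmetric] FI_block_perm[OF \<sigma>] ..
qed

lemma iota_alternator:
  assumes y: "y \<in> V N"
  shows "iota (alternator scale \<rho> C y) = alternator scale \<rho>' C (iota y)"
proof -
  have lin: "linear_on scale scale (V N) iota"
    unfolding iota_def by (rule act_linear[OF FI_block_in_hom])
  have "iota (alternator scale \<rho> C y) = (\<Sum>\<pi>\<in>C. iota (scale (of_int (sign \<pi>)) (\<rho> \<pi> y)))"
    unfolding alternator_def using small.rho_in[OF C_perm(1) y]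
    by (intro linear_on_sum[OF lin subspace_V vector_space_axioms vector_space_axioms]
        subspace_scale[OF subspace_V])
  also have "\<dots> = alternator scale \<rho>' C (iota y)"
    unfolding alternator_def
  proof (rule sum.cong)
    fix \<pi> assume "\<pi> \<in> C"
    then show "iota (scale (of_int (sign \<pi>)) (\<rho> \<pi> y)) = scale (of_int (sign \<pi>)) (\<rho>' \<pi> (iota y))"
      using lin small.rho_in[OF C_perm(1) y] iota_perm[OF C_perm(1) y] by (simp add: linear_on_def)
  qed simp
  finally show ?thesis .
qed

text \<open>The factorization of the column stabilizer of \<open>t'\<close> into \<open>K\<close>
  and \<open>C\<close>. Together with \<open>iota_alternator\<close> it expresses \<kappa>' of an
  inserted vector by \<kappa> of the insertion of a vector antisymmetrized in degree
  \<open>N\<close>.\<close>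

lemma alternator_product:
  assumes u: "u \<in> V (N + d)"
  shows "\<kappa>' u = \<kappa> (alternator scale \<rho>' C u)"
proof -
  let ?f = "\<lambda>\<pi>. scale (of_int (sign \<pi>)) (\<rho>' \<pi> u)"
  have "\<kappa>' u = (\<Sum>p\<in>K \<times> C. ?f (case p of (\<sigma>, \<pi>) \<Rightarrow> \<sigma> \<circ> \<pi>))"
    unfolding alternator_def by (rule sum.reindex_bij_betw[OF column_stabilizer_product, symmetric])
  also have "\<dots> = (\<Sum>\<sigma>\<in>K. \<Sum>\<pi>\<in>C. ?f (\<sigma> \<circ> \<pi>))"
    by (simp add: sum.cartesian_product case_prod_unfold)
  also have "\<dots> = \<kappa> (alternator scale \<rho>' C u)"
    unfolding alternator_def[of _ _ K]
  proof (rule sum.cong)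
    fix \<sigma> assume "\<sigma> \<in> K"
    note \<sigma> = K_perm[OF this]
    have A: "\<rho>' \<sigma> (alternator scale \<rho>' C u) = (\<Sum>\<pi>\<in>C. \<rho>' \<sigma> (?f \<pi>))"
      unfolding alternator_def using big.rho_in[OF C_perm(2) u]
      by (intro big.rho_sum[OF \<sigma>] subspace_scale[OF subspace_V])
    have B: "scale (of_int (sign \<sigma>)) (\<Sum>\<pi>\<in>C. \<rho>' \<sigma> (?f \<pi>)) = (\<Sum>\<pi>\<in>C. ?f (\<sigma> \<circ> \<pi>))"
      unfolding scale_sum_right
    proof (rule sum.cong)
      fix \<pi> assume "\<pi> \<in> C"
      note \<pi> = C_perm(2)[OF this]
      show "scale (of_int (sign \<sigma>)) (\<rho>' \<sigma> (?f \<pi>)) = ?f (\<sigma> \<circ> \<pi>)"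
        using big.rho_scale[OF \<sigma> big.rho_in[OF \<pi> u]] big.rho_comp[OF \<sigma> \<pi> u]
        by (simp add: sign_comp_permutes[OF \<sigma> \<pi>])
    qed simp
    show "(\<Sum>\<pi>\<in>C. ?f (\<sigma> \<circ> \<pi>)) = scale (of_int (sign \<sigma>)) (\<rho>' \<sigma> (alternator scale \<rho>' C u))"
      unfolding A B ..
  qed simp
  finally show ?thesis .
qed

text \<open>Permutations of the old and of the new points commute, having disjoint supports. This is
  what makes the comparison of spaces of equivariant maps respect the action on the old
  points.\<close>

lemma alternator_column_perm:
  assumes \<sigma>: "\<sigma> permutes {1..N}" and u: "u \<in> V (N + d)"
  shows "\<kappa> (\<rho>' \<sigma> u) = \<rho>' \<sigma> (\<kappa> u)"
proof -
  have \<sigma>': "\<sigma> permutes {1..N + d}"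
    by (rule permutes_subset[OF \<sigma>]) auto
  have "\<sigma> \<circ> \<pi> \<circ> inv \<sigma> = \<pi>" if "\<pi> \<in> K" for \<pi>
  proof -
    have \<pi>: "\<pi> permutes {N + 1..N + d}"
      using that by simp
    have "\<sigma> (\<pi> x) = \<pi> (\<sigma> x)" for x
    proof (cases "x \<in> {1..N}")
      case True
      then have "\<pi> x = x" "\<pi> (\<sigma> x) = \<sigma> x"
        using permutes_not_in[OF \<pi>] permutes_in_image[OF \<sigma>, of x] by auto
      then show ?thesis
        by simp
    next
      case False
      then have "\<sigma> x = x"
        using permutes_not_in[OF \<sigma>] by blast
      moreover have "\<pi> x \<notin> {1..N}"
        using False permutes_in_image[OF \<pi>, of x] permutes_not_in[OF \<pi>, of x]
        by (cases "x \<in> {N + 1..N + d}") auto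
      ultimately show ?thesis
        using permutes_not_in[OF \<sigma>] by simp
    qed
    then show ?thesis
      using permutes_inverses(1)[OF \<sigma>] by (simp add: fun_eq_iff)
  qed
  then have "(\<lambda>\<pi>. \<sigma> \<circ> \<pi> \<circ> inv \<sigma>) ` K = K"
    by force
  moreover have "K \<subseteq> {\<pi>. \<pi> permutes {1..N + d}}"
    using K_perm by blast
  ultimately show ?thesis
    using big.rho_alternator[OF \<sigma>' _ u] by metis
qed

lemma alternator_in_K: "u \<in> V (N + d) \<Longrightarrow> \<kappa> u \<in> V (N + d)"
  using K_perm by (intro big.alternator_in) blast+

lemma hom_alternator:
  assumes \<psi>: "\<psi> \<in> Hom'" and u: "u \<in> V (N + d)"
  shows "\<psi> (\<kappa>' u) = alternator fun_scale tabloid_act C' (\<psi> u)"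
  using C'_perm by (intro alternator_hom[OF big.sym_rep_axioms sym_rep_specht' \<psi> _ u]) blast

text \<open>By irreducibility a nonzero \<psi> is onto and takes the value \<open>e'\<close>. The
  antisymmetrizer multiplies \<open>e'\<close> by the order of \<open>C'\<close>, so \<psi> \<circ>
  \<kappa>' is not zero, and this must show on the spanning set.\<close>

lemma exists_generator:
  assumes \<psi>: "\<psi> \<in> Hom'" and ne: "\<psi> \<noteq> 0"
  shows "\<exists>m x \<alpha>. (m, x) \<in> S \<and> \<alpha> \<in> FI_hom d m (N + d) \<and>
    \<psi> (\<kappa>' (act m (N + d) \<alpha> x)) \<noteq> 0"
proof (rule ccontr)
  assume none: "\<not> ?thesis"
  interpret S': sym_rep fun_scale "N + d" tabloid_act specht'
    by (rule sym_rep_specht')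
  have C': "C' \<subseteq> {\<pi>. \<pi> permutes {1..N + d}}"
    using C'_perm by blast
  have lin: "linear_on scale fun_scale (V (N + d)) (\<lambda>u. \<psi> (\<kappa>' u))"
    using big.alternator_linear[OF C'] big.alternator_in[OF C'] hom_spaceD(3)[OF \<psi>]
    by (simp add: linear_on_def)
  have zero: "\<psi> (\<kappa>' 0) = 0"
    by (rule linear_on_zero[OF lin subspace_V vector_space_axioms S'.vector_space_axioms])
  have "V (N + d) \<subseteq> {u \<in> V (N + d). \<psi> (\<kappa>' u) = 0}"
  proof (subst (1) gen, rule span_minimal)
    show "{act m (N + d) \<alpha> x |m x \<alpha>. (m, x) \<in> S \<and> \<alpha> \<in> FI_hom d m (N + d)} \<subseteq>
        {u \<in> V (N + d). \<psi> (\<kappa>' u) = 0}"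
      using none S act_in by blast
    show "subspace {u \<in> V (N + d). \<psi> (\<kappa>' u) = 0}"
      using lin zero subspace_V[of "N + d"] by (auto simp: subspace_def linear_on_def)
  qed
  then have all0: "\<psi> (\<kappa>' u) = 0" if "u \<in> V (N + d)" for u
    using that by blast
  obtain u where "u \<in> V (N + d)" "\<psi> u \<noteq> 0"
    using ne hom_spaceD(2)[OF \<psi>] by (metis ext zero_fun_apply)
  then have "\<psi> ` V (N + d) \<noteq> {0}"
    by blast
  then have "\<psi> ` V (N + d) = specht'"
    using irreducible_specht[OF sorted(2), where 'k='k] big.subrep_image[OF sym_rep_specht' \<psi>]
    unfolding irreducible_rep_def sum_\<mu>' by blast
  then obtain u where u: "u \<in> V (N + d)" "\<psi> u = e'"
    using polytabloid_in_specht[OF t'_tableau] by (metis imageE)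
  have "fun_scale (of_nat (card C')) e' = 0"
    using all0[OF u(1)] unfolding hom_alternator[OF \<psi> u(1)] u(2) alternator_polytabloid[OF t'_tableau] .
  then show False
    using card_column_stabilizer[where 'k='k, of \<mu>' t'] polytabloid_nonzero[OF t'_tableau, where 'a='k]
    by simp
qed

text \<open>Both points lie outside the image of \<alpha> and have the same colour, so their
  transposition fixes \<alpha> and therefore the vector. It is an odd element of
  \<open>C'\<close>.\<close>

lemma alternator_repeated_colour:
  assumes \<alpha>: "\<alpha> \<in> FI_hom d m (N + d)" and x: "x \<in> V m"
    and p: "(i, j) \<in> D'" "(i', j) \<in> D'" "i \<noteq> i'"
    and off: "t' (i, j) \<notin> fst \<alpha> ` {1..m}" "t' (i', j) \<notin> fst \<alpha> ` {1..m}"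
    and colour: "snd \<alpha> (t' (i, j)) = snd \<alpha> (t' (i', j))"
  shows "\<kappa>' (act m (N + d) \<alpha> x) = 0"
proof -
  define a b where ab: "a = t' (i, j)" "b = t' (i', j)"
  define \<tau> where "\<tau> = transpose a b"
  have ne: "a \<noteq> b"
    unfolding ab using tableau_eq_iff[OF t'_tableau p(1,2)] p(3) by simp
  have abin: "a \<in> {1..N + d}" "b \<in> {1..N + d}"
    unfolding ab using tableau_in[OF t'_tableau] p(1,2) unfolding sum_\<mu>' by blast+
  have \<tau>p: "\<tau> permutes {1..N + d}"
    unfolding \<tau>_def by (rule permutes_swap_id[OF abin])
  have \<tau>: "\<tau> \<in> C'"
    unfolding column_stabilizer_iff[OF t'_tableau]
  proof (intro conjI ballI)
    show "\<tau> permutes {1..sum_list \<mu>'}"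
      using \<tau>p by (simp add: sum_\<mu>')
    fix y assume y: "y \<in> D'"
    consider "y = (i, j)" | "y = (i', j)" | "t' y \<noteq> a" "t' y \<noteq> b"
      unfolding ab using tableau_eq_iff[OF t'_tableau y] p(1,2) by blast
    then show "\<exists>y'\<in>D'. \<tau> (t' y) = t' y' \<and> snd y' = snd y"
    proof cases
      case 1
      then show ?thesis
        using p(2) by (intro bexI[of _ "(i', j)"]) (auto simp: \<tau>_def ab)
    next
      case 2
      then show ?thesis
        using p(1) by (intro bexI[of _ "(i, j)"]) (auto simp: \<tau>_def ab)
    next
      case 3
      then show ?thesis
        using y by (intro bexI[of _ y]) (auto simp: \<tau>_def)
    qed
  qed
  have "FI_comp m (N + d) (N + d) (FI_perm (N + d) \<tau>) \<alpha> = \<alpha>"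
  proof (rule FI_hom_eqI[OF FI_comp_in_hom[OF FI_perm_in_hom[OF \<tau>p] \<alpha>] \<alpha>])
    show fst: "fst (FI_comp m (N + d) (N + d) (FI_perm (N + d) \<tau>) \<alpha>) z = fst \<alpha> z" if "z \<in> {1..m}" for z
    proof -
      have "fst \<alpha> z \<noteq> a" "fst \<alpha> z \<noteq> b"
        using off that unfolding ab by (metis imageI)+
      then show ?thesis
        unfolding fst_FI_comp_perm[OF \<alpha> that] by (simp add: \<tau>_def)
    qed
    fix y assume y: "y \<in> {1..N + d}"
      "y \<notin> fst (FI_comp m (N + d) (N + d) (FI_perm (N + d) \<tau>) \<alpha>) ` {1..m}"
    then have y': "y \<notin> fst \<alpha> ` {1..m}"
      using fst by (metis image_cong)
    then have "\<tau> y \<notin> fst \<alpha> ` {1..m}" "snd \<alpha> (\<tau> y) = snd \<alpha> y"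
      using off colour unfolding ab[symmetric] \<tau>_def transpose_def by auto
    moreover have "\<tau> y \<in> {1..N + d}" "\<tau> (\<tau> y) = y"
      using permutes_in_image[OF \<tau>p] y(1) by (auto simp: \<tau>_def)
    ultimately show "snd (FI_comp m (N + d) (N + d) (FI_perm (N + d) \<tau>) \<alpha>) y = snd \<alpha> y"
      using snd_FI_comp_perm[OF \<tau>p \<alpha>, of "\<tau> y"] by simp
  qed
  then have "\<rho>' \<tau> (act m (N + d) \<alpha> x) = act m (N + d) \<alpha> x"
    unfolding perm_act_act[OF \<tau>p \<alpha> x] by simp
  moreover have "sign \<tau> = -1"
    using ne by (simp add: \<tau>_def sign_swap_id)
  ultimately show ?thesis
    by (intro big.alternator_eq_0[OF C'_group \<tau> _ act_in[OF \<alpha> x]])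
qed

text \<open>
  As \<open>m \<le> l\<close>, some column of height \<open>d\<close> avoids the image of \<open>\<alpha>\<close>, and it contains every colour,
  since a repeated colour would be killed by \<open>\<kappa>'\<close>. Sorting the colours in this column changes the value
  of \<open>\<psi> \<circ> \<kappa>'\<close> by a sign, and swapping the column with the inserted one does not change it, since
  that value is a multiple of a polytabloid.
\<close>

lemma exists_inserted:
  assumes \<psi>: "\<psi> \<in> Hom'" and \<alpha>: "\<alpha> \<in> FI_hom d m (N + d)" and x: "x \<in> V m" and m: "m \<le> l"
    and ne: "\<psi> (\<kappa>' (act m (N + d) \<alpha> x)) \<noteq> 0"
  shows "\<exists>y\<in>V N. \<psi> (\<kappa>' (iota y)) \<noteq> 0"
proof -
  let ?b = "act m (N + d) \<alpha> x"
  have b: "?b \<in> V (N + d)"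
    by (rule act_in[OF \<alpha> x])
  obtain j where j: "c \<le> j" "\<And>i. i < d \<Longrightarrow> (i, j) \<in> D'" "\<And>i. i < d \<Longrightarrow> t' (i, j) \<notin> fst \<alpha> ` {1..m}"
    using free_column[of "fst \<alpha> ` {1..m}"] m card_image_le[of "{1..m}" "fst \<alpha>"] by auto
  \<comment> \<open>Colours start at 1 and rows at 0: \<open>g i\<close> is the row of the inserted
    column that belongs to the colour of the point in row \<open>i\<close>.\<close>
  define g where "g i = snd \<alpha> (t' (i, j)) - 1" for i
  have colour: "snd \<alpha> (t' (i, j)) \<in> {1..d}" if "i < d" for i
    using tableau_in[OF t'_tableau j(2)[OF that]] j(3)[OF that]
    unfolding sum_\<mu>' by (rule snd_FI_hom[OF \<alpha>])
  have g: "g i < d" "snd \<alpha> (t' (i, j)) = g i + 1" if "i < d" for i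
    using colour[OF that] by (auto simp: g_def)
  have "inj_on g {..<d}"
  proof (rule inj_onI)
    fix i i' assume i: "i \<in> {..<d}" "i' \<in> {..<d}" "g i = g i'"
    show "i = i'"
    proof (rule ccontr)
      assume "i \<noteq> i'"
      then have "\<kappa>' ?b = 0"
        using i g j by (intro alternator_repeated_colour[OF \<alpha> x, of i j i']) auto
      then show False
        using ne hom_spaceD(3)[OF \<psi>] linear_on_zero[OF hom_spaceD(3)[OF \<psi>] subspace_V
            vector_space_axioms vector_space_fun_scale] by simp
    qed
  qed
  then have g_bij: "bij_betw g {..<d} {..<d}"
    using g(1) by (metis bij_betw_def endo_inj_surj finite_lessThan image_subsetI lessThan_iff)
  obtain \<pi> where \<pi>: "\<pi> \<in> C'" "\<And>i. i < d \<Longrightarrow> \<pi> (t' (i, j)) = t' (g i, j)"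
    using permute_column[OF j(1,2) g_bij] by blast
  obtain \<tau> where \<tau>: "\<tau> permutes {1..N + d}" "\<And>i. i < d \<Longrightarrow> \<tau> (t' (i, j)) = N + 1 + i"
    "column_stabilizer \<mu>' (\<tau> \<circ> t') = C'" "tabloid \<mu>' (\<tau> \<circ> t') = tabloid \<mu>' t'"
    using swap_columns[OF j(1,2)] by blast
  have \<pi>p: "\<pi> permutes {1..N + d}"
    by (rule C'_perm[OF \<pi>(1)])
  \<comment> \<open>\<pi> sorts the colours within column \<open>j\<close>, then \<tau> exchanges
    this column with the inserted one. Together they send the point of colour \<open>q\<close> in
    column \<open>j\<close> to N + q, as required by \<open>FI_block\<close>.\<close>
  define \<sigma> where "\<sigma> = \<tau> \<circ> \<pi>"
  have \<sigma>: "\<sigma> permutes {1..N + d}"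
    unfolding \<sigma>_def by (rule permutes_compose[OF \<pi>p \<tau>(1)])
  have \<sigma>t: "\<sigma> (t' (i, j)) = N + 1 + g i" if "i < d" for i
    using \<pi>(2)[OF that] \<tau>(2)[OF g(1)[OF that]] by (simp add: \<sigma>_def)
  have hit: "\<exists>i<d. y = \<sigma> (t' (i, j)) \<and> y = N + 1 + g i" if y: "y \<in> {1..N + d}" "y \<notin> {1..N}" for y
  proof -
    have "y - N - 1 \<in> g ` {..<d}"
      using y bij_betw_imp_surj_on[OF g_bij] by auto
    then obtain i where "i < d" "g i = y - N - 1"
      by auto
    then show ?thesis
      using y \<sigma>t[of i] by auto
  qed
  define \<alpha>' where "\<alpha>' = FI_comp m (N + d) (N + d) (FI_perm (N + d) \<sigma>) \<alpha>"
  have \<alpha>': "\<alpha>' \<in> FI_hom d m (N + d)"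
    unfolding \<alpha>'_def by (rule FI_comp_in_hom[OF FI_perm_in_hom[OF \<sigma>] \<alpha>])
  have block: "fst (FI_block d N) ` {1..N} = {1..N}"
    by (simp add: FI_block_def)
  have "\<exists>\<beta>\<in>FI_hom d m N. \<alpha>' = FI_comp m N (N + d) (FI_block d N) \<beta>"
  proof (rule FI_factor_right[OF \<alpha>' FI_block_in_hom])
    show "fst \<alpha>' ` {1..m} \<subseteq> fst (FI_block d N) ` {1..N}"
      unfolding block
    proof
      fix y assume y: "y \<in> fst \<alpha>' ` {1..m}"
      then obtain z where z: "z \<in> {1..m}" "y = fst \<alpha>' z"
        by blast
      have yz: "y = \<sigma> (fst \<alpha> z)"
        unfolding z(2) \<alpha>'_def by (rule fst_FI_comp_perm[OF \<alpha> z(1)])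
      show "y \<in> {1..N}"
      proof (rule ccontr)
        assume "y \<notin> {1..N}"
        then obtain i where "i < d" "y = \<sigma> (t' (i, j))"
          using hit y fst_FI_hom_image[OF \<alpha>'] by blast
        then have "fst \<alpha> z = t' (i, j)" "i < d"
          using yz injD[OF permutes_inj[OF \<sigma>]] by metis+
        then show False
          using j(3) z(1) by (metis imageI)
      qed
    qed
    fix y assume y: "y \<in> {1..N + d}" "y \<notin> fst (FI_block d N) ` {1..N}"
    then obtain i where i: "i < d" "y = \<sigma> (t' (i, j))" "y = N + 1 + g i"
      using hit unfolding block by blast
    have "snd \<alpha>' y = snd \<alpha> (t' (i, j))"
      unfolding \<alpha>'_def i(2)
      using tableau_in[OF t'_tableau j(2)[OF i(1)]] j(3)[OF i(1)] unfolding sum_\<mu>'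
      by (rule snd_FI_comp_perm[OF \<sigma> \<alpha>])
    then show "snd \<alpha>' y = snd (FI_block d N) y"
      using g[OF i(1)] i(3) by (simp add: FI_block_def)
  qed
  then obtain \<beta> where \<beta>: "\<beta> \<in> FI_hom d m N" "\<alpha>' = FI_comp m N (N + d) (FI_block d N) \<beta>"
    by blast
  define y where "y = act m N \<beta> x"
  have y: "y \<in> V N"
    unfolding y_def by (rule act_in[OF \<beta>(1) x])
  have "iota y = act m (N + d) \<alpha>' x"
    unfolding iota_def y_def \<beta>(2) by (rule act_comp[OF FI_block_in_hom \<beta>(1) x, symmetric])
  also have "\<dots> = \<rho>' \<sigma> ?b"
    unfolding \<alpha>'_def by (rule perm_act_act[OF \<sigma> \<alpha> x, symmetric])
  also have "\<dots> = \<rho>' \<tau> (\<rho>' \<pi> ?b)"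
    unfolding \<sigma>_def by (rule big.rho_comp[OF \<tau>(1) \<pi>p b])
  finally have iy: "iota y = \<rho>' \<tau> (\<rho>' \<pi> ?b)" .
  have \<pi>b: "\<rho>' \<pi> ?b \<in> V (N + d)"
    by (rule big.rho_in[OF \<pi>p b])
  have C': "C' \<subseteq> {\<pi>. \<pi> permutes {1..N + d}}"
    using C'_perm by blast
  have kb: "\<kappa>' ?b \<in> V (N + d)"
    by (rule big.alternator_in[OF C' b])
  \<comment> \<open>\<tau> permutes the columns of \<open>t'\<close> among themselves, hence
    normalizes \<open>C'\<close>.\<close>
  have "(\<lambda>\<pi>. \<tau> \<circ> \<pi> \<circ> inv \<tau>) ` C' = C'"
    using column_stabilizer_comp[OF t'_tableau, of \<tau>] \<tau>(1,3) by (simp add: sum_\<mu>')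
  then have "\<kappa>' (iota y) = \<rho>' \<tau> (\<kappa>' (\<rho>' \<pi> ?b))"
    using big.rho_alternator[OF \<tau>(1) C' \<pi>b] unfolding iy by simp
  also have "\<dots> = \<rho>' \<tau> (scale (of_int (sign \<pi>)) (\<kappa>' ?b))"
    by (simp add: big.alternator_rho[OF C'_group \<pi>(1) b])
  finally have "\<psi> (\<kappa>' (iota y)) =
      fun_scale (of_int (sign \<pi>)) (tabloid_act \<tau> (\<psi> (\<kappa>' ?b)))"
    using hom_spaceD(3)[OF \<psi>] hom_spaceD(4)[OF \<psi> \<tau>(1) kb] big.rho_scale[OF \<tau>(1) kb]
      big.rho_in[OF \<tau>(1) kb] by (simp add: linear_on_def)
  moreover obtain a where a: "\<psi> (\<kappa>' ?b) = fun_scale a e'"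
    using alternator_specht[OF sorted(2) t'_tableau hom_spaceD(1)[OF \<psi> b]]
    unfolding hom_alternator[OF \<psi> b] by blast
  moreover have "tabloid_act \<tau> (fun_scale a e') = fun_scale a e'"
  proof -
    have "tabloid_act \<tau> e' = polytabloid \<mu>' (\<tau> \<circ> t')"
      using \<tau>(1) by (intro tabloid_act_polytabloid[OF t'_tableau]) (simp add: sum_\<mu>')
    also have "\<dots> = e'"
      unfolding polytabloid_eq_alternator \<tau>(3,4) ..
    finally show ?thesis
      using sym_rep.rho_scale[OF sym_rep_tabloid_act \<tau>(1) UNIV_I, of a e'] by simp
  qed
  ultimately have "\<psi> (\<kappa>' (iota y)) =
      fun_scale (of_int (sign \<pi>)) (\<psi> (\<kappa>' ?b))"
    by simp
  then have "\<psi> (\<kappa>' (iota y)) \<noteq> 0"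
    using ne by (simp add: vector_space.scale_eq_0_iff[OF vector_space_fun_scale])
  then show ?thesis
    using y by blast
qed

end

context column_insertion
begin

lemma delete_column_add: "delete_column (v + w) = delete_column v + delete_column w"
  by (auto simp: delete_column_def fun_eq_iff)

lemma delete_column_scale: "delete_column (fun_scale a v) = fun_scale a (delete_column v)"
  by (auto simp: delete_column_def fun_scale_def fun_eq_iff)

end

context FI_column_insertion
begin

text \<open>
  The map \<open>\<Phi>\<close> below sends equivariant maps \<open>V (N + d) \<rightarrow> S\<^sup>\<mu>\<^sup>'\<close> to equivariant maps \<open>V N \<rightarrow> S\<^sup>\<mu>\<close>. The
  projection \<open>P\<close> is needed because \<open>delete_column\<close> takes values in all tabloids, not in \<open>S\<^sup>\<mu>\<close>.
\<close>

theorem multiplicity_le: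
  assumes fin: "\<And>n. finite_dimensional scale (V n)"
  shows "specht_multiplicity \<mu>' scale (perm_act act (sum_list \<mu>')) (V (sum_list \<mu>')) \<le>
    specht_multiplicity \<mu> scale (perm_act act (sum_list \<mu>)) (V (sum_list \<mu>))"
proof -
  let ?specht = "specht \<mu> :: ((nat \<Rightarrow> nat set) \<Rightarrow> 'k) set"
  let ?Hom = "hom_space N scale \<rho> (V N) fun_scale tabloid_act ?specht"
  interpret M: sym_rep "fun_scale :: 'k \<Rightarrow> _" N tabloid_act UNIV
    by (rule sym_rep_tabloid_act)
  have sub: "subrep fun_scale N tabloid_act UNIV ?specht"
    using subrep_specht[of \<mu>] by (simp add: N_def)
  obtain P where P: "P \<in> hom_space N fun_scale tabloid_act UNIV fun_scale tabloid_act ?specht"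
    "\<And>x. x \<in> ?specht \<Longrightarrow> P x = x"
    using M.maschke[OF sub] by blast
  have P_add: "P (v + w) = P v + P w" and P_scale: "P (fun_scale a v) = fun_scale a (P v)" for v w a
    using hom_spaceD(3)[OF P(1)] by (auto simp: linear_on_def)
  define \<Phi> where "\<Phi> \<psi> = (\<lambda>z. if z \<in> V N
    then P (delete_column (\<psi> (\<kappa> (iota z)))) else 0)" for \<psi>
  have Kperm: "K \<subseteq> {\<pi>. \<pi> permutes {1..N + d}}"
    using K_perm by blast
  have kV: "\<kappa> (iota z) \<in> V (N + d)" if "z \<in> V N" for z
    by (rule alternator_in_K[OF iota_in[OF that]])
  have iota_lin: "linear_on scale scale (V N) iota"
    unfolding iota_def by (rule act_linear[OF FI_block_in_hom])
  have k_add: "\<kappa> (iota (y + z)) =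
      \<kappa> (iota y) + \<kappa> (iota z)"
    if "y \<in> V N" "z \<in> V N" for y z
    using iota_lin big.alternator_linear[OF Kperm] iota_in that by (simp add: linear_on_def)
  have k_scale: "\<kappa> (iota (scale a z)) = scale a (\<kappa> (iota z))"
    if "z \<in> V N" for a z
    using iota_lin big.alternator_linear[OF Kperm] iota_in that by (simp add: linear_on_def)
  have \<Phi>_hom: "\<Phi> \<psi> \<in> ?Hom" if \<psi>: "\<psi> \<in> Hom'" for \<psi>
    unfolding \<Phi>_def
  proof (rule small.restrict_in_hom_space)
    show "P (delete_column (\<psi> (\<kappa> (iota z)))) \<in> ?specht" for z
      by (rule hom_spaceD(1)[OF P(1) UNIV_I])
    show "linear_on scale fun_scale (V N) (\<lambda>z. P (delete_column (\<psi> (\<kappa> (iota z)))))"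
      unfolding linear_on_def
    proof (intro conjI ballI allI)
      fix y z assume yz: "y \<in> V N" "z \<in> V N"
      have "\<psi> (\<kappa> (iota (y + z))) =
          \<psi> (\<kappa> (iota y)) + \<psi> (\<kappa> (iota z))"
        using hom_spaceD(3)[OF \<psi>] kV yz unfolding k_add[OF yz] linear_on_def by blast
      then show "P (delete_column (\<psi> (\<kappa> (iota (y + z))))) =
          P (delete_column (\<psi> (\<kappa> (iota y)))) +
          P (delete_column (\<psi> (\<kappa> (iota z))))"
        by (simp only: delete_column_add P_add)
    next
      fix a z assume z: "z \<in> V N"
      have "\<psi> (\<kappa> (iota (scale a z))) = fun_scale a (\<psi> (\<kappa> (iota z)))"
        using hom_spaceD(3)[OF \<psi>] kV z unfolding k_scale[OF z] linear_on_def by blast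
      then show "P (delete_column (\<psi> (\<kappa> (iota (scale a z))))) =
          fun_scale a (P (delete_column (\<psi> (\<kappa> (iota z)))))"
        by (simp only: delete_column_scale P_scale)
    qed
    fix \<sigma> z assume \<sigma>: "\<sigma> permutes {1..N}" and z: "z \<in> V N"
    have \<sigma>': "\<sigma> permutes {1..N + d}"
      by (rule permutes_subset[OF \<sigma>]) auto
    show "P (delete_column (\<psi> (\<kappa> (iota (\<rho> \<sigma> z))))) =
        tabloid_act \<sigma> (P (delete_column (\<psi> (\<kappa> (iota z)))))"
      unfolding iota_perm[OF \<sigma> z] alternator_column_perm[OF \<sigma> iota_in[OF z]]
        hom_spaceD(4)[OF \<psi> \<sigma>' kV[OF z]] delete_column_act[OF \<sigma>] hom_spaceD(4)[OF P(1) \<sigma> UNIV_I] ..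
  qed
  have \<Phi>_linear: "linear_on (hom_scale fun_scale) (hom_scale fun_scale) Hom' \<Phi>"
    unfolding linear_on_def
  proof (intro conjI ballI allI)
    fix f g :: "'v \<Rightarrow> (nat \<Rightarrow> nat set) \<Rightarrow> 'k"
    show "\<Phi> (f + g) = \<Phi> f + \<Phi> g"
    proof
      fix z
      show "\<Phi> (f + g) z = (\<Phi> f + \<Phi> g) z"
        unfolding \<Phi>_def plus_fun_apply[of f g] delete_column_add P_add by simp
    qed
  next
    fix a and f :: "'v \<Rightarrow> (nat \<Rightarrow> nat set) \<Rightarrow> 'k"
    show "\<Phi> (hom_scale fun_scale a f) = hom_scale fun_scale a (\<Phi> f)"
    proof
      fix z
      show "\<Phi> (hom_scale fun_scale a f) z = hom_scale fun_scale a (\<Phi> f) z"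
        unfolding \<Phi>_def hom_scale_def delete_column_scale P_scale by (simp add: fun_scale_def fun_eq_iff)
    qed
  qed
  have \<Phi>_inj: "\<psi> = 0" if \<psi>: "\<psi> \<in> Hom'" and zero: "\<Phi> \<psi> = 0" for \<psi>
  proof (rule ccontr)
    assume "\<psi> \<noteq> 0"
    then obtain m x \<alpha> where "(m, x) \<in> S" "\<alpha> \<in> FI_hom d m (N + d)"
      "\<psi> (\<kappa>' (act m (N + d) \<alpha> x)) \<noteq> 0"
      using exists_generator[OF \<psi>] by blast
    then obtain y where y: "y \<in> V N" "\<psi> (\<kappa>' (iota y)) \<noteq> 0"
      using exists_inserted[OF \<psi>] S deg by blast
    obtain a where a: "\<psi> (\<kappa>' (iota y)) = fun_scale a e'"
      using alternator_specht[OF sorted(2) t'_tableau hom_spaceD(1)[OF \<psi> iota_in[OF y(1)]]]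
      unfolding hom_alternator[OF \<psi> iota_in[OF y(1)]] by blast
    have "a \<noteq> 0"
      using y(2) a by (auto simp: fun_scale_def zero_fun_def)
    \<comment> \<open>Antisymmetrizing over \<open>C\<close> completes \<kappa> to \<kappa>', so at
      \<open>z\<close> the map \<psi> \<circ> \<kappa> \<circ> \<open>iota\<close> has the known
      value, a nonzero multiple of \<open>e'\<close>. Deleting the column leaves the same multiple
      of the polytabloid of \<open>t\<close>, which \<open>P\<close> fixes.\<close>
    define z where "z = alternator scale \<rho> C y"
    have z: "z \<in> V N"
      unfolding z_def using C_perm(1) by (intro small.alternator_in y) blast
    have "\<psi> (\<kappa> (iota z)) = fun_scale a e'"
      using a unfolding z_def iota_alternator[OF y(1)] alternator_product[OF iota_in[OF y(1)]] .
    then have "\<Phi> \<psi> z = P (delete_column (fun_scale a e'))"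
      using z by (simp add: \<Phi>_def)
    also have "\<dots> = fun_scale a (polytabloid \<mu> t)"
      unfolding delete_column_scale delete_column_polytabloid P_scale
      by (simp add: P(2)[OF polytabloid_in_specht[OF t]])
    finally have "fun_scale a (polytabloid \<mu> t) = (0 :: _ \<Rightarrow> 'k)"
      using zero by simp
    then show False
      using \<open>a \<noteq> 0\<close> polytabloid_nonzero[OF t, where 'a='k]
      by (simp add: vector_space.scale_eq_0_iff[OF vector_space_fun_scale])
  qed
  have fs: "vector_space (hom_scale fun_scale :: 'k \<Rightarrow> ('v \<Rightarrow> _) \<Rightarrow> _)"
    by (rule vector_space_hom_scale[OF vector_space_fun_scale])
  obtain A where A: "finite A" "A \<subseteq> Hom'" "module.independent (hom_scale fun_scale) A"
    "card A = specht_multiplicity \<mu>' scale \<rho>' (V (N + d))"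
    using specht_multiplicity_basis[OF sorted(2), of scale \<rho>' "V (N + d)"] big.sym_rep_axioms fin
    unfolding sum_\<mu>' by blast
  obtain B where B: "finite B" "?Hom \<subseteq> module.span (hom_scale fun_scale) B"
    "card B = specht_multiplicity \<mu> scale \<rho> (V N)"
    using specht_multiplicity_basis[OF sorted(1), of scale \<rho> "V N"] small.sym_rep_axioms fin
    unfolding N_def[symmetric] by blast
  have "card A \<le> card B"
  proof (rule card_le_of_injective[OF fs fs _ \<Phi>_linear \<Phi>_inj A(1-3) B(1)])
    show "module.subspace (hom_scale fun_scale) Hom'"
      by (rule subspace_hom_space[OF big.sym_rep_axioms sym_rep_specht'])
    show "\<Phi> ` Hom' \<subseteq> module.span (hom_scale fun_scale) B"
      using \<Phi>_hom B(2) by blast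
  qed
  then show ?thesis
    unfolding A(4) B(3) sum_\<mu>' N_def .
qed

end

lemma eventually_constant_of_decreasing:
  fixes f :: "nat \<Rightarrow> nat"
  assumes "\<And>n. n \<ge> n0 \<Longrightarrow> f (Suc n) \<le> f n"
  shows "\<exists>c. \<forall>\<^sub>F n in sequentially. f n = c"
proof -
  obtain n1 where n1: "n1 \<ge> n0" "\<And>n. n \<ge> n0 \<Longrightarrow> f n1 \<le> f n"
    using ex_has_least_nat[of "\<lambda>n. n \<ge> n0" n0 f] by blast
  have "f n \<le> f n1" if "n \<ge> n1" for n
    using that
  proof (induction n rule: dec_induct)
    case (step n)
    then show ?case
      using assms[of n] n1(1) by simp
  qed simp
  then have "f n = f n1" if "n \<ge> n1" for n
    using that n1 by (meson le_antisym order_trans)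
  then show ?thesis
    unfolding eventually_sequentially by blast
qed

context FI_module_char_0
begin

text \<open>Passing from \<open>l\<close> to l + 1 lengthens the \<open>d\<close> padded rows by one
  cell each. The hypothesis on \<open>ns\<close> gives these rows length at least
  \<open>first_part \<nu> + l\<close>, while the rows of \<nu> are at most
  \<open>first_part \<nu>\<close> long; so \<open>first_part \<nu>\<close> is the index of the
  inserted column.\<close>

lemma padded_multiplicity_stable:
  assumes fg: finitely_generated and d: "d \<ge> 1"
    and \<nu>: "is_partition \<nu>" and ns: "length ns = d" "sorted_wrt (\<ge>) ns"
      "\<And>m. m \<in> set ns \<Longrightarrow> m \<ge> sum_list \<nu> + first_part \<nu>"
  shows "\<exists>c. \<forall>\<^sub>F l in sequentially. padded_multiplicity scale d V act \<nu> (map (\<lambda>m. m + l) ns) = c"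
proof -
  obtain S where S: "finite S" "S \<subseteq> Sigma UNIV V"
    "\<forall>n. V n = span {act m n \<alpha> x |m x \<alpha>. (m, x) \<in> S \<and> \<alpha> \<in> FI_hom d m n}"
    using finitely_generated_span[OF fg] by blast
  obtain l0 where l0: "\<forall>m\<in>fst ` S. m \<le> l0"
    using finite_nat_set_iff_bounded_le[of "fst ` S"] S(1) by auto
  define \<mu> where "\<mu> l = map (\<lambda>m. m + l - sum_list \<nu>) ns @ \<nu>" for l
  have first: "y \<le> first_part \<nu>" if "y \<in> set \<nu>" for y
    using that \<nu> by (cases \<nu>) (auto simp: is_partition_def first_part_def)
  have \<mu>_sorted: "sorted_wrt (\<ge>) (\<mu> l)" for l
  proof -
    have "sorted_wrt (\<ge>) (map (\<lambda>m. m + l - sum_list \<nu>) ns)"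
      unfolding sorted_wrt_map by (rule sorted_wrt_mono_rel[OF _ ns(2)]) auto
    moreover have "y \<le> m + l - sum_list \<nu>" if "m \<in> set ns" "y \<in> set \<nu>" for m y
      using first[OF that(2)] ns(3)[OF that(1)] by simp
    ultimately show ?thesis
      using \<nu> by (auto simp: \<mu>_def sorted_wrt_append is_partition_def)
  qed
  have padded: "padded_partition \<nu> (map (\<lambda>m. m + l) ns) = \<mu> l" if "l \<ge> 1" for l
  proof -
    have "m + l - sum_list \<nu> \<noteq> 0" if "m \<in> set ns" for m
      using ns(3)[OF that] \<open>l \<ge> 1\<close> by simp
    moreover have "y \<noteq> 0" if "y \<in> set \<nu>" for y
      using \<nu> that by (metis is_partition_def)
    ultimately have "\<forall>y\<in>set (\<mu> l). y \<noteq> 0"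
      unfolding \<mu>_def by (auto simp: not_le)
    then show ?thesis
      by (simp add: padded_partition_def \<mu>_def comp_def flip: filter_append)
  qed
  have mult: "padded_multiplicity scale d V act \<nu> (map (\<lambda>m. m + l) ns) =
      specht_multiplicity (\<mu> l) scale (perm_act act (sum_list (\<mu> l))) (V (sum_list (\<mu> l)))"
    if "l \<ge> 1" for l
  proof -
    have "sum_list (padded_partition \<nu> (map (\<lambda>m. m + l) ns)) =
        sum_list (map (\<lambda>m. m + l) ns) - (d - 1) * sum_list \<nu>"
      using sum_list_padded_partition[of "map (\<lambda>m. m + l) ns" \<nu>] ns d by fastforce
    then show ?thesis
      by (simp add: padded_multiplicity_def Let_def padded[OF that])
  qed
  show ?thesis
  proof (rule eventually_constant_of_decreasing)
    \<comment> \<open>l \<ge> 1 makes all padded parts nonzero, so \<open>padded_partition\<close>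
      drops none of them; l \<ge> l0 puts all generators in degrees at most
      \<open>l\<close>.\<close>
    fix l assume l: "l \<ge> max 1 l0"
    obtain t where t: "tableau (\<mu> l) t"
      using exists_tableau by blast
    have nth: "\<mu> l ! i = ns ! i + l - sum_list \<nu>" "sum_list \<nu> + first_part \<nu> \<le> ns ! i" if "i < d" for i l
      using that ns(1,3) by (auto simp: \<mu>_def nth_append)
    have nth': "\<mu> l ! i = \<nu> ! (i - d)" if "d \<le> i" for i l
      using that ns(1) by (simp add: \<mu>_def nth_append)
    interpret FI_column_insertion scale d V act "\<mu> l" "\<mu> (Suc l)" "first_part \<nu>" l t S
    proof
      show "length (\<mu> (Suc l)) = length (\<mu> l)" "d \<le> length (\<mu> l)"
        using ns(1) by (simp_all add: \<mu>_def)
      show "\<mu> (Suc l) ! i = \<mu> l ! i + 1" "first_part \<nu> + l \<le> \<mu> l ! i" if "i < d" for i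
        using nth[OF that] by auto
      show "\<mu> (Suc l) ! i = \<mu> l ! i" "\<mu> l ! i \<le> first_part \<nu>" if "d \<le> i" "i < length (\<mu> l)" for i
      proof -
        have "i - d < length \<nu>"
          using that ns(1) by (simp add: \<mu>_def)
        then show "\<mu> (Suc l) ! i = \<mu> l ! i" "\<mu> l ! i \<le> first_part \<nu>"
          using first[OF nth_mem] unfolding nth'[OF that(1)] by blast+
      qed
      show "m \<le> l" if "(m, x) \<in> S" for m x
        using l0 that l by force
    qed (use \<mu>_sorted t S in auto)
    show "padded_multiplicity scale d V act \<nu> (map (\<lambda>m. m + Suc l) ns) \<le>
        padded_multiplicity scale d V act \<nu> (map (\<lambda>m. m + l) ns)"
      using multiplicity_le[OF finitely_generated_finite_dimensional[OF fg]] l mult[of l] mult[of "Suc l"]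
      by simp
  qed
qed

end

theorem theorem1:
  fixes scale :: "'k::field_char_0 \<Rightarrow> 'v::ab_group_add \<Rightarrow> 'v"
    and d :: nat
    and V :: "nat \<Rightarrow> 'v set"
    and act :: "nat \<Rightarrow> nat \<Rightarrow> fi_mor \<Rightarrow> 'v \<Rightarrow> 'v"
  assumes "d \<ge> 1"
    and "FI_module scale d V act"
  shows "FI_module.finitely_generated scale d V act \<longleftrightarrow>
    (\<forall>n. finite_dimensional scale (V n)) \<and>
    (\<forall>\<^sub>F n in sequentially. (\<Inter>i\<in>{1..d}. {x \<in> V n. phi act i n x = 0}) = {0}) \<and>
    (\<forall>\<^sub>F n in sequentially.
      subrep_generated scale (n + 1) (perm_act act (n + 1)) (V (n + 1))
        {\<Sum>i=1..d. phi act i n (x i) |x. \<forall>i\<in>{1..d}. x i \<in> V n} = V (n + 1)) \<and>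
    (\<forall>\<mu> ns. is_partition \<mu> \<and> length ns = d \<and> sorted_wrt (\<ge>) ns \<and>
        (\<forall>m\<in>set ns. m \<ge> sum_list \<mu> + first_part \<mu>) \<longrightarrow>
      (\<exists>c. \<forall>\<^sub>F l in sequentially.
        padded_multiplicity scale d V act \<mu> (map (\<lambda>m. m + l) ns) = c))"
proof -
  interpret FI_module scale d V act
    by fact
  interpret FI_module_char_0 scale d V act ..
  show ?thesis
  proof (intro iffI conjI allI impI; (elim conjE)?)
    assume fg: finitely_generated
    show "finite_dimensional scale (V n)" for n
      by (rule finitely_generated_finite_dimensional[OF fg])
    show "\<forall>\<^sub>F n in sequentially. (\<Inter>i\<in>{1..d}. {x \<in> V n. phi act i n x = 0}) = {0}"
      by (rule finitely_generated_no_torsion[OF fg assms(1)])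
    show "\<forall>\<^sub>F n in sequentially. subrep_generated scale (n + 1) (perm_act act (n + 1)) (V (n + 1))
        {\<Sum>i=1..d. phi act i n (x i) |x. \<forall>i\<in>{1..d}. x i \<in> V n} = V (n + 1)"
      by (rule finitely_generated_phi_span[OF fg])
    show "\<exists>c. \<forall>\<^sub>F l in sequentially. padded_multiplicity scale d V act \<mu> (map (\<lambda>m. m + l) ns) = c"
      if "is_partition \<mu>" "length ns = d" "sorted_wrt (\<ge>) ns"
        "\<forall>m\<in>set ns. m \<ge> sum_list \<mu> + first_part \<mu>" for \<mu> ns
      using padded_multiplicity_stable[OF fg assms(1) that(1-3)] that(4) by blast
  next
    assume "\<forall>n. finite_dimensional scale (V n)"
      "\<forall>\<^sub>F n in sequentially. subrep_generated scale (n + 1) (perm_act act (n + 1)) (V (n + 1))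
        {\<Sum>i=1..d. phi act i n (x i) |x. \<forall>i\<in>{1..d}. x i \<in> V n} = V (n + 1)"
    then show finitely_generated
      by (intro finitely_generatedI) blast+
  qed
qed

end
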